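(* Suppose that there exist $m\ge2$ (distinct) non-degenerate central configurations $\bar\xi_1,\dots,\bar\xi_m$, not antipodal if $m=2$. Then, if $h$ is large enough, the (continuous and surjective) projection map $\pi:X\to\mathcal L$, which satisfies $\pi\circ\mathcal F=\sigma_r\circ\pi$, is also injective. In other words, the dynamics of the refraction billiard admits a topologically chaotic subsystem.
   Context: Fix constants $\omega,\mu,\mathcal E>0$. $D\subset\mathbb R^2$ is a bounded open domain containing the origin, with $\overline D\subset\{z:\|z\|<\sqrt{2\mathcal E}/\omega\}$, whose boundary is a simple closed curve $\partial D=\gamma([0,L])$, with $\gamma:[0,L]\to\mathbb R^2$ an arc-length parametrization of class (at least) $C^1$. For $h>0$ put $V_E(z)=\mathcal E-\frac{\omega^2}{2}\|z\|^2$ (outer potential) and $V_I(z)=\mathcal E+h+\frac{\mu}{\|z\|}$ (inner potential). Let $t(\xi)=\dot\gamma(\xi)$ and let $n(\xi)$ be the outward unit normal to $\partial D$ at $\gamma(\xi)$. Central configurations. $\bar\xi\in[0,L]$ is a central configuration if it is a critical point of $\xi\mapsto\|\gamma(\xi)\|$ and the half-line from the origin through $\gamma(\bar\xi)$ intersects $\partial D$ only at $\gamma(\bar\xi)$; it is non-degenerate if $\gamma$ is $C^2$ near $\bar\xi$ and $\frac{d^2}{d\xi^2}\|\gamma(\xi)\|_{|\xi=\bar\xi}\ne0$. Parameters $\xi_1,\xi_2$ are antipodal if the origin belongs to the segment joining $\gamma(\xi_1)$ and $\gamma(\xi_2)$; two (possibly equal) intervals are not antipodal if no point of the first is antipodal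 to a point of the second. Intervals. Under the hypotheses there are disjoint open intervals $(a_i,b_i)\ni\bar\xi_i$ and compact intervals $I^{(i)}=[\alpha_i,\beta_i]\subset(a_i,b_i)$ with $\alpha_i<\bar\xi_i<\beta_i$, $i\in\mathcal I=\{1,\dots,m\}$, for which $D$ is admissible; these intervals are fixed and, possibly after restricting them, small enough that $\|\gamma(\cdot)\|$ is strictly convex or strictly concave (second derivative of constant non-zero sign) on each $[\alpha_i,\beta_i]$. Admissible means that properties (O), (I), (C) hold. (O) For every $i$ and $\xi_1,\xi_2\in(a_i,b_i)$ there is a unique solution $z_E$ (outer arc), for some $T_E>0$, of $z''=-\omega^2z$, $\frac12\|z'\|^2=V_E(z)$ on $[0,T_E]$, $z\notin D$ on $(0,T_E)$, $z(0)=\gamma(\xi_1)$, $z(T_E)=\gamma(\xi_2)$. (I) For every $i$ there is $j\neq i$ such that both $(a_i,b_i)$ and $(a_j,b_j)$ are not antipodal to $(a_i,b_i)$, and there is $h_0>0$ such that for all $\xi_1,\xi_2$ in two non-antipodal (possibly equal) intervals and all $h>h_0$ there is a unique solution $z_I$ (inner arc), for some $T_I>0$, of $z''=-\mu z/\|z\|^3$, $\frac12\|z'\|^2=V_I(z)$ on $[0,T_I]$, $z\in D$ on $(0,T_I)$, $z(0)=\gamma(\xi_1)$, $z(T_I)=\gamma(\xi_2)$, which is not homotopic in $\mathbb R^2\setminus\{0\}$ (fixed endpoints) to the segment joining its endpoints (if $\xi_1=\xi_2$: Levi-Civita regularized collision-ejection solution). (C) With $NA(i)=\{j:(a_i,b_i),(a_j,b_j)\text{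 not antipodal}\}$, $S_E(\xi_1,\xi_2)=\int_0^{T_E}\|z_E'\|\sqrt{V_E(z_E)}ds$, $S_I(\xi_1,\xi_2;h)=\int_0^{T_I}\|z_I'\|\sqrt{V_I(z_I)}ds$ and $\partial_a,\partial_b$ the partial derivatives in the first and second variable, there is $h_1\ge h_0$ such that for all $h>h_1$, $i$, $\xi_E\in[\alpha_i,\beta_i]$, $\xi_I\in\bigcup_{j\in NA(i)}[\alpha_j,\beta_j]$ one has $(\partial_bS_E(\xi_E,\alpha_i)+\partial_aS_I(\alpha_i,\xi_I;h))(\partial_bS_E(\xi_E,\beta_i)+\partial_aS_I(\beta_i,\xi_I;h))<0$. Return map. For $r\in\mathcal I$ let $\Xi_r^{\pm}=\{(\xi,v):\xi\in I^{(r)},\ v\in\mathbb R^2,\ \frac12\|v\|^2=V_E(\gamma(\xi)),\ \pm\langle n(\xi),v\rangle>0\}$. The refraction map (Snell's law $\sqrt{V_E}\sin\alpha_E=\sqrt{V_I}\sin\alpha_I$) sends $v=a\,t(\xi)+b\,n(\xi)$ with $\|v\|^2=2V_E(\gamma(\xi))$ to $R_\xi(v)=a\,t(\xi)+\mathrm{sgn}(b)\sqrt{2V_I(\gamma(\xi))-a^2}\,n(\xi)$. The map $F$ is defined at $(\xi,v)\in\Xi_r^+$, $r\in\mathcal I$, if: (i) the solution of $z''=-\omega^2z$ with initial data $(\gamma(\xi),v)$ is outside $\overline D$ for $s\in(0,s_1)$ and at time $s_1>0$ has position and velocity $(\gamma(\xi_1),v_1)$ with $(\xi_1,v_1)\in\Xi_r^-$;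 (ii) the (regularized) solution of $z''=-\mu z/\|z\|^3$ with initial data $(\gamma(\xi_1),R_{\xi_1}(v_1))$ stays in $D$ for $s\in(0,s_2)$ and at time $s_2>0$ has position and velocity $(\gamma(\xi_2),R_{\xi_2}(v_2))$ with $(\xi_2,v_2)\in\Xi_{r'}^+$ for some $r'\in NA(r)$. Then $F(\xi,v)=(\xi_2,v_2)$. $X$ is the set of $(\xi,v)$ at which all iterates $F^k$, $k\in\mathbb Z$, are defined, with the Euclidean metric of $\mathbb R^3$, and $\mathcal F=F|_X$. Words. $\mathcal L=\{\underline\ell=(\ell_j)_{j\in\mathbb Z}\in\mathcal I^{\mathbb Z}:\ell_{j+1}\in NA(\ell_j)\ \forall j\}$ with metric $d(\underline\ell,\underline m)=\sum_k\rho(\ell_k,m_k)4^{-|k|}$, $\rho(i,j)=0$ if $i=j$ and $1$ otherwise. Put $\chi(\xi,v)=r$ iff $\xi\in I^{(r)}$ and $\pi(\xi,v)=(\chi(\mathcal F^j(\xi,v)))_{j\in\mathbb Z}$. The shift is $(\sigma_r\underline\ell)_j=\ell_{j+1}$.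
   Formalization: The fixed admissible intervals must lie within some δ>0 (depending only on the billiard and the central configurations) of the points ξ̄_i; strict convexity or concavity of ‖γ‖ on them alone does not exclude extra orbits along direct inner arcs with the same word. *)

theory Defs
  imports "HOL-Analysis.Analysis"
begin

text \<open>
  The Euclidean plane is the type \<^typ>\<open>complex\<close>, so that the Levi-Civita map is squaring.
  The arc-length parametrization of the boundary is a periodic function on the whole line, with
  period the length of the curve; a parameter interval may therefore contain a multiple of the
  length, and parameters are identified when they differ by a multiple of it.
\<close>

record billiard =
  omega :: real
  mu :: real
  energy :: real
  region :: "complex set"
  bdry :: "real \<Rightarrow> complex"
  len :: real

definition C1_curve :: "(real \<Rightarrow> complex) \<Rightarrow> bool" where
  "C1_curve g \<longleftrightarrow> (\<forall>x. g differentiable at x) \<and>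
     continuous_on UNIV (\<lambda>x. vector_derivative g (at x))"

definition C2_near :: "(real \<Rightarrow> complex) \<Rightarrow> real \<Rightarrow> bool" where
  "C2_near g x0 \<longleftrightarrow> (\<exists>U. open U \<and> x0 \<in> U \<and>
     (\<forall>x\<in>U. (\<lambda>y. vector_derivative g (at y)) differentiable at x) \<and>
     continuous_on U (\<lambda>x. vector_derivative (\<lambda>y. vector_derivative g (at y)) (at x)))"

definition refraction_billiard :: "billiard \<Rightarrow> bool" where
  "refraction_billiard B \<longleftrightarrow>
     omega B > 0 \<and> mu B > 0 \<and> energy B > 0 \<and>
     open (region B) \<and> connected (region B) \<and> bounded (region B) \<and> 0 \<in> region B \<and>
     closure (region B) \<subseteq> {z. norm z < sqrt (2 * energy B) / omega B} \<and>
     len B > 0 \<and> frontier (region B) = bdry B ` {0..len B} \<and>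
     (\<forall>x. bdry B (x + len B) = bdry B x) \<and> inj_on (bdry B) {0..<len B} \<and>
     C1_curve (bdry B) \<and> (\<forall>x. norm (vector_derivative (bdry B) (at x)) = 1)"

definition VE :: "billiard \<Rightarrow> complex \<Rightarrow> real" where
  "VE B z = energy B - (omega B)\<^sup>2 / 2 * (norm z)\<^sup>2"

definition VI :: "billiard \<Rightarrow> real \<Rightarrow> complex \<Rightarrow> real" where
  "VI B h z = energy B + h + mu B / norm z"

definition tangent :: "billiard \<Rightarrow> real \<Rightarrow> complex" where
  "tangent B x = vector_derivative (bdry B) (at x)"

definition normal :: "billiard \<Rightarrow> real \<Rightarrow> complex" where
  "normal B x = (THE n. norm n = 1 \<and> n \<bullet> tangent B x = 0 \<and>
     (\<forall>\<^sub>F e in at_right 0. bdry B x + e *\<^sub>R n \<notin> closure (region B)))"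


section \<open>Central configurations\<close>

definition central_configuration :: "billiard \<Rightarrow> real \<Rightarrow> bool" where
  "central_configuration B x \<longleftrightarrow> x \<in> {0..len B} \<and>
     ((\<lambda>y. norm (bdry B y)) has_real_derivative 0) (at x) \<and>
     {s *\<^sub>R bdry B x | s. s \<ge> 0} \<inter> frontier (region B) = {bdry B x}"

definition nondegenerate_cc :: "billiard \<Rightarrow> real \<Rightarrow> bool" where
  "nondegenerate_cc B x \<longleftrightarrow> central_configuration B x \<and> C2_near (bdry B) x \<and>
     deriv (deriv (\<lambda>y. norm (bdry B y))) x \<noteq> 0"

definition antipodal :: "billiard \<Rightarrow> real \<Rightarrow> real \<Rightarrow> bool" where
  "antipodal B x y \<longleftrightarrow> 0 \<in> closed_segment (bdry B x) (bdry B y)"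


section \<open>Outer and inner arcs\<close>

definition is_motion ::
    "(complex \<Rightarrow> complex) \<Rightarrow> real \<Rightarrow> (real \<Rightarrow> complex) \<Rightarrow> (real \<Rightarrow> complex) \<Rightarrow> bool" where
  "is_motion acc T z v \<longleftrightarrow> (\<forall>s\<in>{0..T}.
     (z has_vector_derivative v s) (at s within {0..T}) \<and>
     (v has_vector_derivative acc (z s)) (at s within {0..T}))"

definition outer_motion ::
    "billiard \<Rightarrow> real \<Rightarrow> (real \<Rightarrow> complex) \<Rightarrow> (real \<Rightarrow> complex) \<Rightarrow> bool" where
  "outer_motion B T z v \<longleftrightarrow> is_motion (\<lambda>w. - ((omega B)\<^sup>2 *\<^sub>R w)) T z v"

definition kepler_motion ::
    "billiard \<Rightarrow> real \<Rightarrow> (real \<Rightarrow> complex) \<Rightarrow> (real \<Rightarrow> complex) \<Rightarrow> bool" where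
  "kepler_motion B T z v \<longleftrightarrow> (\<forall>s\<in>{0..T}. z s \<noteq> 0) \<and>
     is_motion (\<lambda>w. - ((mu B / (norm w)^3) *\<^sub>R w)) T z v"

text \<open>
  Levi-Civita regularization at Kepler energy \<open>H = energy B + h\<close>: with \<open>z = u\<^sup>2\<close> and
  \<open>dt = |u|\<^sup>2 d\<sigma>\<close>, the equation \<open>z'' = - mu z / |z|\<^sup>3\<close> on the level
  \<open>|z'|\<^sup>2 / 2 - mu / |z| = H\<close> becomes \<open>u'' = (H / 2) u\<close> on \<open>2 |u'|\<^sup>2 - H |u|\<^sup>2 = mu\<close>, and
  \<open>z' = 2 u u' / |u|\<^sup>2\<close>.  The velocity \<open>v\<close> is left unconstrained at a collision.
\<close>

definition lc_motion ::
    "billiard \<Rightarrow> real \<Rightarrow> real \<Rightarrow> (real \<Rightarrow> complex) \<Rightarrow> (real \<Rightarrow> complex) \<Rightarrow> bool" where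
  "lc_motion B h T z v \<longleftrightarrow> (\<exists>S > 0. \<exists>u u' \<tau>.
     is_motion (\<lambda>w. ((energy B + h) / 2) *\<^sub>R w) S u u' \<and>
     (\<tau> 0 :: real) = 0 \<and> \<tau> S = T \<and>
     (\<forall>\<sigma>\<in>{0..S}.
        2 * (norm (u' \<sigma>))\<^sup>2 - (energy B + h) * (norm (u \<sigma>))\<^sup>2 = mu B \<and>
        (\<tau> has_real_derivative (norm (u \<sigma>))\<^sup>2) (at \<sigma> within {0..S}) \<and>
        z (\<tau> \<sigma>) = (u \<sigma>)\<^sup>2 \<and>
        (u \<sigma> \<noteq> 0 \<longrightarrow> v (\<tau> \<sigma>) = (2 / (norm (u \<sigma>))\<^sup>2) *\<^sub>R (u \<sigma> * u' \<sigma>))))"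

definition inner_motion ::
    "billiard \<Rightarrow> real \<Rightarrow> real \<Rightarrow> (real \<Rightarrow> complex) \<Rightarrow> (real \<Rightarrow> complex) \<Rightarrow> bool" where
  "inner_motion B h T z v \<longleftrightarrow> kepler_motion B T z v \<or> lc_motion B h T z v"

definition outer_arc ::
    "billiard \<Rightarrow> real \<Rightarrow> real \<Rightarrow> real \<Rightarrow> (real \<Rightarrow> complex) \<Rightarrow> (real \<Rightarrow> complex) \<Rightarrow> bool" where
  "outer_arc B x y T z v \<longleftrightarrow> T > 0 \<and> outer_motion B T z v \<and>
     (\<forall>s\<in>{0..T}. (norm (v s))\<^sup>2 / 2 = VE B (z s)) \<and>
     (\<forall>s\<in>{0<..<T}. z s \<notin> region B) \<and> z 0 = bdry B x \<and> z T = bdry B y"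

text \<open>
  The energy relation is required where the velocity is defined, i.e. off collisions.
\<close>

definition inner_arc ::
    "billiard \<Rightarrow> real \<Rightarrow> real \<Rightarrow> real \<Rightarrow> real \<Rightarrow> (real \<Rightarrow> complex) \<Rightarrow> (real \<Rightarrow> complex) \<Rightarrow> bool" where
  "inner_arc B h x y T z v \<longleftrightarrow> T > 0 \<and>
     (if x = y then lc_motion B h T z v \<and> (\<exists>s\<in>{0<..<T}. z s = 0)
      else kepler_motion B T z v \<and>
        \<not> homotopic_paths (- {0}) (\<lambda>s. z (T * s)) (linepath (bdry B x) (bdry B y))) \<and>
     (\<forall>s\<in>{0..T}. z s \<noteq> 0 \<longrightarrow> (norm (v s))\<^sup>2 / 2 = VI B h (z s)) \<and>
     (\<forall>s\<in>{0<..<T}. z s \<in> region B) \<and> z 0 = bdry B x \<and> z T = bdry B y"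

text \<open>
  Motions are functions on the whole line, but only their values on \<open>[0, T]\<close> matter.
\<close>

definition unique_arc ::
    "(real \<Rightarrow> (real \<Rightarrow> complex) \<Rightarrow> (real \<Rightarrow> complex) \<Rightarrow> bool) \<Rightarrow> bool" where
  "unique_arc P \<longleftrightarrow> (\<exists>T z v. P T z v \<and>
     (\<forall>T' z' v'. P T' z' v' \<longrightarrow> T' = T \<and> (\<forall>s\<in>{0..T}. z' s = z s)))"

definition SE :: "billiard \<Rightarrow> real \<Rightarrow> real \<Rightarrow> real" where
  "SE B x y = (THE S. \<exists>T z v. outer_arc B x y T z v \<and>
     S = integral {0..T} (\<lambda>s. norm (v s) * sqrt (VE B (z s))))"

definition SI :: "billiard \<Rightarrow> real \<Rightarrow> real \<Rightarrow> real \<Rightarrow> real" where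
  "SI B h x y = (THE S. \<exists>T z v. inner_arc B h x y T z v \<and>
     S = integral {0..T} (\<lambda>s. norm (v s) * sqrt (VI B h (z s))))"


section \<open>Admissible families of intervals\<close>

text \<open>Indices run over \<open>{..<num J}\<close>.\<close>

record intervals =
  num :: nat
  oleft :: "nat \<Rightarrow> real"
  oright :: "nat \<Rightarrow> real"
  cleft :: "nat \<Rightarrow> real"
  cright :: "nat \<Rightarrow> real"

abbreviation ointerval :: "intervals \<Rightarrow> nat \<Rightarrow> real set" where
  "ointerval J i \<equiv> {oleft J i<..<oright J i}"

abbreviation cinterval :: "intervals \<Rightarrow> nat \<Rightarrow> real set" where
  "cinterval J i \<equiv> {cleft J i..cright J i}"

text \<open>Disjointness is understood modulo the period, hence stated on the curve.\<close>

definition intervals_around :: "billiard \<Rightarrow> intervals \<Rightarrow> (nat \<Rightarrow> real) \<Rightarrow> bool" where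
  "intervals_around B J xi \<longleftrightarrow>
     (\<forall>i<num J. oleft J i < cleft J i \<and> cleft J i < xi i \<and> xi i < cright J i \<and>
        cright J i < oright J i \<and> oright J i - oleft J i \<le> len B) \<and>
     (\<forall>i<num J. \<forall>j<num J. i \<noteq> j \<longrightarrow>
        bdry B ` ointerval J i \<inter> bdry B ` ointerval J j = {})"

definition not_antipodal :: "billiard \<Rightarrow> intervals \<Rightarrow> nat \<Rightarrow> nat \<Rightarrow> bool" where
  "not_antipodal B J i j \<longleftrightarrow>
     (\<forall>x\<in>ointerval J i. \<forall>y\<in>ointerval J j. \<not> antipodal B x y)"

definition NA :: "billiard \<Rightarrow> intervals \<Rightarrow> nat \<Rightarrow> nat set" where
  "NA B J i = {j. j < num J \<and> not_antipodal B J i j}"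

definition outer_property :: "billiard \<Rightarrow> intervals \<Rightarrow> bool" where
  "outer_property B J \<longleftrightarrow> (\<forall>i<num J. \<forall>x\<in>ointerval J i. \<forall>y\<in>ointerval J i.
     unique_arc (outer_arc B x y))"

definition inner_property :: "billiard \<Rightarrow> intervals \<Rightarrow> real \<Rightarrow> bool" where
  "inner_property B J h0 \<longleftrightarrow>
     (\<forall>i<num J. \<exists>j<num J. j \<noteq> i \<and> not_antipodal B J i i \<and> not_antipodal B J j i) \<and>
     (\<forall>i<num J. \<forall>j\<in>NA B J i. \<forall>x\<in>ointerval J i. \<forall>y\<in>ointerval J j. \<forall>h>h0.
        unique_arc (inner_arc B h x y))"

text \<open>The partial derivatives are required to exist.\<close>

definition sign_property :: "billiard \<Rightarrow> intervals \<Rightarrow> real \<Rightarrow> bool" where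
  "sign_property B J h1 \<longleftrightarrow> (\<forall>h>h1. \<forall>i<num J. \<forall>x\<in>cinterval J i.
     \<forall>j\<in>NA B J i. \<forall>y\<in>cinterval J j. \<exists>dE dI dE' dI'.
       ((\<lambda>s. SE B x s) has_real_derivative dE) (at (cleft J i)) \<and>
       ((\<lambda>s. SI B h s y) has_real_derivative dI) (at (cleft J i)) \<and>
       ((\<lambda>s. SE B x s) has_real_derivative dE') (at (cright J i)) \<and>
       ((\<lambda>s. SI B h s y) has_real_derivative dI') (at (cright J i)) \<and>
       (dE + dI) * (dE' + dI') < 0)"

definition admissible :: "billiard \<Rightarrow> intervals \<Rightarrow> bool" where
  "admissible B J \<longleftrightarrow> outer_property B J \<and>
     (\<exists>h0>0. inner_property B J h0 \<and> (\<exists>h1\<ge>h0. sign_property B J h1))"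

definition strictly_curved :: "billiard \<Rightarrow> intervals \<Rightarrow> bool" where
  "strictly_curved B J \<longleftrightarrow> (\<forall>i<num J. \<exists>r2.
     (\<forall>x\<in>cinterval J i. (deriv (\<lambda>y. norm (bdry B y)) has_real_derivative r2 x) (at x)) \<and>
     ((\<forall>x\<in>cinterval J i. r2 x > 0) \<or> (\<forall>x\<in>cinterval J i. r2 x < 0)))"


section \<open>The return map\<close>

type_synonym state = "real \<times> complex"

definition phase :: "billiard \<Rightarrow> intervals \<Rightarrow> real \<Rightarrow> nat \<Rightarrow> state set" where
  "phase B J sg r = {(x, v). x \<in> cinterval J r \<and> (norm v)\<^sup>2 / 2 = VE B (bdry B x) \<and>
     sg * (normal B x \<bullet> v) > 0}"

abbreviation phase_out :: "billiard \<Rightarrow> intervals \<Rightarrow> nat \<Rightarrow> state set" where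
  "phase_out B J \<equiv> phase B J 1"

abbreviation phase_in :: "billiard \<Rightarrow> intervals \<Rightarrow> nat \<Rightarrow> state set" where
  "phase_in B J \<equiv> phase B J (- 1)"

definition refract :: "billiard \<Rightarrow> real \<Rightarrow> real \<Rightarrow> complex \<Rightarrow> complex" where
  "refract B h x v =
     (let a = v \<bullet> tangent B x; b = v \<bullet> normal B x
      in a *\<^sub>R tangent B x + (sgn b * sqrt (2 * VI B h (bdry B x) - a\<^sup>2)) *\<^sub>R normal B x)"

definition outer_step :: "billiard \<Rightarrow> state \<Rightarrow> state \<Rightarrow> bool" where
  "outer_step B p q \<longleftrightarrow> (\<exists>T>0. \<exists>z v. outer_motion B T z v \<and>
     z 0 = bdry B (fst p) \<and> v 0 = snd p \<and>
     (\<forall>s\<in>{0<..<T}. z s \<notin> closure (region B)) \<and>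
     z T = bdry B (fst q) \<and> v T = snd q)"

definition inner_step :: "billiard \<Rightarrow> real \<Rightarrow> state \<Rightarrow> state \<Rightarrow> bool" where
  "inner_step B h p q \<longleftrightarrow> (\<exists>T>0. \<exists>z v. inner_motion B h T z v \<and>
     z 0 = bdry B (fst p) \<and> v 0 = refract B h (fst p) (snd p) \<and>
     (\<forall>s\<in>{0<..<T}. z s \<in> region B) \<and>
     z T = bdry B (fst q) \<and> v T = refract B h (fst q) (snd q))"

text \<open>The graph of the partial return map \<open>F\<close>.\<close>

definition return_rel :: "billiard \<Rightarrow> intervals \<Rightarrow> real \<Rightarrow> state \<Rightarrow> state \<Rightarrow> bool" where
  "return_rel B J h p q \<longleftrightarrow> (\<exists>r<num J. \<exists>p1. \<exists>r'\<in>NA B J r.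
     p \<in> phase_out B J r \<and> outer_step B p p1 \<and> p1 \<in> phase_in B J r \<and>
     inner_step B h p1 q \<and> q \<in> phase_out B J r')"

text \<open>All iterates, of either sign, are defined at \<open>p\<close> iff \<open>p\<close> lies on a bi-infinite orbit.\<close>

definition full_orbits :: "billiard \<Rightarrow> intervals \<Rightarrow> real \<Rightarrow> state set" where
  "full_orbits B J h = {p. \<exists>q :: int \<Rightarrow> state. q 0 = p \<and> (\<forall>k. return_rel B J h (q k) (q (k + 1)))}"

definition return_map :: "billiard \<Rightarrow> intervals \<Rightarrow> real \<Rightarrow> state \<Rightarrow> state" where
  "return_map B J h p = (THE q. return_rel B J h p q)"

definition return_iter :: "billiard \<Rightarrow> intervals \<Rightarrow> real \<Rightarrow> int \<Rightarrow> state \<Rightarrow> state" where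
  "return_iter B J h k =
     (if k \<ge> 0 then return_map B J h ^^ nat k
      else inv_into (full_orbits B J h) (return_map B J h) ^^ nat (- k))"


section \<open>Words and the projection\<close>

type_synonym word = "int \<Rightarrow> nat"

definition words :: "billiard \<Rightarrow> intervals \<Rightarrow> word set" where
  "words B J = {l. \<forall>j. l j < num J \<and> l (j + 1) \<in> NA B J (l j)}"

definition word_dist :: "word \<Rightarrow> word \<Rightarrow> real" where
  "word_dist l l' = (\<Sum>\<^sub>\<infinity>k\<in>UNIV. (if l k = l' k then 0 else 1) / 4 ^ nat \<bar>k\<bar>)"

definition shift :: "word \<Rightarrow> word" where
  "shift l = (\<lambda>j. l (j + 1))"

definition chi :: "intervals \<Rightarrow> state \<Rightarrow> nat" where
  "chi J p = (THE r. r < num J \<and> fst p \<in> cinterval J r)"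

definition proj :: "billiard \<Rightarrow> intervals \<Rightarrow> real \<Rightarrow> state \<Rightarrow> word" where
  "proj B J h p = (\<lambda>j. chi J (return_iter B J h j p))"

lemma summable_4: "(\<lambda>k::int. 1 / 4 ^ nat \<bar>k\<bar> :: real) summable_on UNIV"
proof -
  have g: "(\<lambda>n::nat. 1 / 4 ^ n :: real) summable_on UNIV"
    by (rule norm_summable_imp_summable_on)
       (use summable_geometric[of "1/4::real"] in \<open>simp add: power_one_over\<close>)
  have A: "(\<lambda>k::int. 1 / 4 ^ nat \<bar>k\<bar> :: real) summable_on (int ` UNIV)"
    by (subst summable_on_reindex) (use g in \<open>auto simp: o_def\<close>)
  have B: "(\<lambda>k::int. 1 / 4 ^ nat \<bar>k\<bar> :: real) summable_on ((\<lambda>n. - int n) ` UNIV)"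
    by (subst summable_on_reindex) (use g in \<open>auto simp: o_def inj_on_def\<close>)
  have "UNIV = range int \<union> range (\<lambda>n. - int n)"
    by (auto simp: image_iff) (metis int_cases2)
  then show ?thesis
    using summable_on_union[OF A B] by simp
qed

lemma summable_word_dist:
  "(\<lambda>k::int. (if l k = l' k then 0 else 1 :: real) / 4 ^ nat \<bar>k\<bar>) summable_on UNIV"
  by (rule summable_on_comparison_test[OF summable_4]) auto

lemma Metric_space_words: "Metric_space (words B J) word_dist"
proof
  fix l l' l'' :: word
  show "0 \<le> word_dist l l'"
    unfolding word_dist_def by (rule infsum_nonneg) auto
  show "word_dist l l' = word_dist l' l"
    unfolding word_dist_def by (rule infsum_cong) auto
  show "word_dist l l' = 0 \<longleftrightarrow> l = l'"
  proof
    assume z: "word_dist l l' = 0"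
    have "(if l k = l' k then 0 else 1 :: real) / 4 ^ nat \<bar>k\<bar> = 0" for k
      by (rule nonneg_infsum_le_0D[where A = UNIV])
         (use z summable_word_dist in \<open>auto simp: word_dist_def\<close>)
    then have "l k = l' k" for k
      by (metis divide_eq_0_iff one_neq_zero power_not_zero zero_neq_numeral)
    then show "l = l'" by (simp add: fun_eq_iff)
  qed (simp add: word_dist_def)
  have "word_dist l l'' \<le> (\<Sum>\<^sub>\<infinity>k\<in>UNIV. (if l k = l' k then 0 else 1) / 4 ^ nat \<bar>k\<bar> +
      (if l' k = l'' k then 0 else 1) / 4 ^ nat \<bar>k\<bar>)"
    unfolding word_dist_def
    by (intro infsum_mono summable_on_add summable_word_dist) (auto simp: divide_simps)
  also have "\<dots> = word_dist l l' + word_dist l' l''"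
    unfolding word_dist_def by (rule infsum_add[OF summable_word_dist summable_word_dist])
  finally show "word_dist l l'' \<le> word_dist l l' + word_dist l' l''" .
qed

end

theory Submission
  imports Defs
begin

text \<open>
  An orbit is a sequence of parameters \<open>x\<^sub>n\<close> joined alternately by outer and inner arcs, subject to
  Snell's law at every \<open>x\<^sub>n\<close>: the tangential components of the two velocities agree.  Both kinds of arcs
  are explicit.  Outer arcs are pieces of harmonic ellipses; near a central configuration an almost
  radial one exists, hence is the unique one, and its velocities are smooth in the end points.  Inner
  arcs are hyperbolic sines and cosines in Levi-Civita coordinates.  With \<open>H = energy + h\<close> and
  \<open>\<epsilon> = mu / H\<close>, the initial velocity of an arc winding around the centre is \<open>sqrt (2 H)\<close> times
  \<open>- p / |p| + O(\<epsilon>)\<close>, also in the Lipschitz sense.  Dividing Snell's law by \<open>sqrt (2 H)\<close> gives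
  \<open>\<rho>'(x\<^sub>n) = small\<close>, where \<open>\<rho> = |bdry|\<close> has \<open>\<rho>'' \<noteq> 0\<close>, the right hand side being small with small Lipschitz
  constant in \<open>x\<^bsub>n-1\<^esub>, x\<^sub>n, x\<^bsub>n+1\<^esub>\<close>.  For every word these equations are solved by a contraction, so
  each word has exactly one orbit.  Direct inner arcs do not occur: refraction at a high inner energy
  makes the inner velocity almost normal to the boundary, while a direct arc starts off less
  radially than its chord.
\<close>

subsection \<open>Local Lipschitz continuity at a point\<close>

text \<open>The bound on \<open>h\<close> comes after the intervals: the small terms must also be
  dominated by the values of \<open>\<rho>'\<close> at the interval ends, which shrink with the
  intervals, so that each single equation has a zero. The tangential velocities contain the tangent,
  which is only \<open>C^1\<close> near the central configurations. Bounds and Lipschitz constants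
  are all that the contraction needs, and a Lipschitz calculus at one point delivers both. For inner
  arcs it is applied jointly in \<open>(\<epsilon>, x, y)\<close> at \<open>\<epsilon> = 0\<close>,
  hence uniformly for large \<open>h\<close>. The return map and its inverse are single valued
  because both flows are groups and the two kinds of steps end at first hits. Continuity of both
  comes from a compact set of pairs of states which restricts to their graphs.\<close>

definition loclip :: "('a::metric_space \<Rightarrow> 'b::real_normed_vector) \<Rightarrow> 'a \<Rightarrow> bool" where
  "loclip f a \<longleftrightarrow> (\<exists>C\<ge>0. \<exists>e>0. \<forall>p q. dist p a < e \<longrightarrow> dist q a < e \<longrightarrow>
     norm (f p - f q) \<le> C * dist p q)"

lemma loclipI:
  assumes "e > 0" "\<And>p q. dist p a < e \<Longrightarrow> dist q a < e \<Longrightarrow> norm (f p - f q) \<le> C * dist p q"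
  shows "loclip f a"
proof -
  have "norm (f p - f q) \<le> \<bar>C\<bar> * dist p q" if "dist p a < e" "dist q a < e" for p q
    using assms(2)[OF that] by (smt (verit) mult_right_mono zero_le_dist)
  then show ?thesis
    unfolding loclip_def using assms(1) by (meson abs_ge_zero)
qed

lemma loclipE:
  assumes "loclip f a"
  obtains C e where "C \<ge> 0" "e > 0"
    "\<And>p q. dist p a < e \<Longrightarrow> dist q a < e \<Longrightarrow> norm (f p - f q) \<le> C * dist p q"
  using assms unfolding loclip_def by metis

lemma loclip_isCont:
  assumes "loclip f a"
  shows "isCont f a"
proof -
  obtain C e where C: "C \<ge> 0" "e > 0"
    "\<And>p q. dist p a < e \<Longrightarrow> dist q a < e \<Longrightarrow> norm (f p - f q) \<le> C * dist p q"
    using assms by (rule loclipE) blast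
  have lim: "((\<lambda>p. C * dist p a) \<longlongrightarrow> C * dist a a) (at a)"
    by (intro tendsto_intros)
  have "\<forall>\<^sub>F p in at a. norm (f p - f a) \<le> C * dist p a"
    unfolding eventually_at using C by (metis dist_self)
  then have "((\<lambda>p. f p - f a) \<longlongrightarrow> 0) (at a)"
    by (rule Lim_null_comparison) (use lim in simp)
  then show ?thesis
    by (simp add: isCont_def LIM_zero_iff)
qed

lemma loclip_bounded:
  assumes "loclip f a"
  obtains C M e where "C \<ge> 0" "M \<ge> 0" "e > 0"
    "\<And>p q. dist p a < e \<Longrightarrow> dist q a < e \<Longrightarrow> norm (f p - f q) \<le> C * dist p q"
    "\<And>p. dist p a < e \<Longrightarrow> norm (f p) \<le> M"
proof -
  obtain C e where C: "C \<ge> 0" "e > 0"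
    "\<And>p q. dist p a < e \<Longrightarrow> dist q a < e \<Longrightarrow> norm (f p - f q) \<le> C * dist p q"
    using assms by (rule loclipE) blast
  have "norm (f p) \<le> norm (f a) + C * e" if "dist p a < e" for p
  proof -
    have "norm (f p) \<le> norm (f a) + norm (f p - f a)"
      by (simp add: norm_triangle_sub)
    moreover have "norm (f p - f a) \<le> C * dist p a" using C(2,3) that by auto
    moreover have "C * dist p a \<le> C * e" using C(1) that by (simp add: mult_left_mono)
    ultimately show ?thesis by linarith
  qed
  then show ?thesis
    using C by (intro that[of C "norm (f a) + C * e" e]) auto
qed

lemma loclip_const: "loclip (\<lambda>_. c) a"
  by (rule loclipI[of 1 _ _ 0]) auto

text \<open>The product rule needs local boundedness besides the two Lipschitz bounds. Stating it
  for \<open>bounded_bilinear\<close> covers products, scaling and inner products at once.\<close>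

lemma loclip_bilinear:
  assumes "bounded_bilinear pr" "loclip f a" "loclip g a"
  shows "loclip (\<lambda>x. pr (f x) (g x)) a"
proof -
  interpret bounded_bilinear pr by fact
  obtain K where K: "K > 0" "\<And>u v. norm (pr u v) \<le> norm u * norm v * K"
    using pos_bounded by blast
  obtain C M e where 1: "C \<ge> 0" "M \<ge> 0" "e > 0"
    "\<And>p q. dist p a < e \<Longrightarrow> dist q a < e \<Longrightarrow> norm (f p - f q) \<le> C * dist p q"
    "\<And>p. dist p a < e \<Longrightarrow> norm (f p) \<le> M"
    by (rule loclip_bounded[OF assms(2)]) (rule that)
  obtain C' M' e' where 2: "C' \<ge> 0" "M' \<ge> 0" "e' > 0"
    "\<And>p q. dist p a < e' \<Longrightarrow> dist q a < e' \<Longrightarrow> norm (g p - g q) \<le> C' * dist p q"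
    "\<And>p. dist p a < e' \<Longrightarrow> norm (g p) \<le> M'"
    by (rule loclip_bounded[OF assms(3)]) (rule that)
  show ?thesis
  proof (rule loclipI)
    show "min e e' > 0" using 1 2 by simp
    fix p q assume pq: "dist p a < min e e'" "dist q a < min e e'"
    have "pr (f p) (g p) - pr (f q) (g q) = pr (f p - f q) (g p) + pr (f q) (g p - g q)"
      by (simp add: diff_left diff_right)
    then have "norm (pr (f p) (g p) - pr (f q) (g q))
        \<le> norm (f p - f q) * norm (g p) * K + norm (f q) * norm (g p - g q) * K"
      using K(2) by (smt (verit) norm_triangle_ineq)
    also have "\<dots> \<le> (C * dist p q) * M' * K + M * (C' * dist p q) * K"
      using pq 1 2 K(1) by (intro add_mono mult_mono mult_nonneg_nonneg) auto
    also have "\<dots> = (C * M' * K + M * C' * K) * dist p q"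
      by (simp add: algebra_simps)
    finally show "norm (pr (f p) (g p) - pr (f q) (g q)) \<le> (C * M' * K + M * C' * K) * dist p q" .
  qed
qed

lemmas loclip_mult = loclip_bilinear[OF bounded_bilinear_mult]
lemmas loclip_scaleR = loclip_bilinear[OF bounded_bilinear_scaleR]
lemmas loclip_inner = loclip_bilinear[OF bounded_bilinear_inner]

lemma loclip_add:
  assumes "loclip f a" "loclip g a"
  shows "loclip (\<lambda>x. f x + g x) a"
proof -
  obtain C e where 1: "C \<ge> 0" "e > 0"
    "\<And>p q. dist p a < e \<Longrightarrow> dist q a < e \<Longrightarrow> norm (f p - f q) \<le> C * dist p q"
    using assms(1) by (rule loclipE) blast
  obtain C' e' where 2: "C' \<ge> 0" "e' > 0"
    "\<And>p q. dist p a < e' \<Longrightarrow> dist q a < e' \<Longrightarrow> norm (g p - g q) \<le> C' * dist p q"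
    using assms(2) by (rule loclipE) blast
  show ?thesis
  proof (rule loclipI)
    show "min e e' > 0" using 1 2 by simp
    fix p q assume pq: "dist p a < min e e'" "dist q a < min e e'"
    have "norm (f p + g p - (f q + g q)) \<le> norm (f p - f q) + norm (g p - g q)"
      by (rule norm_diff_triangle_ineq)
    also have "\<dots> \<le> (C + C') * dist p q"
      using pq 1(3)[of p q] 2(3)[of p q] by (simp add: distrib_right)
    finally show "norm (f p + g p - (f q + g q)) \<le> (C + C') * dist p q" .
  qed
qed

lemma loclip_minus: "loclip f a \<Longrightarrow> loclip (\<lambda>x. - f x) a"
  using loclip_scaleR[OF loclip_const[of "-1"], of f a] by (simp only: scaleR_minus1_left)

lemma loclip_diff: "loclip f a \<Longrightarrow> loclip g a \<Longrightarrow> loclip (\<lambda>x. f x - g x) a"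
  using loclip_add[OF _ loclip_minus, of f a g] by simp

lemma loclip_compose:
  fixes g :: "'b::real_normed_vector \<Rightarrow> 'c::real_normed_vector"
  assumes "loclip f a" "loclip g (f a)"
  shows "loclip (\<lambda>x. g (f x)) a"
proof -
  obtain C e where 1: "C \<ge> 0" "e > 0"
    "\<And>p q. dist p a < e \<Longrightarrow> dist q a < e \<Longrightarrow> norm (f p - f q) \<le> C * dist p q"
    using assms(1) by (rule loclipE) blast
  obtain C' e' where 2: "C' \<ge> 0" "e' > 0"
    "\<And>p q. dist p (f a) < e' \<Longrightarrow> dist q (f a) < e' \<Longrightarrow> norm (g p - g q) \<le> C' * dist p q"
    using assms(2) by (rule loclipE) blast
  obtain e2 where e2: "e2 > 0" "\<And>p. dist p a < e2 \<Longrightarrow> dist (f p) (f a) < e'"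
    using loclip_isCont[OF assms(1)] 2(2) unfolding continuous_at_eps_delta by blast
  show ?thesis
  proof (rule loclipI)
    show "min e e2 > 0" using 1 e2 by simp
    fix p q assume pq: "dist p a < min e e2" "dist q a < min e e2"
    have "norm (g (f p) - g (f q)) \<le> C' * norm (f p - f q)"
      using pq e2 2(3) by (simp add: dist_norm)
    also have "\<dots> \<le> C' * (C * dist p q)"
      using pq 1 2(1) by (intro mult_left_mono) auto
    finally show "norm (g (f p) - g (f q)) \<le> C' * C * dist p q"
      by (simp add: algebra_simps)
  qed
qed

lemma loclip_norm: "loclip f a \<Longrightarrow> loclip (\<lambda>x. norm (f x)) a"
proof -
  assume "loclip f a"
  then obtain C e where 1: "C \<ge> 0" "e > 0"
    "\<And>p q. dist p a < e \<Longrightarrow> dist q a < e \<Longrightarrow> norm (f p - f q) \<le> C * dist p q"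
    by (rule loclipE) blast
  show ?thesis
    using 1 by (intro loclipI[of e _ _ C]) (auto intro: order_trans[OF norm_triangle_ineq3])
qed

lemma loclip_fst: "loclip f (fst a) \<Longrightarrow> loclip (\<lambda>x. f (fst x)) a"
proof -
  assume "loclip f (fst a)"
  then obtain C e where 1: "C \<ge> 0" "e > 0"
    "\<And>p q. dist p (fst a) < e \<Longrightarrow> dist q (fst a) < e \<Longrightarrow> norm (f p - f q) \<le> C * dist p q"
    by (rule loclipE) blast
  show ?thesis
  proof (rule loclipI[OF 1(2)])
    fix p q assume "dist p a < e" "dist q a < e"
    then have "norm (f (fst p) - f (fst q)) \<le> C * dist (fst p) (fst q)"
      by (intro 1) (meson dist_fst_le order.strict_trans1)+
    also have "\<dots> \<le> C * dist p q" by (intro mult_left_mono dist_fst_le 1)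
    finally show "norm (f (fst p) - f (fst q)) \<le> C * dist p q" .
  qed
qed

lemma loclip_snd: "loclip f (snd a) \<Longrightarrow> loclip (\<lambda>x. f (snd x)) a"
proof -
  assume "loclip f (snd a)"
  then obtain C e where 1: "C \<ge> 0" "e > 0"
    "\<And>p q. dist p (snd a) < e \<Longrightarrow> dist q (snd a) < e \<Longrightarrow> norm (f p - f q) \<le> C * dist p q"
    by (rule loclipE) blast
  show ?thesis
  proof (rule loclipI[OF 1(2)])
    fix p q assume "dist p a < e" "dist q a < e"
    then have "norm (f (snd p) - f (snd q)) \<le> C * dist (snd p) (snd q)"
      by (intro 1) (meson dist_snd_le order.strict_trans1)+
    also have "\<dots> \<le> C * dist p q" by (intro mult_left_mono dist_snd_le 1)
    finally show "norm (f (snd p) - f (snd q)) \<le> C * dist p q" .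
  qed
qed

lemma loclip_ident: "loclip (\<lambda>x::'a::real_normed_vector. x) a"
  by (rule loclipI[of 1 _ _ 1]) (auto simp: dist_norm)

text \<open>The mean value inequality for \<open>g\<close> minus its linear part on a small ball. A
  derivative continuous at \<open>a\<close> thus controls difference quotients with both points
  moving, which later gives Lipschitz bounds, the strict monotonicity of \<open>rho1\<close> and the
  slope bound for the boundary.\<close>

lemma strict_vector_derivative:
  fixes g :: "real \<Rightarrow> 'b::real_normed_vector"
  assumes "\<forall>\<^sub>F x in nhds a. (g has_vector_derivative g' x) (at x)" "isCont g' a" "k > 0"
  obtains e where "e > 0" "\<And>x y. dist x a < e \<Longrightarrow> dist y a < e \<Longrightarrow>
    norm (g y - g x - (y - x) *\<^sub>R g' a) \<le> k * \<bar>y - x\<bar>"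
proof -
  obtain e1 where e1: "e1 > 0" "\<And>x. dist x a < e1 \<Longrightarrow> (g has_vector_derivative g' x) (at x)"
    using assms(1) unfolding eventually_nhds_metric by blast
  obtain e2 where e2: "e2 > 0" "\<And>x. dist x a < e2 \<Longrightarrow> dist (g' x) (g' a) < k"
    using assms(2,3) unfolding continuous_at_eps_delta by blast
  define e where "e = min e1 e2"
  have e: "e > 0" using e1 e2 by (simp add: e_def)
  show ?thesis
  proof (rule that[OF e])
    fix x y assume xy: "dist x a < e" "dist y a < e"
    have "norm (g y - g x - (y - x) *\<^sub>R g' a) \<le> norm (y - x) * k"
    proof (rule vector_differentiable_bound_linearization[where S = "ball a e"])
      show "closed_segment x y \<subseteq> ball a e"
        using xy by (intro closed_segment_subset convex_ball) (auto simp: dist_commute)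
      show "(g has_vector_derivative g' z) (at z within ball a e)" if "z \<in> ball a e" for z
        using that e1(2)[of z] by (auto simp: e_def dist_commute intro: has_vector_derivative_at_within)
      show "norm (g' z - g' a) \<le> k" if "z \<in> ball a e" for z
        using that e2(2)[of z] by (simp add: e_def dist_commute dist_norm norm_minus_commute)
    qed (use e in auto)
    then show "norm (g y - g x - (y - x) *\<^sub>R g' a) \<le> k * \<bar>y - x\<bar>"
      by (simp add: mult.commute)
  qed
qed

lemma loclip_C1:
  fixes g :: "real \<Rightarrow> 'b::real_normed_vector"
  assumes "\<forall>\<^sub>F x in nhds a. (g has_vector_derivative g' x) (at x)" "isCont g' a"
  shows "loclip g a"
proof -
  obtain e where e: "e > 0" "\<And>x y. dist x a < e \<Longrightarrow> dist y a < e \<Longrightarrow>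
      norm (g y - g x - (y - x) *\<^sub>R g' a) \<le> 1 * \<bar>y - x\<bar>"
    using strict_vector_derivative[OF assms zero_less_one] by blast
  show ?thesis
  proof (rule loclipI[OF e(1)])
    fix p q assume pq: "dist p a < e" "dist q a < e"
    have "norm (g p - g q) \<le> norm (g p - g q - (p - q) *\<^sub>R g' a) + norm ((p - q) *\<^sub>R g' a)"
      by (metis diff_add_cancel norm_triangle_ineq)
    also have "\<dots> \<le> (1 + norm (g' a)) * dist p q"
      using e(2)[OF pq(2,1)] by (simp add: dist_real_def distrib_right mult.commute[of "norm _"])
    finally show "norm (g p - g q) \<le> (1 + norm (g' a)) * dist p q" .
  qed
qed

lemma loclip_inverse:
  fixes f :: "'a::metric_space \<Rightarrow> real"
  assumes "loclip f a" "f a \<noteq> 0"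
  shows "loclip (\<lambda>x. inverse (f x)) a"
proof (rule loclip_compose[OF assms(1)], rule loclip_C1)
  have "\<forall>\<^sub>F x in nhds (f a). x \<noteq> 0"
    using assms(2) by (intro t1_space_nhds)
  then show "\<forall>\<^sub>F x in nhds (f a). (inverse has_vector_derivative - (inverse x ^ Suc (Suc 0))) (at x)"
    by eventually_elim (use DERIV_inverse in \<open>force simp flip: has_real_derivative_iff_has_vector_derivative\<close>)
  show "isCont (\<lambda>x. - (inverse x ^ Suc (Suc 0))) (f a)"
    using assms(2) by (intro continuous_intros) auto
qed

lemma loclip_divide:
  fixes f :: "'a::metric_space \<Rightarrow> real"
  shows "loclip g a \<Longrightarrow> loclip f a \<Longrightarrow> f a \<noteq> 0 \<Longrightarrow> loclip (\<lambda>x. g x / f x) a"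
  unfolding divide_inverse by (intro loclip_mult loclip_inverse)

lemma loclip_power:
  fixes f :: "'a::metric_space \<Rightarrow> real"
  shows "loclip f a \<Longrightarrow> loclip (\<lambda>x. f x ^ n) a"
  by (induction n) (simp_all add: loclip_mult loclip_const)

lemma loclip_sqrt:
  fixes f :: "'a::metric_space \<Rightarrow> real"
  assumes "loclip f a" "f a > 0"
  shows "loclip (\<lambda>x. sqrt (f x)) a"
proof (rule loclip_compose[OF assms(1)], rule loclip_C1)
  have "\<forall>\<^sub>F x in nhds (f a). x > 0"
    using assms(2) by (metis eventually_nhds greaterThan_iff open_greaterThan)
  then show "\<forall>\<^sub>F x in nhds (f a). (sqrt has_vector_derivative inverse (sqrt x) / 2) (at x)"
    by eventually_elim (simp add: DERIV_real_sqrt flip: has_real_derivative_iff_has_vector_derivative)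
  show "isCont (\<lambda>x. inverse (sqrt x) / 2) (f a)"
    using assms(2) by (intro continuous_intros) auto
qed

lemmas loclip_intros = loclip_const loclip_add loclip_diff loclip_minus loclip_mult loclip_scaleR
  loclip_inner loclip_norm loclip_fst loclip_snd loclip_divide loclip_power loclip_sqrt

subsection \<open>Sequences solving contracting equations\<close>

lemma zero_of_increasing:
  fixes F :: "real \<Rightarrow> real"
  assumes "a \<le> b" "continuous_on {a..b} F" "F a \<le> 0" "F b \<ge> 0"
    "\<And>x y. a \<le> x \<Longrightarrow> x \<le> y \<Longrightarrow> y \<le> b \<Longrightarrow> c * (y - x) \<le> F y - F x" "c > 0"
  shows "\<exists>!x. x \<in> {a..b} \<and> F x = 0"
proof -
  have "\<exists>x. a \<le> x \<and> x \<le> b \<and> F x = 0"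
    using assms by (intro IVT') auto
  moreover have "x = y" if "x \<in> {a..b}" "y \<in> {a..b}" "F x = 0" "F y = 0" for x y
  proof -
    have "c * (y - x) \<le> 0" if "x \<le> y" "x \<in> {a..b}" "y \<in> {a..b}" "F x = 0" "F y = 0" for x y
      using assms(5)[of x y] that by auto
    then show ?thesis
      using that assms(6) by (smt (verit) mult_pos_pos)
  qed
  ultimately show ?thesis by fastforce
qed

text \<open>Nearest-neighbour coupling: solving the \<open>n\<close>th equation for the \<open>n\<close>th unknown is a
  contraction of the product of the intervals in the supremum distance.\<close>

lemma contracting_equations:
  fixes a b :: "int \<Rightarrow> real" and F :: "int \<Rightarrow> real \<Rightarrow> real \<Rightarrow> real \<Rightarrow> real"
  assumes ab: "\<And>n. a n \<le> b n" "\<And>n. b n - a n \<le> M" and c: "c > 0"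
    and cont: "\<And>n y z. y \<in> {a (n-1)..b (n-1)} \<Longrightarrow> z \<in> {a (n+1)..b (n+1)} \<Longrightarrow>
      continuous_on {a n..b n} (\<lambda>x. F n x y z)"
    and ends: "\<And>n y z. y \<in> {a (n-1)..b (n-1)} \<Longrightarrow> z \<in> {a (n+1)..b (n+1)} \<Longrightarrow>
      F n (a n) y z \<le> 0 \<and> F n (b n) y z \<ge> 0"
    and mono: "\<And>n x x' y z. y \<in> {a (n-1)..b (n-1)} \<Longrightarrow> z \<in> {a (n+1)..b (n+1)} \<Longrightarrow>
      a n \<le> x \<Longrightarrow> x \<le> x' \<Longrightarrow> x' \<le> b n \<Longrightarrow> c * (x' - x) \<le> F n x' y z - F n x y z"
    and lip: "\<And>n x y z y' z' d. x \<in> {a n..b n} \<Longrightarrow>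
      y \<in> {a (n-1)..b (n-1)} \<Longrightarrow> z \<in> {a (n+1)..b (n+1)} \<Longrightarrow>
      y' \<in> {a (n-1)..b (n-1)} \<Longrightarrow> z' \<in> {a (n+1)..b (n+1)} \<Longrightarrow>
      \<bar>y - y'\<bar> \<le> d \<Longrightarrow> \<bar>z - z'\<bar> \<le> d \<Longrightarrow> \<bar>F n x y z - F n x y' z'\<bar> \<le> c / 2 * d"
  shows "\<exists>!x. \<forall>n. x n \<in> {a n..b n} \<and> F n (x n) (x (n-1)) (x (n+1)) = 0"
proof -
  define sol where "sol n y z = (THE x. x \<in> {a n..b n} \<and> F n x y z = 0)" for n y z
  have sol: "sol n y z \<in> {a n..b n} \<and> F n (sol n y z) y z = 0"
    and sol_eq: "\<And>x. x \<in> {a n..b n} \<Longrightarrow> F n x y z = 0 \<Longrightarrow> x = sol n y z"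
    if "y \<in> {a (n-1)..b (n-1)}" "z \<in> {a (n+1)..b (n+1)}" for n y z
  proof -
    have ex1: "\<exists>!x. x \<in> {a n..b n} \<and> F n x y z = 0"
      by (rule zero_of_increasing[where c = c]) (use that ab cont ends mono c in auto)
    show "sol n y z \<in> {a n..b n} \<and> F n (sol n y z) y z = 0"
      unfolding sol_def by (rule theI'[OF ex1])
    show "x = sol n y z" if "x \<in> {a n..b n}" "F n x y z = 0" for x
      unfolding sol_def using the1_equality[OF ex1, of x] that by auto
  qed
  \<comment> \<open>Inserting the second solution into the first equation leaves an error of at most
    \<open>c / 2 * d\<close>; monotonicity with rate \<open>c\<close> turns it into a distance of at
    most half of \<open>d\<close>.\<close>
  have sol_lip: "\<bar>sol n y z - sol n y' z'\<bar> \<le> d / 2"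
    if y: "y \<in> {a (n-1)..b (n-1)}" "z \<in> {a (n+1)..b (n+1)}"
      "y' \<in> {a (n-1)..b (n-1)}" "z' \<in> {a (n+1)..b (n+1)}" and d: "\<bar>y - y'\<bar> \<le> d" "\<bar>z - z'\<bar> \<le> d"
    for n y z y' z' d
  proof -
    have key: "c * \<bar>x - x'\<bar> \<le> \<bar>F n x y z - F n x' y z\<bar>"
      if "x \<in> {a n..b n}" "x' \<in> {a n..b n}" for x x'
      using mono[OF y(1,2), of x x'] mono[OF y(1,2), of x' x] that
      by (cases "x \<le> x'") (auto simp: abs_real_def)
    have "c * \<bar>sol n y z - sol n y' z'\<bar> \<le> \<bar>F n (sol n y z) y z - F n (sol n y' z') y z\<bar>"
      by (rule key) (use sol y in auto)
    also have "\<dots> = \<bar>F n (sol n y' z') y' z' - F n (sol n y' z') y z\<bar>"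
      using sol y by simp
    also have "\<dots> \<le> c / 2 * d"
      by (rule lip) (use sol y d in \<open>auto simp: abs_minus_commute\<close>)
    finally show ?thesis using c by (simp add: field_simps)
  qed
  define X where "X = {x::int \<Rightarrow> real. \<forall>n. x n \<in> {a n..b n}}"
  define \<Phi> where "\<Phi> x n = sol n (x (n-1)) (x (n+1))" for x :: "int \<Rightarrow> real" and n
  have \<Phi>X: "\<Phi> x \<in> X" if "x \<in> X" for x
    using that sol by (auto simp: X_def \<Phi>_def)
  have \<Phi>lip: "\<bar>\<Phi> x n - \<Phi> y n\<bar> \<le> d / 2" if "x \<in> X" "y \<in> X" "\<And>n. \<bar>x n - y n\<bar> \<le> d" for x y d n
    unfolding \<Phi>_def by (rule sol_lip) (use that in \<open>auto simp: X_def\<close>)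
  have iff: "(\<forall>n. x n \<in> {a n..b n} \<and> F n (x n) (x (n-1)) (x (n+1)) = 0) \<longleftrightarrow> x \<in> X \<and> \<Phi> x = x" for x
  proof
    assume A: "\<forall>n. x n \<in> {a n..b n} \<and> F n (x n) (x (n-1)) (x (n+1)) = 0"
    then show "x \<in> X \<and> \<Phi> x = x"
    proof (intro conjI ext)
      fix n
      show "\<Phi> x n = x n"
        unfolding \<Phi>_def using A by (intro sol_eq[symmetric]) auto
    qed (auto simp: X_def)
  next
    assume x: "x \<in> X \<and> \<Phi> x = x"
    show "\<forall>n. x n \<in> {a n..b n} \<and> F n (x n) (x (n-1)) (x (n+1)) = 0"
    proof
      fix n
      have "x n = sol n (x (n-1)) (x (n+1))"
        using x by (metis \<Phi>_def)
      then show "x n \<in> {a n..b n} \<and> F n (x n) (x (n-1)) (x (n+1)) = 0"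
        using sol[of "x (n-1)" n "x (n+1)"] x unfolding X_def by simp
    qed
  qed
  \<comment> \<open>The iteration starts at the left end points. \<open>M\<close> bounds the
    supremum distance of any two points of \<open>X\<close>, hence the rate \<open>M / 2 ^ k\<close>
    for all later iterates at once.\<close>
  define it where "it k = (\<Phi> ^^ k) a" for k
  have itX: "it k \<in> X" for k
    by (induction k) (use ab \<Phi>X in \<open>auto simp: it_def X_def\<close>)
  have M: "\<bar>x n - y n\<bar> \<le> M" if "x \<in> X" "y \<in> X" for x y n
  proof -
    have "x n \<in> {a n..b n}" "y n \<in> {a n..b n}" using that by (auto simp: X_def)
    then show ?thesis using ab(2)[of n] by (simp add: abs_le_iff)
  qed
  have step: "\<bar>it k n - it (k + j) n\<bar> \<le> M / 2 ^ k" for k j n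
  proof (induction k arbitrary: j n)
    case 0
    show ?case using M[OF itX itX] by simp
  next
    case (Suc k)
    have "\<bar>\<Phi> (it k) n - \<Phi> (it (k + j)) n\<bar> \<le> (M / 2 ^ k) / 2"
      by (rule \<Phi>lip[OF itX itX Suc])
    then show ?case by (simp add: it_def)
  qed
  have M0: "M \<ge> 0" using ab[of 0] by simp
  have cau: "Cauchy (\<lambda>k. it k n)" for n
  proof (rule metric_CauchyI)
    fix e :: real assume "e > 0"
    then obtain N where N: "M / 2 ^ N < e / 2"
    proof -
      obtain N where N: "(1/2) ^ N < e / (2 * (M + 1))"
        using M0 \<open>e > 0\<close> real_arch_pow_inv[of "e / (2 * (M + 1))" "1/2"] by auto
      have "M * (1/2) ^ N \<le> (M + 1) * (1/2) ^ N"
        by (intro mult_right_mono) auto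
      also have "\<dots> < (M + 1) * (e / (2 * (M + 1)))"
        using N M0 by (intro mult_strict_left_mono) auto
      also have "\<dots> = e / 2" using M0 by (simp add: field_simps)
      finally show ?thesis using that[of N] by (simp add: power_one_over)
    qed
    have "dist (it k n) (it l n) < e" if "k \<ge> N" "l \<ge> N" for k l
    proof -
      have "\<bar>it N n - it k n\<bar> \<le> M / 2 ^ N" "\<bar>it N n - it l n\<bar> \<le> M / 2 ^ N"
        using step[of N n "k - N"] step[of N n "l - N"] that by auto
      then show ?thesis using N unfolding dist_real_def by linarith
    qed
    then show "\<exists>M. \<forall>m\<ge>M. \<forall>k\<ge>M. dist (it m n) (it k n) < e"
      by (intro exI[of _ N]) auto
  qed
  then obtain x where x: "\<And>n. (\<lambda>k. it k n) \<longlonglongrightarrow> x n"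
    unfolding Cauchy_convergent_iff convergent_def by metis
  have xX: "x \<in> X"
  proof -
    have "x n \<in> {a n..b n}" for n
      by (rule closed_sequentially[OF _ _ x]) (use itX in \<open>auto simp: X_def\<close>)
    then show ?thesis by (simp add: X_def)
  qed
  have near: "\<bar>it k n - x n\<bar> \<le> M / 2 ^ k" for k n
  proof (rule LIMSEQ_le_const2)
    show "(\<lambda>j. \<bar>it k n - it (j + k) n\<bar>) \<longlonglongrightarrow> \<bar>it k n - x n\<bar>"
      using LIMSEQ_ignore_initial_segment[OF x] by (intro tendsto_intros)
    show "\<exists>N. \<forall>j\<ge>N. \<bar>it k n - it (j + k) n\<bar> \<le> M / 2 ^ k"
      using step by (metis add.commute)
  qed
  have fixx: "\<Phi> x = x"
  proof
    fix n
    have "\<bar>\<Phi> x n - it (Suc k) n\<bar> \<le> M / 2 ^ k / 2" for k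
      using \<Phi>lip[OF xX itX, of k "M / 2 ^ k" n] near[of k]
      by (simp add: it_def abs_minus_commute)
    moreover have "M / 2 ^ k / 2 \<le> M * (1/2) ^ k" for k
      using M0 by (simp add: power_one_over field_simps)
    ultimately have "\<bar>\<Phi> x n - it (Suc k) n\<bar> \<le> M * (1/2) ^ k" for k
      using order_trans by blast
    moreover have "(\<lambda>k. \<bar>\<Phi> x n - it (Suc k) n\<bar>) \<longlonglongrightarrow> \<bar>\<Phi> x n - x n\<bar>"
      by (rule tendsto_rabs[OF tendsto_diff[OF tendsto_const LIMSEQ_Suc[OF x]]])
    moreover have "(\<lambda>k. M * (1/2) ^ k) \<longlonglongrightarrow> 0"
      by (intro tendsto_mult_right_zero LIMSEQ_power_zero) auto
    ultimately have "\<bar>\<Phi> x n - x n\<bar> \<le> 0"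
      by (meson LIMSEQ_le)
    then show "\<Phi> x n = x n" by simp
  qed
  have uniq: "y = x" if y: "y \<in> X" "\<Phi> y = y" for y
  proof -
    have "\<bar>y n - x n\<bar> \<le> M / 2 ^ k" for k n
    proof (induction k arbitrary: n)
      case 0
      show ?case using M[OF y(1) xX] by simp
    next
      case (Suc k)
      then show ?case
        using \<Phi>lip[OF y(1) xX Suc, of n] fixx y(2) by (simp add: mult.commute)
    qed
    then have le: "\<bar>y n - x n\<bar> \<le> M * (1/2) ^ k" for k n
      by (simp add: power_one_over)
    have "(\<lambda>k. M * (1/2) ^ k) \<longlonglongrightarrow> 0"
      by (intro tendsto_mult_right_zero LIMSEQ_power_zero) auto
    then have "\<bar>y n - x n\<bar> \<le> 0" for n
      using le by (meson LIMSEQ_le_const)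
    then show ?thesis by (simp add: fun_eq_iff)
  qed
  show ?thesis
    unfolding iff using xX fixx uniq by blast
qed

subsection \<open>Linear flows\<close>

lemma zero_derivative_constant:
  fixes f :: "real \<Rightarrow> 'a::real_normed_vector"
  assumes "\<And>s. s \<in> {0..T} \<Longrightarrow> (f has_vector_derivative 0) (at s within {0..T})" "s \<in> {0..T}"
  shows "f s = f 0"
  using assms by (intro has_derivative_zero_unique[where s = "{0..T}"])
    (auto simp: has_vector_derivative_def)

text \<open>The flow of \<open>z'' = - om^2 z\<close> on pairs (position, velocity). It is defined
  for all times and is a group, so a state can be carried back beyond the start of a motion given
  only on \<open>[0, T]\<close>.\<close>

definition osc_flow :: "real \<Rightarrow> real \<Rightarrow> complex \<times> complex \<Rightarrow> complex \<times> complex" where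
  "osc_flow om s a = (cos (om * s) *\<^sub>R fst a + (sin (om * s) / om) *\<^sub>R snd a,
     cos (om * s) *\<^sub>R snd a - (om * sin (om * s)) *\<^sub>R fst a)"

text \<open>The flow of \<open>u'' = k^2 u\<close>, which is the Levi-Civita equation when
  \<open>k = lc_rate B h\<close>.\<close>

definition hyp_flow :: "real \<Rightarrow> real \<Rightarrow> complex \<times> complex \<Rightarrow> complex \<times> complex" where
  "hyp_flow k s a = (cosh (k * s) *\<^sub>R fst a + (sinh (k * s) / k) *\<^sub>R snd a,
     cosh (k * s) *\<^sub>R snd a + (k * sinh (k * s)) *\<^sub>R fst a)"

lemma osc_flow_0: "osc_flow om 0 a = a"
  by (simp add: osc_flow_def)

lemma hyp_flow_0: "hyp_flow k 0 a = a"
  by (simp add: hyp_flow_def)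

lemma osc_flow_add:
  assumes "om \<noteq> 0"
  shows "osc_flow om (s + t) a = osc_flow om s (osc_flow om t a)"
  using assms by (simp add: osc_flow_def cos_add sin_add distrib_left scaleR_add_right
    scaleR_diff_right scaleR_add_left scaleR_diff_left divide_simps)
    (simp add: algebra_simps add_divide_distrib)

lemma hyp_flow_add:
  assumes "k \<noteq> 0"
  shows "hyp_flow k (s + t) a = hyp_flow k s (hyp_flow k t a)"
  using assms by (simp add: hyp_flow_def cosh_add sinh_add distrib_left scaleR_add_right
    scaleR_diff_right scaleR_add_left scaleR_diff_left divide_simps)
    (simp add: algebra_simps add_divide_distrib)

lemma hyp_flow_minus: "hyp_flow k s (- a) = - hyp_flow k s a"
  by (simp add: hyp_flow_def algebra_simps)

text \<open>Variation of constants: \<open>f\<close> and \<open>g\<close> are the components of the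
  state at time \<open>s\<close> carried back to time 0 by the flow. Their derivatives vanish, so
  uniqueness for this linear equation needs no Gronwall estimate.\<close>

lemma outer_motion_flow:
  assumes "outer_motion B T z v" "omega B \<noteq> 0" "s \<in> {0..T}"
  shows "(z s, v s) = osc_flow (omega B) s (z 0, v 0)"
proof -
  define om where "om = omega B"
  have om: "om \<noteq> 0" using assms by (simp add: om_def)
  have dz: "(z has_vector_derivative v s) (at s within {0..T})"
    and dv: "(v has_vector_derivative - (om\<^sup>2 *\<^sub>R z s)) (at s within {0..T})" if "s \<in> {0..T}" for s
    using assms(1) that unfolding outer_motion_def is_motion_def om_def by auto
  define f where "f s = cos (om * s) *\<^sub>R z s - (sin (om * s) / om) *\<^sub>R v s" for s
  define g where "g s = cos (om * s) *\<^sub>R v s + (om * sin (om * s)) *\<^sub>R z s" for s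
  have "(f has_vector_derivative 0) (at s within {0..T})" if "s \<in> {0..T}" for s
    unfolding f_def
    using om by (auto intro!: derivative_eq_intros dz[OF that] dv[OF that] simp: power2_eq_square algebra_simps)
  then have f: "f s = z 0" using zero_derivative_constant[of T f s] assms(3) by (simp add: f_def)
  have "(g has_vector_derivative 0) (at s within {0..T})" if "s \<in> {0..T}" for s
    unfolding g_def
    using om by (auto intro!: derivative_eq_intros dz[OF that] dv[OF that] simp: power2_eq_square algebra_simps)
  then have g: "g s = v 0" using zero_derivative_constant[of T g s] assms(3) by (simp add: g_def)
  have "osc_flow om (- s) (z s, v s) = (z 0, v 0)"
    using f g by (simp add: osc_flow_def f_def g_def)
  then show ?thesis
    using osc_flow_add[OF om, of s "- s" "(z s, v s)"] by (simp add: osc_flow_0 om_def)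
qed

lemma outer_motion_osc_flow:
  assumes "omega B \<noteq> 0"
  shows "outer_motion B T (\<lambda>s. fst (osc_flow (omega B) s a)) (\<lambda>s. snd (osc_flow (omega B) s a))"
  unfolding outer_motion_def is_motion_def
proof (intro ballI conjI)
  fix s :: real
  show "((\<lambda>s. fst (osc_flow (omega B) s a)) has_vector_derivative snd (osc_flow (omega B) s a))
      (at s within {0..T})"
    unfolding osc_flow_def fst_conv
    using assms by (auto intro!: derivative_eq_intros simp: algebra_simps)
  show "((\<lambda>s. snd (osc_flow (omega B) s a)) has_vector_derivative
      - ((omega B)\<^sup>2 *\<^sub>R fst (osc_flow (omega B) s a))) (at s within {0..T})"
    unfolding osc_flow_def snd_conv
    using assms by (auto intro!: derivative_eq_intros simp: algebra_simps power2_eq_square)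
qed

lemma outer_motion_energy:
  assumes "outer_motion B T z v" "s \<in> {0..T}"
  shows "(norm (v s))\<^sup>2 / 2 - VE B (z s) = (norm (v 0))\<^sup>2 / 2 - VE B (z 0)"
proof -
  have dz: "(z has_vector_derivative v s) (at s within {0..T})"
    and dv: "(v has_vector_derivative - ((omega B)\<^sup>2 *\<^sub>R z s)) (at s within {0..T})"
    if "s \<in> {0..T}" for s
    using assms(1) that unfolding outer_motion_def is_motion_def by auto
  define f where "f s = (v s \<bullet> v s) / 2 + (omega B)\<^sup>2 / 2 * (z s \<bullet> z s)" for s
  have "(f has_vector_derivative 0) (at s within {0..T})" if "s \<in> {0..T}" for s
  proof -
    have "((\<lambda>s. v s \<bullet> v s) has_vector_derivative
        v s \<bullet> (- ((omega B)\<^sup>2 *\<^sub>R z s)) + (- ((omega B)\<^sup>2 *\<^sub>R z s)) \<bullet> v s) (at s within {0..T})"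
      by (rule bounded_bilinear.has_vector_derivative[OF bounded_bilinear_inner dv[OF that] dv[OF that]])
    moreover have "((\<lambda>s. z s \<bullet> z s) has_vector_derivative z s \<bullet> v s + v s \<bullet> z s) (at s within {0..T})"
      by (rule bounded_bilinear.has_vector_derivative[OF bounded_bilinear_inner dz[OF that] dz[OF that]])
    ultimately show ?thesis
      unfolding f_def has_real_derivative_iff_has_vector_derivative[symmetric]
      by (auto intro!: derivative_eq_intros simp: inner_commute)
  qed
  from zero_derivative_constant[OF this assms(2)] show ?thesis
    by (simp add: f_def VE_def dot_square_norm)
qed

text \<open>The same constancy argument with a time change \<open>sg\<close>: its derivative is
  \<open>1 / norm (z s)\<close> for Kepler motions in physical time and \<open>1\<close> for motions
  already given in Levi-Civita time.\<close>

lemma hyp_flow_solution: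
  fixes u w :: "real \<Rightarrow> complex"
  assumes du: "\<And>s. s \<in> {0..T} \<Longrightarrow> (u has_vector_derivative sg' s *\<^sub>R w s) (at s within {0..T})"
    and dw: "\<And>s. s \<in> {0..T} \<Longrightarrow> (w has_vector_derivative (sg' s * k\<^sup>2) *\<^sub>R u s) (at s within {0..T})"
    and dsg: "\<And>s. s \<in> {0..T} \<Longrightarrow> (sg has_real_derivative sg' s) (at s within {0..T})"
    and "sg 0 = 0" "k \<noteq> 0" "s \<in> {0..T}"
  shows "(u s, w s) = hyp_flow k (sg s) (u 0, w 0)"
proof -
  define f where "f s = cosh (k * sg s) *\<^sub>R u s - (sinh (k * sg s) / k) *\<^sub>R w s" for s
  define g where "g s = cosh (k * sg s) *\<^sub>R w s - (k * sinh (k * sg s)) *\<^sub>R u s" for s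
  have "(f has_vector_derivative 0) (at s within {0..T})" if "s \<in> {0..T}" for s
    unfolding f_def
    using assms(5) by (auto intro!: derivative_eq_intros du[OF that] dw[OF that] dsg[OF that] simp: power2_eq_square algebra_simps)
  then have f: "f s = u 0" using zero_derivative_constant[of T f s] assms(4,6) by (simp add: f_def)
  have "(g has_vector_derivative 0) (at s within {0..T})" if "s \<in> {0..T}" for s
    unfolding g_def
    using assms(5) by (auto intro!: derivative_eq_intros du[OF that] dw[OF that] dsg[OF that] simp: power2_eq_square algebra_simps)
  then have g: "g s = w 0" using zero_derivative_constant[of T g s] assms(4,6) by (simp add: g_def)
  have "hyp_flow k (- sg s) (u s, w s) = (u 0, w 0)"
    using f g by (simp add: hyp_flow_def f_def g_def)
  then show ?thesis
    using hyp_flow_add[OF assms(5), of "sg s" "- sg s" "(u s, w s)"] by (simp add: hyp_flow_0)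
qed

section \<open>First hits of a set along a flow\<close>

definition first_hit :: "(real \<Rightarrow> 'a \<Rightarrow> 'a) \<Rightarrow> 'a set \<Rightarrow> real \<Rightarrow> 'a \<Rightarrow> 'a \<Rightarrow> bool" where
  "first_hit \<phi> Z T a b \<longleftrightarrow> T > 0 \<and> \<phi> T a = b \<and> (\<forall>s\<in>{0<..<T}. \<phi> s a \<notin> Z)"

lemma first_hit_unique:
  assumes "first_hit \<phi> Z T a b" "first_hit \<phi> Z T' a b'" "b \<in> Z" "b' \<in> Z"
  shows "b = b'"
  using assms unfolding first_hit_def
  by (metis greaterThanLessThan_iff less_linear)

text \<open>If \<open>T < T'\<close>, the orbit of \<open>a'\<close> passes through \<open>a\<close>
  at the time \<open>T' - T\<close>, before its first hit, although \<open>a\<close> lies in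
  \<open>Z\<close>. So the durations agree, and the flow is invertible.\<close>

lemma first_hit_unique_start:
  assumes "\<And>a. \<phi> 0 a = a" "\<And>s t a. \<phi> (s + t) a = \<phi> s (\<phi> t a)"
    and "first_hit \<phi> Z T a b" "first_hit \<phi> Z T' a' b" "a \<in> Z" "a' \<in> Z"
  shows "a = a'"
proof -
  have *: False if "first_hit \<phi> Z T a b" "first_hit \<phi> Z T' a' b" "a \<in> Z" "T < T'" for T T' a a'
  proof -
    have "\<phi> (T' - T) a' = \<phi> (- T) (\<phi> T' a')"
      by (simp flip: assms(2))
    also have "\<dots> = \<phi> (- T) (\<phi> T a)"
      using that by (simp add: first_hit_def)
    also have "\<dots> = a"
      by (simp add: assms(1) flip: assms(2))
    finally show False
      using that unfolding first_hit_def by (auto dest: bspec[of _ _ "T' - T"])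
  qed
  have "T = T'"
    using *[OF assms(3,4,5)] *[OF assms(4,3,6)] by (cases T T' rule: linorder_cases) auto
  moreover have "\<phi> (- t) (\<phi> t x) = x" for t x
    using assms(2)[of "- t" t x] by (simp add: assms(1))
  then have "a = \<phi> (- T) b" "a' = \<phi> (- T') b"
    using assms(3,4) by (metis first_hit_def)+
  ultimately show ?thesis by simp
qed

subsection \<open>Levi-Civita form of inner motions\<close>

text \<open>The velocity \<open>z' = 2 u u' / |u|^2\<close> of \<open>z = u^2\<close> in physical
  time, read off from the Levi-Civita state \<open>(u, u')\<close>.\<close>

definition kepler_vel :: "complex \<times> complex \<Rightarrow> complex" where
  "kepler_vel a = (2 / (norm (fst a))\<^sup>2) *\<^sub>R (fst a * snd a)"

definition lc_rate :: "billiard \<Rightarrow> real \<Rightarrow> real" where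
  "lc_rate B h = sqrt ((energy B + h) / 2)"

definition lc_energy :: "billiard \<Rightarrow> real \<Rightarrow> complex \<times> complex \<Rightarrow> bool" where
  "lc_energy B h a \<longleftrightarrow> 2 * (norm (snd a))\<^sup>2 - (energy B + h) * (norm (fst a))\<^sup>2 = mu B"

text \<open>Collisions are ordinary points of the flow in Levi-Civita coordinates, and the origin
  belongs to the region, so one notion covers Kepler motions and regularized ones. The end points
  are left free here; that their squares lie off the region is added where it is used.\<close>

definition lc_arc ::
    "billiard \<Rightarrow> real \<Rightarrow> real \<Rightarrow> complex \<times> complex \<Rightarrow> complex \<times> complex \<Rightarrow> bool" where
  "lc_arc B h S a b \<longleftrightarrow> lc_energy B h a \<and>
     first_hit (hyp_flow (lc_rate B h)) {c. (fst c)\<^sup>2 \<notin> region B} S a b"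

lemma kepler_vel_eq_iff:
  assumes "fst a \<noteq> 0" "fst a = fst b"
  shows "kepler_vel a = kepler_vel b \<longleftrightarrow> a = b"
  using assms by (auto simp: kepler_vel_def prod_eq_iff)

lemma kepler_vel_uminus [simp]: "kepler_vel (- a) = kepler_vel a"
  by (simp add: kepler_vel_def)

lemma lc_arc_uminus: "lc_arc B h S a b \<Longrightarrow> lc_arc B h S (- a) (- b)"
  by (auto simp: lc_arc_def lc_energy_def first_hit_def hyp_flow_minus)

text \<open>The Levi-Civita map is two to one; its deck transformation changes the signs of
  \<open>u\<close> and \<open>u'\<close> together and leaves \<open>kepler_vel\<close> alone.
  Position and velocity in the plane therefore determine the lifted state up to this sign.\<close>

lemma square_eq_cases:
  assumes "(fst a)\<^sup>2 = (fst b)\<^sup>2" "fst a \<noteq> 0" "kepler_vel a = kepler_vel b"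
  shows "a = b \<or> a = - b"
proof -
  have "fst a = fst b \<or> fst a = fst (- b)"
    using assms(1) by (simp add: power2_eq_iff)
  then show ?thesis
    using kepler_vel_eq_iff[of a b] kepler_vel_eq_iff[of a "- b"] assms by auto
qed

lemma lc_rate_pos: "energy B + h > 0 \<Longrightarrow> lc_rate B h > 0"
  by (simp add: lc_rate_def)

lemma lc_arc_unique:
  assumes "lc_arc B h S a b" "lc_arc B h S' a' b'" "(fst a)\<^sup>2 = (fst a')\<^sup>2" "fst a \<noteq> 0"
    "kepler_vel a = kepler_vel a'" "(fst b)\<^sup>2 \<notin> region B" "(fst b')\<^sup>2 \<notin> region B"
  shows "(fst b)\<^sup>2 = (fst b')\<^sup>2 \<and> kepler_vel b = kepler_vel b'"
proof -
  have "a = a' \<or> a = - a'" using square_eq_cases assms by blast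
  then obtain c where c: "c = b' \<or> c = - b'" "lc_arc B h S' a c"
    using assms(2) lc_arc_uminus by blast
  then have "b = c"
    using assms by (intro first_hit_unique[of _ _ S a b S' c]) (auto simp: lc_arc_def)
  then show ?thesis using c by auto
qed

lemma lc_arc_unique_start:
  assumes "lc_arc B h S a b" "lc_arc B h S' a' b'" "(fst b)\<^sup>2 = (fst b')\<^sup>2" "fst b \<noteq> 0"
    "kepler_vel b = kepler_vel b'" "(fst a)\<^sup>2 \<notin> region B" "(fst a')\<^sup>2 \<notin> region B" "energy B + h > 0"
  shows "(fst a)\<^sup>2 = (fst a')\<^sup>2 \<and> kepler_vel a = kepler_vel a'"
proof -
  have "b = b' \<or> b = - b'" using square_eq_cases assms by blast
  then obtain c where c: "c = a' \<or> c = - a'" "lc_arc B h S' c b"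
    using assms(2) lc_arc_uminus by (metis minus_minus)
  have "a = c"
    by (rule first_hit_unique_start[of "hyp_flow (lc_rate B h)" "{c. (fst c)\<^sup>2 \<notin> region B}" S a b S'])
      (use assms c lc_rate_pos[OF assms(8)] in
        \<open>auto simp: lc_arc_def hyp_flow_0 intro!: hyp_flow_add\<close>)
  then show ?thesis using c by auto
qed

lemma kepler_motion_energy:
  assumes "kepler_motion B T z v" "s \<in> {0..T}"
  shows "(norm (v s))\<^sup>2 / 2 - VI B h (z s) = (norm (v 0))\<^sup>2 / 2 - VI B h (z 0)"
proof -
  have dz: "(z has_vector_derivative v s) (at s within {0..T})"
    and dv: "(v has_vector_derivative - ((mu B / (norm (z s))^3) *\<^sub>R z s)) (at s within {0..T})"
    and nz: "z s \<noteq> 0" if "s \<in> {0..T}" for s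
    using assms(1) that unfolding kepler_motion_def is_motion_def by auto
  define f where "f s = (v s \<bullet> v s) / 2 - mu B / norm (z s)" for s
  have "(f has_vector_derivative 0) (at s within {0..T})" if s: "s \<in> {0..T}" for s
  proof -
    have 1: "((\<lambda>s. v s \<bullet> v s) has_vector_derivative
        v s \<bullet> (- ((mu B / (norm (z s))^3) *\<^sub>R z s)) + (- ((mu B / (norm (z s))^3) *\<^sub>R z s)) \<bullet> v s)
        (at s within {0..T})"
      by (rule bounded_bilinear.has_vector_derivative[OF bounded_bilinear_inner dv[OF s] dv[OF s]])
    have "((\<lambda>s. z s \<bullet> z s) has_vector_derivative z s \<bullet> v s + v s \<bullet> z s) (at s within {0..T})"
      by (rule bounded_bilinear.has_vector_derivative[OF bounded_bilinear_inner dz[OF s] dz[OF s]])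
    moreover have "z s \<bullet> z s > 0" using nz[OF s] by simp
    ultimately have "((\<lambda>s. sqrt (z s \<bullet> z s)) has_real_derivative (z s \<bullet> v s) / norm (z s)) (at s within {0..T})"
      unfolding has_real_derivative_iff_has_vector_derivative[symmetric]
      using nz[OF s] by (auto intro!: derivative_eq_intros simp: inner_commute norm_eq_sqrt_inner divide_simps
        simp del: inner_gt_zero_iff)
    then have 2: "((\<lambda>s. norm (z s)) has_real_derivative (z s \<bullet> v s) / norm (z s)) (at s within {0..T})"
      by (simp add: norm_eq_sqrt_inner)
    have 3: "((\<lambda>s. v s \<bullet> v s) has_real_derivative - (2 * mu B * (z s \<bullet> v s)) / (norm (z s))^3)
        (at s within {0..T})"
      using 1 by (simp add: has_real_derivative_iff_has_vector_derivative inner_commute mult.assoc)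
    show ?thesis
      unfolding f_def has_real_derivative_iff_has_vector_derivative[symmetric]
      by (rule DERIV_cong[OF DERIV_diff[OF DERIV_cdivide[OF 3] DERIV_divide[OF DERIV_const 2]]])
        (use nz[OF s] in \<open>simp_all add: field_simps power3_eq_cube\<close>)
  qed
  from zero_derivative_constant[OF this assms(2)] show ?thesis
    by (simp add: f_def VI_def dot_square_norm)
qed

text \<open>Exponentiating half the integral of \<open>v / z\<close> continues a square root
  \<open>u\<close> of \<open>z\<close> along the whole motion, without any branch cut. In the time
  \<open>sg\<close>, the integral of \<open>1 / |z|\<close>, the pair \<open>(u, w)\<close> solves
  the linear equation.\<close>

lemma kepler_regularization:
  assumes kep: "kepler_motion B T z v" and T: "T > 0" and H: "energy B + h > 0"
    and en: "\<And>s. s \<in> {0..T} \<Longrightarrow> (norm (v s))\<^sup>2 / 2 = VI B h (z s)"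
  obtains a sg where "continuous_on {0..T} sg" "sg 0 = 0" "strict_mono_on {0..T} sg"
    "lc_energy B h a"
    "\<And>s. s \<in> {0..T} \<Longrightarrow> z s = (fst (hyp_flow (lc_rate B h) (sg s) a))\<^sup>2"
    "\<And>s. s \<in> {0..T} \<Longrightarrow> v s = kepler_vel (hyp_flow (lc_rate B h) (sg s) a)"
proof -
  define I where "I = {0..T}"
  have dz: "(z has_vector_derivative v s) (at s within I)"
    and dv: "(v has_vector_derivative - ((mu B / (norm (z s))^3) *\<^sub>R z s)) (at s within I)"
    and nz: "z s \<noteq> 0" if "s \<in> I" for s
    using kep that unfolding kepler_motion_def is_motion_def I_def by auto
  have cz: "continuous_on I z" and cv: "continuous_on I v"
    unfolding continuous_on_eq_continuous_within using dz dv by (meson has_vector_derivative_continuous)+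
  define G where "G s = integral {0..s} (\<lambda>t. v t / z t)" for s
  have dG: "(G has_vector_derivative v s / z s) (at s within I)" if "s \<in> I" for s
    unfolding G_def I_def using that
    by (intro integral_has_vector_derivative continuous_on_divide) (use cz cv nz in \<open>auto simp: I_def\<close>)
  define sg where "sg s = integral {0..s} (\<lambda>t. 1 / norm (z t))" for s
  have dsg: "(sg has_real_derivative 1 / norm (z s)) (at s within I)" if "s \<in> I" for s
    unfolding sg_def I_def has_real_derivative_iff_has_vector_derivative using that
    by (intro integral_has_vector_derivative continuous_intros) (use cz nz in \<open>auto simp: I_def\<close>)
  define u where "u s = csqrt (z 0) * exp (G s / 2)" for s
  \<comment> \<open>This inverts \<open>kepler_vel\<close>: from \<open>v = 2 u w / |u|^2\<close>
    one gets \<open>w = v * cnj u / 2\<close>, which turns out to be the derivative of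
    \<open>u\<close> with respect to \<open>sg\<close>.\<close>
  define w where "w s = v s * cnj (u s) / 2" for s
  have du: "(u has_vector_derivative u s * (v s / z s) / 2) (at s within I)" if "s \<in> I" for s
  proof -
    have "((\<lambda>s. exp (G s / 2)) has_vector_derivative (v s / z s / 2) * exp (G s / 2)) (at s within I)"
      by (rule field_vector_diff_chain_within[where g = exp, unfolded o_def])
        (auto intro!: derivative_eq_intros dG[OF that] DERIV_exp)
    then show ?thesis
      unfolding u_def by (auto intro!: derivative_eq_intros simp: algebra_simps)
  qed
  have zu: "z s = (u s)\<^sup>2" if "s \<in> I" for s
  proof -
    have "((\<lambda>s. z s * exp (- G s)) has_vector_derivative 0) (at s within I)" if "s \<in> I" for s
    proof -
      have "((\<lambda>s. exp (- G s)) has_vector_derivative (- (v s / z s)) * exp (- G s)) (at s within I)"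
        by (rule field_vector_diff_chain_within[where g = exp, unfolded o_def])
          (auto intro!: derivative_eq_intros dG[OF that] DERIV_exp)
      then show ?thesis
        by (auto intro!: derivative_eq_intros dz[OF that] simp: nz[OF that])
    qed
    then have "z s * exp (- G s) = z 0 * exp (- G 0)"
      using that unfolding I_def by (rule zero_derivative_constant)
    then have "z s = z 0 * exp (G s)"
      by (simp add: G_def exp_minus field_simps)
    then show ?thesis
      by (simp add: u_def power_mult_distrib flip: exp_double)
  qed
  have nu: "u s \<noteq> 0" if "s \<in> I" for s
    using zu nz that by auto
  have nz2: "norm (z s) = (norm (u s))\<^sup>2" if "s \<in> I" for s
    using zu[OF that] by (simp add: norm_power)
  have ucu: "u s * cnj (u s) = of_real (norm (z s))" if "s \<in> I" for s
    using complex_norm_square[of "u s"] by (simp add: nz2[OF that])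
  have vw: "v s = kepler_vel (u s, w s)" if "s \<in> I" for s
  proof -
    have "u s * w s = v s * (u s * cnj (u s)) / 2"
      by (simp add: w_def)
    then have "u s * w s = ((norm (u s))\<^sup>2 / 2) *\<^sub>R v s"
      unfolding ucu[OF that] nz2[OF that] by (simp add: scaleR_conv_of_real)
    then show ?thesis
      using nu[OF that] by (simp add: kepler_vel_def)
  qed
  have dsw: "u s * (v s / z s) / 2 = (1 / norm (z s)) *\<^sub>R w s" if "s \<in> I" for s
  proof -
    have "of_real (norm (z s)) * (u s * (v s / z s)) = v s * cnj (u s)"
      using ucu[OF that] nu[OF that] zu[OF that] by (simp add: power2_eq_square field_simps)
    then show ?thesis
      using nz[OF that] by (simp add: w_def scaleR_conv_of_real field_simps)
  qed
  have lcen: "2 * (norm (w s))\<^sup>2 - (energy B + h) * (norm (u s))\<^sup>2 = mu B" if "s \<in> I" for s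
  proof -
    have "2 * (norm (w s))\<^sup>2 = ((norm (v s))\<^sup>2 / 2) * (norm (u s))\<^sup>2"
      by (simp add: w_def norm_mult norm_divide power_mult_distrib power_divide)
    then show ?thesis
      using en[of s] that nu[OF that] nz2[OF that] by (simp add: I_def VI_def field_simps)
  qed
  have dw: "(w has_vector_derivative (1 / norm (z s) * (lc_rate B h)\<^sup>2) *\<^sub>R u s) (at s within I)"
    if s: "s \<in> I" for s
  proof -
    have "(w has_vector_derivative (v s * cnj (u s * (v s / z s) / 2) +
        (- ((mu B / (norm (z s))^3) *\<^sub>R z s)) * cnj (u s)) / 2) (at s within I)"
      unfolding w_def
      by (intro has_vector_derivative_divide has_vector_derivative_mult has_vector_derivative_cnj
          du[OF s] dv[OF s])
    moreover have "(v s * cnj (u s * (v s / z s) / 2) +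
        (- ((mu B / (norm (z s))^3) *\<^sub>R z s)) * cnj (u s)) / 2
        = (1 / norm (z s) * (lc_rate B h)\<^sup>2) *\<^sub>R u s"
    proof -
      define r where "r = norm (z s)"
      have r: "r > 0" using nz[OF s] by (simp add: r_def)
      have "v s * cnj (u s * (v s / z s) / 2) = v s * cnj ((1 / r) *\<^sub>R w s)"
        using dsw[OF s] by (simp add: r_def)
      also have "\<dots> = (v s * cnj (v s)) * u s / (2 * of_real r)"
        by (simp add: w_def scaleR_conv_of_real mult_ac)
      also have "\<dots> = of_real ((norm (v s))\<^sup>2 / (2 * r)) * u s"
        unfolding complex_norm_square[symmetric] by simp
      finally have 1: "v s * cnj (u s * (v s / z s) / 2) = of_real ((norm (v s))\<^sup>2 / (2 * r)) * u s" .
      have "z s * cnj (u s) = of_real r * u s"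
        using ucu[OF s] zu[OF s] by (simp add: power2_eq_square r_def algebra_simps)
      then have "(- ((mu B / r^3) *\<^sub>R z s)) * cnj (u s) = of_real (- (mu B / r^3)) * (of_real r * u s)"
        by (simp add: scaleR_conv_of_real mult.assoc)
      also have "\<dots> = of_real (- (mu B / r^3) * r) * u s"
        by (simp add: mult.assoc)
      also have "- (mu B / r^3) * r = - (mu B / r\<^sup>2)"
        using r by (simp add: power2_eq_square power3_eq_cube)
      finally have 2: "(- ((mu B / r^3) *\<^sub>R z s)) * cnj (u s) = of_real (- (mu B / r\<^sup>2)) * u s" .
      \<comment> \<open>Here the energy relation enters: it eliminates the speed and leaves the
        constant \<open>energy B + h\<close>, up to the factor \<open>1 / r\<close> of the time
        change.\<close>
      have 3: "(norm (v s))\<^sup>2 / (2 * r) - mu B / r\<^sup>2 = (energy B + h) / r"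
        using en[of s] s r by (simp add: I_def VI_def r_def[symmetric] field_simps power2_eq_square)
      have "(v s * cnj (u s * (v s / z s) / 2) + (- ((mu B / r^3) *\<^sub>R z s)) * cnj (u s)) / 2
          = of_real ((norm (v s))\<^sup>2 / (2 * r) - mu B / r\<^sup>2) * u s / 2"
        unfolding 1 2 by (simp add: algebra_simps)
      also have "\<dots> = (1 / r * (lc_rate B h)\<^sup>2) *\<^sub>R u s"
        unfolding 3 using H by (simp add: lc_rate_def scaleR_conv_of_real)
      finally show ?thesis by (simp add: r_def)
    qed
    ultimately show ?thesis by (simp only:)
  qed
  have sg0: "sg 0 = 0" by (simp add: sg_def)
  have sol: "(u s, w s) = hyp_flow (lc_rate B h) (sg s) (u 0, w 0)" if "s \<in> {0..T}" for s
  proof (rule hyp_flow_solution[where sg' = "\<lambda>s. 1 / norm (z s)"])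
    show "(u has_vector_derivative (1 / norm (z s)) *\<^sub>R w s) (at s within {0..T})" if "s \<in> {0..T}" for s
      using du dsw that by (simp add: I_def)
  qed (use dw dsg lc_rate_pos[OF H] that sg0 in \<open>auto simp: I_def\<close>)
  show ?thesis
  proof (rule that[of sg "(u 0, w 0)"])
    show "continuous_on {0..T} sg"
      using dsg unfolding I_def by (meson DERIV_continuous_on)
    show "strict_mono_on {0..T} sg"
    proof (rule strict_mono_onI)
      fix r s assume rs: "r \<in> {0..T}" "s \<in> {0..T}" "r < s"
      have "\<exists>x\<in>{r<..<s}. sg s - sg r = (1 / norm (z x)) * (s - r)"
      proof (rule mvt_simple[OF rs(3)])
        fix x assume "r \<le> x" "x \<le> s"
        then have "x \<in> I" using rs by (auto simp: I_def)
        then show "(sg has_derivative (*) (1 / norm (z x))) (at x within {r..s})"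
          using dsg rs unfolding has_field_derivative_def
          by (rule_tac has_derivative_subset[of _ _ _ I]) (auto simp: I_def)
      qed
      then obtain x where x: "r < x" "x < s" "sg s - sg r = (s - r) * (1 / norm (z x))"
        by (auto simp: mult.commute)
      then have "z x \<noteq> 0" using nz[of x] rs by (auto simp: I_def)
      then have "(s - r) * (1 / norm (z x)) > 0" using rs by simp
      then show "sg r < sg s" using x by simp
    qed
    show "lc_energy B h (u 0, w 0)"
      using lcen[of 0] T by (simp add: lc_energy_def I_def)
    fix s assume s: "s \<in> {0..T}"
    show "z s = (fst (hyp_flow (lc_rate B h) (sg s) (u 0, w 0)))\<^sup>2"
      using zu[of s] sol[OF s, symmetric] s by (simp add: I_def)
    show "v s = kepler_vel (hyp_flow (lc_rate B h) (sg s) (u 0, w 0))"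
      using vw[of s] sol[OF s, symmetric] s by (simp add: I_def)
  qed (rule sg0)
qed

text \<open>The reparametrization \<open>sg\<close> is kept in the conclusion because the homotopy
  class of the arc, and not just its end states, matters in
  \<open>direct_arc_homotopic\<close>.\<close>

lemma kepler_motion_lc_arc:
  assumes kep: "kepler_motion B T z v" and T: "T > 0" and H: "energy B + h > 0"
    and en: "\<And>s. s \<in> {0..T} \<Longrightarrow> (norm (v s))\<^sup>2 / 2 = VI B h (z s)"
    and inside: "\<And>s. s \<in> {0<..<T} \<Longrightarrow> z s \<in> region B"
  shows "\<exists>S a b. lc_arc B h S a b \<and> z 0 = (fst a)\<^sup>2 \<and> v 0 = kepler_vel a \<and>
    z T = (fst b)\<^sup>2 \<and> v T = kepler_vel b \<and> fst a \<noteq> 0 \<and> fst b \<noteq> 0 \<and>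
    (\<exists>sg. continuous_on {0..T} sg \<and> sg ` {0..T} \<subseteq> {0..S} \<and>
       (\<forall>s\<in>{0..T}. z s = (fst (hyp_flow (lc_rate B h) (sg s) a))\<^sup>2))"
proof -
  obtain a sg where sg: "continuous_on {0..T} sg" "sg 0 = 0" "strict_mono_on {0..T} sg"
    and a: "lc_energy B h a"
    and z: "\<And>s. s \<in> {0..T} \<Longrightarrow> z s = (fst (hyp_flow (lc_rate B h) (sg s) a))\<^sup>2"
    and v: "\<And>s. s \<in> {0..T} \<Longrightarrow> v s = kepler_vel (hyp_flow (lc_rate B h) (sg s) a)"
    by (rule kepler_regularization[OF kep T H], rule en, assumption, rule that)
  have less: "sg r < sg s" if "r \<in> {0..T}" "s \<in> {0..T}" "r < s" for r s
    using strict_mono_onD[OF sg(3)] that by blast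
  have S: "sg T > 0" using less[of 0 T] T sg(2) by simp
  have nz: "z s \<noteq> 0" if "s \<in> {0..T}" for s
    using kep that by (auto simp: kepler_motion_def)
  define b where "b = hyp_flow (lc_rate B h) (sg T) a"
  have "(fst (hyp_flow (lc_rate B h) y a))\<^sup>2 \<in> region B" if y: "y \<in> {0<..<sg T}" for y
  proof -
    \<comment> \<open>\<open>sg\<close> maps onto \<open>[0, sg T]\<close>, so every Levi-Civita
      time comes from a physical time, at which the motion is known to be inside.\<close>
    obtain s where s: "0 \<le> s" "s \<le> T" "sg s = y"
      using IVT'[of sg 0 y T] y sg T by force
    then have "s \<noteq> 0" "s \<noteq> T" using y sg(2) by auto
    then show ?thesis using inside[of s] z[of s] s by auto
  qed
  then have "lc_arc B h (sg T) a b"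
    using a S by (auto simp: lc_arc_def first_hit_def b_def)
  moreover have "z 0 = (fst a)\<^sup>2" "v 0 = kepler_vel a"
    using z[of 0] v[of 0] T sg(2) by (simp_all add: hyp_flow_0)
  moreover have "z T = (fst b)\<^sup>2" "v T = kepler_vel b"
    using z[of T] v[of T] T by (simp_all add: b_def)
  moreover have "sg ` {0..T} \<subseteq> {0..sg T}"
    using strict_mono_on_leD[OF sg(3)] sg(2) by fastforce
  ultimately show ?thesis
    using nz[of 0] nz[of T] T sg(1) z by (intro exI[of _ "sg T"] exI[of _ a] exI[of _ b]) auto
qed

text \<open>The time change \<open>\<tau>\<close> may stop at collisions, where its derivative
  \<open>|u|^2\<close> vanishes. It could reach \<open>T\<close> early, or leave \<open>0\<close>
  late, only by being constant on an interval; that forces \<open>u = 0\<close> there, including an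
  end point of the arc, where \<open>u\<close> is not zero. So interior Levi-Civita times correspond
  to interior physical times.\<close>

lemma lc_motion_lc_arc:
  assumes lc: "lc_motion B h T z v" and T: "T > 0" and H: "energy B + h > 0"
    and inside: "\<And>s. s \<in> {0<..<T} \<Longrightarrow> z s \<in> region B" and nz: "z 0 \<noteq> 0" "z T \<noteq> 0"
  shows "\<exists>S a b. lc_arc B h S a b \<and> z 0 = (fst a)\<^sup>2 \<and> v 0 = kepler_vel a \<and>
    z T = (fst b)\<^sup>2 \<and> v T = kepler_vel b"
proof -
  obtain S u w \<tau> where S: "S > 0" and mot: "is_motion (\<lambda>w. ((energy B + h) / 2) *\<^sub>R w) S u w"
    and tau: "\<tau> 0 = 0" "\<tau> S = T"
    and all: "\<forall>\<sigma>\<in>{0..S}.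
        2 * (norm (w \<sigma>))\<^sup>2 - (energy B + h) * (norm (u \<sigma>))\<^sup>2 = mu B \<and>
        (\<tau> has_real_derivative (norm (u \<sigma>))\<^sup>2) (at \<sigma> within {0..S}) \<and>
        z (\<tau> \<sigma>) = (u \<sigma>)\<^sup>2 \<and>
        (u \<sigma> \<noteq> 0 \<longrightarrow> v (\<tau> \<sigma>) = (2 / (norm (u \<sigma>))\<^sup>2) *\<^sub>R (u \<sigma> * w \<sigma>))"
    using lc unfolding lc_motion_def by (elim exE conjE) (rule that)
  have en: "\<And>s. s \<in> {0..S} \<Longrightarrow> 2 * (norm (w s))\<^sup>2 - (energy B + h) * (norm (u s))\<^sup>2 = mu B"
    and dtau: "\<And>s. s \<in> {0..S} \<Longrightarrow> (\<tau> has_real_derivative (norm (u s))\<^sup>2) (at s within {0..S})"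
    and z: "\<And>s. s \<in> {0..S} \<Longrightarrow> z (\<tau> s) = (u s)\<^sup>2"
    and v: "\<And>s. s \<in> {0..S} \<Longrightarrow> u s \<noteq> 0 \<Longrightarrow> v (\<tau> s) = (2 / (norm (u s))\<^sup>2) *\<^sub>R (u s * w s)"
    using all by simp_all
  have k: "lc_rate B h > 0" "(lc_rate B h)\<^sup>2 = (energy B + h) / 2"
    using H by (auto simp: lc_rate_def)
  have sol: "(u s, w s) = hyp_flow (lc_rate B h) s (u 0, w 0)" if "s \<in> {0..S}" for s
  proof (rule hyp_flow_solution[where sg = "\<lambda>s. s" and sg' = "\<lambda>_. 1" and T = S])
    fix s assume "s \<in> {0..S}"
    then show "(u has_vector_derivative 1 *\<^sub>R w s) (at s within {0..S})"
      "(w has_vector_derivative (1 * (lc_rate B h)\<^sup>2) *\<^sub>R u s) (at s within {0..S})"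
      using mot unfolding k(2) is_motion_def by simp_all
  qed (use k that in auto)
  have mono: "\<tau> r \<le> \<tau> s" if "r \<in> {0..S}" "s \<in> {0..S}" "r \<le> s" for r s
  proof (cases "r = s")
    case False
    then have "r < s" using that by simp
    have "\<exists>x\<in>{r<..<s}. \<tau> s - \<tau> r = (norm (u x))\<^sup>2 * (s - r)"
    proof (rule mvt_simple[OF \<open>r < s\<close>])
      fix x assume "r \<le> x" "x \<le> s"
      then have "x \<in> {0..S}" using that by auto
      then show "(\<tau> has_derivative (*) ((norm (u x))\<^sup>2)) (at x within {r..s})"
        using dtau that unfolding has_field_derivative_def
        by (rule_tac has_derivative_subset[of _ _ _ "{0..S}"]) auto
    qed
    then obtain x where "\<tau> s - \<tau> r = (norm (u x))\<^sup>2 * (s - r)" by blast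
    moreover have "(norm (u x))\<^sup>2 * (s - r) \<ge> 0" using \<open>r < s\<close> by simp
    ultimately show ?thesis by linarith
  qed simp
  have flat: "u x = 0" if rs: "r \<in> {0..S}" "s \<in> {0..S}" "r < s" "\<tau> r = \<tau> s" "x \<in> {r..s}" for r s x
  proof -
    have const: "\<tau> y = \<tau> r" if "y \<in> {r..s}" for y
      using mono[of r y] mono[of y s] that rs by auto
    have x: "x \<in> {0..S}" using rs by auto
    have d1: "(\<tau> has_vector_derivative (norm (u x))\<^sup>2) (at x within {r..s})"
      using dtau[OF x] rs unfolding has_real_derivative_iff_has_vector_derivative
      by (auto intro: has_vector_derivative_within_subset)
    have d2: "(\<tau> has_vector_derivative 0) (at x within {r..s})"
      by (rule has_vector_derivative_transform[OF rs(5) const has_vector_derivative_const])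
    have "(norm (u x))\<^sup>2 = 0"
      by (rule vector_derivative_unique_within_closed_interval[OF rs(3), of x \<tau>])
        (use rs(5) d1 d2 in \<open>simp_all add: cbox_interval\<close>)
    then show ?thesis by simp
  qed
  have u0: "u 0 \<noteq> 0" "u S \<noteq> 0"
    using z[of 0] z[of S] tau nz S by auto
  have "0 < \<tau> s \<and> \<tau> s < T" if "s \<in> {0<..<S}" for s
    using mono[of 0 s] mono[of s S] flat[of 0 s 0] flat[of s S S] that tau u0 by force
  then have inside': "(u s)\<^sup>2 \<in> region B" if "s \<in> {0<..<S}" for s
    using inside[of "\<tau> s"] z[of s] that by auto
  have "lc_arc B h S (u 0, w 0) (u S, w S)"
    unfolding lc_arc_def first_hit_def
  proof (intro conjI ballI)
    show "lc_energy B h (u 0, w 0)" using en[of 0] S by (simp add: lc_energy_def)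
    show "hyp_flow (lc_rate B h) S (u 0, w 0) = (u S, w S)" using sol[of S] S by simp
    fix s assume "s \<in> {0<..<S}"
    then show "hyp_flow (lc_rate B h) s (u 0, w 0) \<notin> {c. (fst c)\<^sup>2 \<notin> region B}"
      using sol[of s, symmetric] inside'[of s] by simp
  qed (rule S)
  then show ?thesis
    using z[of 0] z[of S] v[of 0] v[of S] tau u0 S
    by (intro exI[of _ S] exI[of _ "(u 0, w 0)"] exI[of _ "(u S, w S)"]) (simp add: kepler_vel_def)
qed

lemma inner_motion_lc_arc:
  assumes "inner_motion B h T z v" "T > 0" "energy B + h > 0" "z 0 \<noteq> 0" "z T \<noteq> 0"
    "\<And>s. s \<in> {0<..<T} \<Longrightarrow> z s \<in> region B" "(norm (v 0))\<^sup>2 / 2 = VI B h (z 0)"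
  shows "\<exists>S a b. lc_arc B h S a b \<and> z 0 = (fst a)\<^sup>2 \<and> v 0 = kepler_vel a \<and>
    z T = (fst b)\<^sup>2 \<and> v T = kepler_vel b"
proof (cases "kepler_motion B T z v")
  case True
  have "(norm (v s))\<^sup>2 / 2 = VI B h (z s)" if "s \<in> {0..T}" for s
    using kepler_motion_energy[OF True that, of h] assms(7) by simp
  from kepler_motion_lc_arc[OF True assms(2,3) this assms(6)] show ?thesis by blast
next
  case False
  then show ?thesis
    using assms lc_motion_lc_arc[of B h T z v] by (simp add: inner_motion_def)
qed

subsection \<open>Velocities of inner arcs as functions of their end points\<close>

definition dI :: "complex \<Rightarrow> complex \<Rightarrow> real" where
  "dI p q = - sqrt ((norm p * norm q + p \<bullet> q) / 2)"

definition DI :: "real \<Rightarrow> complex \<Rightarrow> complex \<Rightarrow> real" where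
  "DI e p q = sqrt ((dI p q)\<^sup>2 + e * (norm p + norm q + e)) - dI p q"

definition QI :: "real \<Rightarrow> complex \<Rightarrow> complex \<Rightarrow> real" where
  "QI e p q = sqrt ((DI e p q)\<^sup>2 - e\<^sup>2)"

text \<open>With \<open>p = a\<^sup>2\<close>, \<open>q = b\<^sup>2\<close> in Levi-Civita coordinates, \<open>dI p q\<close> is the inner product
  \<open>a \<bullet> b\<close> when this is negative, that is, for arcs which wind around the centre.  If \<open>S\<close> is
  the duration, \<open>k\<close> the rate and \<open>e = mu / H\<close>, then \<open>DI = e cosh (k S)\<close> and
  \<open>QI = e sinh (k S)\<close>.\<close>

definition wI :: "real \<Rightarrow> complex \<Rightarrow> complex \<Rightarrow> complex" where
  "wI e p q = (e / (2 * QI e p q * dI p q * norm p)) *\<^sub>R (norm q *\<^sub>R p + norm p *\<^sub>R q)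
     - (DI e p q / (QI e p q * norm p)) *\<^sub>R p"

text \<open>Squaring doubles angles: these are the half-angle and double-angle formulas for the
  angle between \<open>a\<close> and \<open>b\<close>. The second one says that the bisector of the
  directions \<open>a^2\<close> and \<open>b^2\<close> is \<open>a * b\<close> up to sign.\<close>

lemma norm_square_inner:
  fixes a b :: complex
  shows "norm (a\<^sup>2) * norm (b\<^sup>2) + a\<^sup>2 \<bullet> b\<^sup>2 = 2 * (a \<bullet> b)\<^sup>2"
    "norm (b\<^sup>2) *\<^sub>R a\<^sup>2 + norm (a\<^sup>2) *\<^sub>R b\<^sup>2 = (2 * (a \<bullet> b)) *\<^sub>R (a * b)"
    "norm (a\<^sup>2) * norm (b\<^sup>2) - a\<^sup>2 \<bullet> b\<^sup>2 = 2 * (Im (cnj a * b))\<^sup>2"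
    "Im (cnj (a\<^sup>2) * b\<^sup>2) = 2 * (a \<bullet> b) * Im (cnj a * b)"
proof -
  have n: "norm (c\<^sup>2) = (Re c)\<^sup>2 + (Im c)\<^sup>2" for c :: complex
    by (simp add: norm_power cmod_power2)
  show "norm (a\<^sup>2) * norm (b\<^sup>2) + a\<^sup>2 \<bullet> b\<^sup>2 = 2 * (a \<bullet> b)\<^sup>2"
    "norm (a\<^sup>2) * norm (b\<^sup>2) - a\<^sup>2 \<bullet> b\<^sup>2 = 2 * (Im (cnj a * b))\<^sup>2"
    "Im (cnj (a\<^sup>2) * b\<^sup>2) = 2 * (a \<bullet> b) * Im (cnj a * b)"
    unfolding n inner_complex_def by (simp_all add: power2_eq_square algebra_simps)
  show "norm (b\<^sup>2) *\<^sub>R a\<^sup>2 + norm (a\<^sup>2) *\<^sub>R b\<^sup>2 = (2 * (a \<bullet> b)) *\<^sub>R (a * b)"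
    unfolding n inner_complex_def by (simp add: complex_eq_iff power2_eq_square algebra_simps)
qed

text \<open>The energy relation at the start of an arc of duration \<open>S\<close> becomes a quadratic equation
  for \<open>cosh (k S)\<close>.\<close>

lemma lc_quadratic:
  assumes "lc_energy B h a" "b = hyp_flow (lc_rate B h) S a" "energy B + h > 0" "S > 0"
  defines "C \<equiv> cosh (lc_rate B h * S)" and "e \<equiv> mu B / (energy B + h)"
  shows "e * C\<^sup>2 + 2 * (fst a \<bullet> fst b) * C = (norm (fst a))\<^sup>2 + (norm (fst b))\<^sup>2 + e" "C > 1"
    "snd a = (lc_rate B h / sinh (lc_rate B h * S)) *\<^sub>R (fst b - C *\<^sub>R fst a)"
proof -
  define k where "k = lc_rate B h"
  define s where "s = sinh (k * S)"
  have k: "k > 0" "k\<^sup>2 = (energy B + h) / 2"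
    using assms(3) by (auto simp: lc_rate_def k_def)
  have s: "s > 0" using k assms(4) by (simp add: s_def)
  have Cs: "C\<^sup>2 - s\<^sup>2 = 1"
    by (simp add: C_def s_def k_def cosh_square_eq)
  have C1: "C \<ge> 1" by (simp add: C_def cosh_real_ge_1)
  show "C > 1"
    using Cs s C1 by (smt (verit) one_power2 zero_less_power)
  have "fst b = C *\<^sub>R fst a + (s / k) *\<^sub>R snd a"
    using assms(2) by (simp add: hyp_flow_def C_def s_def k_def)
  then have "(k / s) *\<^sub>R (fst b - C *\<^sub>R fst a) = snd a"
    using k s by simp
  then show w: "snd a = (lc_rate B h / sinh (lc_rate B h * S)) *\<^sub>R (fst b - C *\<^sub>R fst a)"
    by (simp add: s_def k_def)
  have "(norm (snd a))\<^sup>2 = (k / s)\<^sup>2 * (norm (fst b - C *\<^sub>R fst a))\<^sup>2"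
    unfolding w by (simp add: s_def k_def power_mult_distrib power_divide)
  also have "(norm (fst b - C *\<^sub>R fst a))\<^sup>2
      = (norm (fst b))\<^sup>2 - 2 * C * (fst a \<bullet> fst b) + C\<^sup>2 * (norm (fst a))\<^sup>2"
    unfolding power2_norm_eq_inner by (simp add: inner_diff_left inner_diff_right inner_commute power2_eq_square algebra_simps)
  finally have "s\<^sup>2 * (2 * (norm (snd a))\<^sup>2) = (energy B + h) *
      ((norm (fst b))\<^sup>2 - 2 * C * (fst a \<bullet> fst b) + C\<^sup>2 * (norm (fst a))\<^sup>2)"
    using s by (simp add: power_divide k(2))
  moreover have "2 * (norm (snd a))\<^sup>2 = (energy B + h) * (e + (norm (fst a))\<^sup>2)"
    using assms(1,3) by (simp add: lc_energy_def e_def distrib_left)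
  ultimately have "(energy B + h) * (s\<^sup>2 * (e + (norm (fst a))\<^sup>2)) = (energy B + h) *
      ((norm (fst b))\<^sup>2 - 2 * C * (fst a \<bullet> fst b) + C\<^sup>2 * (norm (fst a))\<^sup>2)"
    by (simp only: mult.left_commute)
  moreover have "s\<^sup>2 = C\<^sup>2 - 1" using Cs by simp
  ultimately have "(C\<^sup>2 - 1) * (e + (norm (fst a))\<^sup>2) =
      (norm (fst b))\<^sup>2 - 2 * C * (fst a \<bullet> fst b) + C\<^sup>2 * (norm (fst a))\<^sup>2"
    using assms(3) by simp
  then show "e * C\<^sup>2 + 2 * (fst a \<bullet> fst b) * C = (norm (fst a))\<^sup>2 + (norm (fst b))\<^sup>2 + e"
    by (simp add: algebra_simps)
qed

text \<open>\<open>lc_quadratic\<close> determines \<open>cosh\<close> as the larger root, and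
  \<open>sinh\<close> follows. Multiplying the velocity \<open>snd a\<close> by \<open>fst a\<close>
  produces the product \<open>fst a * fst b\<close>, which the bisector formula expresses by the
  squares. The result is \<open>wI\<close>, the initial velocity in units of
  \<open>sqrt (2 H)\<close>.\<close>

lemma winding_velocity:
  assumes "lc_energy B h a" "b = hyp_flow (lc_rate B h) S a" "energy B + h > 0" "S > 0" "mu B > 0"
    "fst a \<noteq> 0" "fst a \<bullet> fst b < 0"
  shows "kepler_vel a = sqrt (2 * (energy B + h)) *\<^sub>R wI (mu B / (energy B + h)) ((fst a)\<^sup>2) ((fst b)\<^sup>2)"
proof -
  define k where "k = lc_rate B h"
  define s where "s = sinh (k * S)"
  define C where "C = cosh (k * S)"
  define e where "e = mu B / (energy B + h)"
  define d where "d = fst a \<bullet> fst b"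
  define r where "r = (norm (fst a))\<^sup>2"
  have k: "k > 0" using lc_rate_pos[OF assms(3)] by (simp add: k_def)
  have s: "s > 0" using k assms(4) by (simp add: s_def)
  have e: "e > 0" using assms by (simp add: e_def)
  have r: "r > 0" "norm ((fst a)\<^sup>2) = r" using assms by (auto simp: r_def norm_power)
  have quad: "e * C\<^sup>2 + 2 * d * C = (norm (fst a))\<^sup>2 + (norm (fst b))\<^sup>2 + e" "C > 1"
    and w: "snd a = (k / s) *\<^sub>R (fst b - C *\<^sub>R fst a)"
    using lc_quadratic[OF assms(1-4)] unfolding C_def k_def s_def e_def d_def by auto
  have d: "dI ((fst a)\<^sup>2) ((fst b)\<^sup>2) = d"
    using norm_square_inner(1)[of "fst a" "fst b"] assms(7) by (simp add: dI_def d_def)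
  have D: "DI e ((fst a)\<^sup>2) ((fst b)\<^sup>2) = e * C"
  proof -
    have "(e * C + d)\<^sup>2 = d\<^sup>2 + e * (e * C\<^sup>2 + 2 * d * C)"
      by (simp add: power2_eq_square algebra_simps)
    then have "d\<^sup>2 + e * (norm ((fst a)\<^sup>2) + norm ((fst b)\<^sup>2) + e) = (e * C + d)\<^sup>2"
      using quad(1) by (simp add: norm_power)
    \<comment> \<open>This selects the root. If \<open>e * C + d\<close> were negative then so would
      be \<open>e * C + 2 * d\<close>, as \<open>d < 0\<close>, and the left side of the quadratic
      could not be positive.\<close>
    moreover have "e * C + d \<ge> 0"
    proof (rule ccontr)
      assume "\<not> e * C + d \<ge> 0"
      then have "C * (e * C + 2 * d) \<le> 0"
        using quad(2) assms(7) by (intro mult_nonneg_nonpos) (auto simp: d_def)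
      then show False
        using quad(1) e by (smt (verit) power2_eq_square distrib_left mult.commute mult.left_commute zero_le_power2)
    qed
    ultimately show ?thesis by (simp add: DI_def d)
  qed
  have Q: "QI e ((fst a)\<^sup>2) ((fst b)\<^sup>2) = e * s"
  proof -
    have "(e * C)\<^sup>2 - e\<^sup>2 = (e * s)\<^sup>2"
      by (simp add: C_def s_def cosh_square_eq power_mult_distrib distrib_left)
    then show ?thesis using e s by (simp add: QI_def D)
  qed
  have "wI e ((fst a)\<^sup>2) ((fst b)\<^sup>2) = (1 / (s * r)) *\<^sub>R (fst a * fst b) - (C / (s * r)) *\<^sub>R (fst a)\<^sup>2"
    unfolding wI_def d D Q norm_square_inner(2)
    unfolding r d_def[symmetric] using e s r assms(7) by (simp add: d_def)
  moreover have "kepler_vel a = (2 * k / (r * s)) *\<^sub>R (fst a * fst b - C *\<^sub>R (fst a)\<^sup>2)"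
    unfolding kepler_vel_def w by (simp add: r_def power2_eq_square algebra_simps)
  moreover have "sqrt (2 * (energy B + h)) = 2 * k"
  proof -
    have "2 * (energy B + h) = 2\<^sup>2 * ((energy B + h) / 2)" by simp
    then show ?thesis by (simp only: k_def lc_rate_def real_sqrt_mult real_sqrt_abs abs_numeral)
  qed
  ultimately show ?thesis
    by (simp add: e_def[symmetric] scaleR_diff_right mult.commute)
qed

lemma hyp_flow_reverse:
  assumes "hyp_flow k S a = b" "k \<noteq> 0"
  shows "hyp_flow k S (fst b, - snd b) = (fst a, - snd a)"
proof -
  have "hyp_flow k (- S) b = a"
    using hyp_flow_add[OF assms(2), of "- S" S a] assms(1) by (simp add: hyp_flow_0)
  then show ?thesis
    by (auto simp: hyp_flow_def algebra_simps)
qed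

lemma lc_energy_flow:
  assumes "lc_energy B h a" "energy B + h > 0"
  shows "lc_energy B h (hyp_flow (lc_rate B h) S a)"
proof -
  define k where "k = lc_rate B h"
  define C where "C = cosh (k * S)"
  define s where "s = sinh (k * S)"
  have k: "k > 0" "energy B + h = 2 * k\<^sup>2"
    using assms(2) by (auto simp: lc_rate_def k_def)
  have Cs: "C\<^sup>2 = s\<^sup>2 + 1"
    by (simp add: C_def s_def cosh_square_eq)
  have "(norm (C *\<^sub>R snd a + (k * s) *\<^sub>R fst a))\<^sup>2
      = C\<^sup>2 * (snd a \<bullet> snd a) + 2 * C * k * s * (fst a \<bullet> snd a) + (k * s)\<^sup>2 * (fst a \<bullet> fst a)"
    unfolding power2_norm_eq_inner
    by (simp add: inner_add_left inner_add_right inner_commute power2_eq_square algebra_simps)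
  moreover have "k\<^sup>2 * (norm (C *\<^sub>R fst a + (s / k) *\<^sub>R snd a))\<^sup>2
      = s\<^sup>2 * (snd a \<bullet> snd a) + 2 * C * k * s * (fst a \<bullet> snd a) + (k * C)\<^sup>2 * (fst a \<bullet> fst a)"
    unfolding power2_norm_eq_inner using k(1)
    by (simp add: inner_add_left inner_add_right inner_commute power2_eq_square field_simps)
  ultimately have "(norm (C *\<^sub>R snd a + (k * s) *\<^sub>R fst a))\<^sup>2
      - k\<^sup>2 * (norm (C *\<^sub>R fst a + (s / k) *\<^sub>R snd a))\<^sup>2
      = snd a \<bullet> snd a - k\<^sup>2 * (fst a \<bullet> fst a)"
    by (simp add: Cs power_mult_distrib algebra_simps)
  then show ?thesis
    using assms(1) unfolding lc_energy_def k(2) power2_norm_eq_inner[of "snd a"] power2_norm_eq_inner[of "fst a"]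
    by (simp add: hyp_flow_def C_def s_def k_def[symmetric])
qed

text \<open>Time reversal: \<open>(fst b, - snd b)\<close> flows to \<open>(fst a, - snd a)\<close>,
  and changing the sign of \<open>snd b\<close> changes that of the velocity.\<close>

lemma winding_velocity_end:
  assumes "lc_energy B h a" "b = hyp_flow (lc_rate B h) S a" "energy B + h > 0" "S > 0" "mu B > 0"
    "fst b \<noteq> 0" "fst a \<bullet> fst b < 0"
  shows "kepler_vel b = - (sqrt (2 * (energy B + h)) *\<^sub>R
    wI (mu B / (energy B + h)) ((fst b)\<^sup>2) ((fst a)\<^sup>2))"
proof -
  have "kepler_vel (fst b, - snd b) = sqrt (2 * (energy B + h)) *\<^sub>R
      wI (mu B / (energy B + h)) ((fst (fst b, - snd b))\<^sup>2) ((fst (fst a, - snd a))\<^sup>2)"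
  proof (rule winding_velocity)
    show "lc_energy B h (fst b, - snd b)"
      using lc_energy_flow[OF assms(1,3), of S] assms(2) by (simp add: lc_energy_def)
    show "(fst a, - snd a) = hyp_flow (lc_rate B h) S (fst b, - snd b)"
      using hyp_flow_reverse[of "lc_rate B h" S a b] assms(2) lc_rate_pos[OF assms(3)] by simp
  qed (use assms in \<open>auto simp: inner_commute\<close>)
  moreover have "kepler_vel (fst b, - snd b) = - kepler_vel b" by (simp add: kepler_vel_def)
  ultimately show ?thesis by (metis fst_conv minus_minus)
qed

text \<open>Equal squares and a positive inner product force \<open>fst b = fst a\<close>. The
  quadratic then reads \<open>e (C^2 - 1) + 2 |a|^2 (C - 1) = 0\<close>, which is impossible for
  \<open>C > 1\<close>.\<close>

lemma no_direct_return:
  assumes "lc_energy B h a" "b = hyp_flow (lc_rate B h) S a" "energy B + h > 0" "S > 0" "mu B > 0"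
    "fst a \<bullet> fst b > 0"
  shows "(fst a)\<^sup>2 \<noteq> (fst b)\<^sup>2"
proof
  assume "(fst a)\<^sup>2 = (fst b)\<^sup>2"
  then have "fst b = fst a"
    using assms(6) by (auto simp: power2_eq_iff) (smt (verit) inner_ge_zero inner_minus_right)
  define C where "C = cosh (lc_rate B h * S)"
  define e where "e = mu B / (energy B + h)"
  have "e * C\<^sup>2 + 2 * (fst a \<bullet> fst b) * C = (norm (fst a))\<^sup>2 + (norm (fst b))\<^sup>2 + e" "C > 1"
    using lc_quadratic[OF assms(1-4)] unfolding C_def e_def by auto
  then have "e * (C\<^sup>2 - 1) + 2 * (fst a \<bullet> fst a) * (C - 1) = 0"
    unfolding \<open>fst b = fst a\<close> by (simp add: dot_square_norm algebra_simps)
  moreover have "e * (C\<^sup>2 - 1) > 0" "2 * (fst a \<bullet> fst a) * (C - 1) \<ge> 0"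
    using assms(3,5) \<open>C > 1\<close> by (simp_all add: e_def)
  ultimately show False by linarith
qed

text \<open>A direct arc starts off less radially than the chord.\<close>

lemma direct_velocity:
  assumes "lc_energy B h a" "b = hyp_flow (lc_rate B h) S a" "energy B + h > 0" "S > 0" "mu B > 0"
    "fst a \<bullet> fst b > 0" "kap \<ge> 0"
  defines "p \<equiv> (fst a)\<^sup>2" and "q \<equiv> (fst b)\<^sup>2"
  assumes steep: "\<bar>Im (cnj p * kepler_vel a)\<bar> \<le> kap * (- (p \<bullet> kepler_vel a))"
  shows "\<bar>Im (cnj p * q)\<bar> \<le> kap * ((norm p)\<^sup>2 - p \<bullet> q)"
proof -
  define k where "k = lc_rate B h"
  define s where "s = sinh (k * S)"
  define C where "C = cosh (k * S)"
  define e where "e = mu B / (energy B + h)"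
  define d where "d = fst a \<bullet> fst b"
  define m where "m = Im (cnj (fst a) * fst b)"
  define r where "r = (norm (fst a))\<^sup>2"
  define r' where "r' = (norm (fst b))\<^sup>2"
  have k: "k > 0" using lc_rate_pos[OF assms(3)] by (simp add: k_def)
  have s: "s > 0" using k assms(4) by (simp add: s_def)
  have e: "e > 0" using assms by (simp add: e_def)
  have nz: "fst a \<noteq> 0" using assms(6) by auto
  have r: "r > 0" "norm p = r" "norm q = r'"
    using nz by (auto simp: r_def r'_def p_def q_def norm_power)
  have quad: "e * C\<^sup>2 + 2 * d * C = r + r' + e" "C > 1"
    and w: "snd a = (k / s) *\<^sub>R (fst b - C *\<^sub>R fst a)"
    using lc_quadratic[OF assms(1-4)] unfolding C_def k_def s_def e_def d_def r_def r'_def by auto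
  have aa: "fst a * cnj (fst a) = of_real r"
    using complex_norm_square[of "fst a"] by (simp add: r_def)
  have "fst a * snd a = of_real (k / s) * (fst a * fst b - of_real C * (fst a * fst a))"
    by (simp add: w scaleR_conv_of_real algebra_simps)
  then have kv: "kepler_vel a = of_real (2 * k / (r * s)) * (fst a * fst b - of_real C * (fst a * fst a))"
    unfolding kepler_vel_def by (simp add: r_def scaleR_conv_of_real)
  have "cnj p * kepler_vel a = of_real (2 * k / (r * s)) *
      ((fst a * cnj (fst a)) * (cnj (fst a) * fst b)
        - of_real C * (fst a * cnj (fst a)) * (fst a * cnj (fst a)))"
    unfolding kv by (simp add: p_def power2_eq_square algebra_simps)
  also have "\<dots> = of_real (2 * k / s) * (cnj (fst a) * fst b - of_real (C * r))"
  proof -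
    have "complex_of_real r \<noteq> 0" "complex_of_real s \<noteq> 0" using r s by auto
    then show ?thesis unfolding aa by (simp add: field_simps)
  qed
  finally have pv: "cnj p * kepler_vel a = of_real (2 * k / s) * (cnj (fst a) * fst b - of_real (C * r))" .
  have re: "Re (cnj x * y) = x \<bullet> y" for x y :: complex
    by (simp add: inner_complex_def)
  have "Im (cnj p * kepler_vel a) = (2 * k / s) * m"
    unfolding pv m_def by simp
  then have im: "\<bar>Im (cnj p * kepler_vel a)\<bar> = (2 * k / s) * \<bar>m\<bar>"
    using k s by (simp only: abs_mult abs_of_pos divide_pos_pos mult_pos_pos zero_less_numeral)
  have inn: "- (p \<bullet> kepler_vel a) = (2 * k / s) * (C * r - d)"
    unfolding re[symmetric] pv d_def by (simp add: diff_divide_distrib right_diff_distrib)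
  have "(2 * k / s) * \<bar>m\<bar> \<le> (2 * k / s) * (kap * (C * r - d))"
    using steep unfolding im inn by (simp only: mult.left_commute)
  then have "\<bar>m\<bar> \<le> kap * (C * r - d)"
    using k s by (simp only: mult_le_cancel_left_pos divide_pos_pos mult_pos_pos zero_less_numeral)
  then have "2 * d * \<bar>m\<bar> \<le> 2 * d * (kap * (C * r - d))"
    using assms(6) by (intro mult_left_mono) (auto simp: d_def)
  also have "\<dots> = kap * ((2 * d * C) * r - 2 * d\<^sup>2)"
    by (simp add: power2_eq_square algebra_simps)
  also have "\<dots> \<le> kap * ((r + r') * r - 2 * d\<^sup>2)"
  proof -
    \<comment> \<open>Since \<open>C > 1\<close>, the quadratic bounds \<open>2 * d * C\<close> by
      \<open>r + r'\<close>. After this replacement the half-angle formula turns the right side into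
      exactly \<open>kap\<close> times the radial part of the chord.\<close>
    have "e * 1 \<le> e * C\<^sup>2" using quad(2) e by (intro mult_left_mono) (auto simp: one_le_power)
    then have "2 * d * C \<le> r + r'" using quad(1) by linarith
    then show ?thesis using r assms(7) by (intro mult_left_mono diff_right_mono mult_right_mono) auto
  qed
  also have "(r + r') * r - 2 * d\<^sup>2 = (norm p)\<^sup>2 - p \<bullet> q"
    using norm_square_inner(1)[of "fst a" "fst b"] unfolding p_def[symmetric] q_def[symmetric] r d_def[symmetric]
    by (simp add: power2_eq_square algebra_simps)
  finally show ?thesis
    using norm_square_inner(4)[of "fst a" "fst b"] assms(6)
    unfolding p_def[symmetric] q_def[symmetric] m_def d_def by (simp add: abs_mult)
qed

text \<open>Equality in the Cauchy-Schwarz inequality: the squared norm of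
  \<open>|q| p + |p| q\<close> is \<open>2 |p| |q| (|p| |q| + p \<bullet> q)\<close>, so this vector
  vanishes. Normalizing its weights gives the convex combination.\<close>

lemma opposite_directions:
  fixes p q :: complex
  assumes "norm p * norm q + p \<bullet> q = 0" "p \<noteq> 0"
  shows "0 \<in> closed_segment p q"
proof -
  have "(norm (norm q *\<^sub>R p + norm p *\<^sub>R q))\<^sup>2 = 2 * norm p * norm q * (norm p * norm q + p \<bullet> q)"
    unfolding power2_norm_eq_inner
    by (simp add: inner_add_left inner_add_right inner_commute)
      (simp add: dot_square_norm power2_eq_square algebra_simps)
  then have "norm q *\<^sub>R p + norm p *\<^sub>R q = 0" using assms by simp
  moreover have pos: "norm p + norm q > 0" using assms(2) by (simp add: add_pos_nonneg)
  ultimately have "0 = (1 / (norm p + norm q)) *\<^sub>R (norm q *\<^sub>R p + norm p *\<^sub>R q)" by simp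
  also have "\<dots> = (norm q / (norm p + norm q)) *\<^sub>R p + (norm p / (norm p + norm q)) *\<^sub>R q"
    by (simp add: scaleR_add_right)
  also have "norm q / (norm p + norm q) = 1 - norm p / (norm p + norm q)"
    using pos by (simp add: divide_simps)
  finally show ?thesis
    unfolding closed_segment_def using pos
    by (auto intro!: exI[of _ "norm p / (norm p + norm q)"] simp: divide_simps)
qed

text \<open>In Levi-Civita coordinates the arc consists of combinations of its ends with nonnegative
  \<open>sinh\<close> weights. For ends at an acute angle their nonzero squares lie in the open half
  plane around \<open>fst a * fst b\<close>. It is convex and misses the origin, so the straight
  homotopy to the chord avoids the collision.\<close>

lemma direct_arc_homotopic:
  assumes b: "b = hyp_flow k S a" and k: "k > 0" and S: "S > 0" and d: "fst a \<bullet> fst b > 0" and T: "T > 0"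
    and sg: "continuous_on {0..T} sg" "sg ` {0..T} \<subseteq> {0..S}"
    and z: "\<And>s. s \<in> {0..T} \<Longrightarrow> z s = (fst (hyp_flow k (sg s) a))\<^sup>2"
    and nz: "\<And>s. s \<in> {0..T} \<Longrightarrow> z s \<noteq> 0"
    and ends: "z 0 = (fst a)\<^sup>2" "z T = (fst b)\<^sup>2"
  shows "homotopic_paths (- {0}) (\<lambda>s. z (T * s)) (linepath ((fst a)\<^sup>2) ((fst b)\<^sup>2))"
proof -
  define K where "K = {w. (fst a * fst b) \<bullet> w > 0}"
  have cone: "(\<alpha> *\<^sub>R fst a + \<beta> *\<^sub>R fst b)\<^sup>2 \<in> K"
    if "\<alpha> \<ge> 0" "\<beta> \<ge> 0" "\<alpha> *\<^sub>R fst a + \<beta> *\<^sub>R fst b \<noteq> 0" for \<alpha> \<beta>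
  proof -
    have "(fst a * fst b) \<bullet> (\<alpha> *\<^sub>R fst a + \<beta> *\<^sub>R fst b)\<^sup>2
      = (\<alpha>\<^sup>2 * (fst a \<bullet> fst a) + \<beta>\<^sup>2 * (fst b \<bullet> fst b)) * (fst a \<bullet> fst b)
        + 2 * \<alpha> * \<beta> * ((fst a \<bullet> fst a) * (fst b \<bullet> fst b))"
      unfolding inner_complex_def by (simp add: power2_eq_square algebra_simps)
    moreover have "\<alpha>\<^sup>2 * (fst a \<bullet> fst a) + \<beta>\<^sup>2 * (fst b \<bullet> fst b) > 0"
    proof -
      have "fst a \<bullet> fst a > 0" "fst b \<bullet> fst b > 0" using d by auto
      moreover have "\<alpha> > 0 \<or> \<beta> > 0" using that by (cases "\<alpha> = 0"; cases "\<beta> = 0") auto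
      ultimately show ?thesis
        by (smt (verit, best) mult_pos_pos mult_nonneg_nonneg zero_le_power2 zero_less_power)
    qed
    ultimately show ?thesis
      using that d by (auto simp: K_def intro!: add_pos_nonneg)
  qed
  have inK: "z s \<in> K" if s: "s \<in> {0..T}" for s
  proof -
    define y where "y = sg s"
    have y: "0 \<le> y" "y \<le> S" using sg(2) s by (auto simp: y_def image_subset_iff)
    define s where "s = sinh (k * S)"
    define \<alpha> where "\<alpha> = sinh (k * (S - y)) / s"
    define \<beta> where "\<beta> = sinh (k * y) / s"
    have pos: "s > 0" using k S by (simp add: s_def)
    \<comment> \<open>Interpolation by the two solutions that vanish at one end:
      \<open>\<alpha>\<close> and \<open>\<beta>\<close> are the weights of \<open>fst a\<close> and
      \<open>fst b\<close> at the time \<open>y\<close>.\<close>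
    have "s * cosh (k * y) = sinh (k * (S - y)) + sinh (k * y) * cosh (k * S)"
      by (simp add: s_def right_diff_distrib sinh_diff)
    then have "cosh (k * y) = \<alpha> + \<beta> * cosh (k * S)"
      using pos by (simp add: \<alpha>_def \<beta>_def field_simps)
    moreover have "sinh (k * y) / k = \<beta> * (sinh (k * S) / k)"
      using pos by (simp add: \<beta>_def s_def[symmetric])
    ultimately have "fst (hyp_flow k y a) = \<alpha> *\<^sub>R fst a + \<beta> *\<^sub>R fst b"
      unfolding b hyp_flow_def fst_conv by (simp add: scaleR_add_left scaleR_add_right)
    moreover have "\<alpha> \<ge> 0" "\<beta> \<ge> 0"
      using y k S pos by (auto simp: \<alpha>_def \<beta>_def)
    ultimately show ?thesis
      using cone[of \<alpha> \<beta>] z[OF s] nz[OF s] by (auto simp: y_def)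
  qed
  have cvx: "convex K" unfolding K_def by (rule convex_halfspace_gt)
  have K0: "K \<subseteq> - {0}" by (auto simp: K_def)
  have cz: "continuous_on {0..T} z"
  proof -
    have "continuous_on {0..T} (\<lambda>s. (fst (hyp_flow k (sg s) a))\<^sup>2)"
      unfolding hyp_flow_def fst_conv by (intro continuous_intros sg(1)) (use k in auto)
    then show ?thesis by (rule continuous_on_eq) (simp add: z)
  qed
  show ?thesis
  proof (rule homotopic_paths_linear)
    show "path (\<lambda>s. z (T * s))"
      unfolding path_def
      by (rule continuous_on_compose2[OF cz]) (use T in \<open>auto intro!: continuous_intros mult_left_le\<close>)
    fix t :: real assume t: "t \<in> {0..1}"
    have "z (T * t) \<in> K" using T t by (intro inK) (auto intro: mult_left_le)
    moreover have "linepath ((fst a)\<^sup>2) ((fst b)\<^sup>2) t \<in> closed_segment ((fst a)\<^sup>2) ((fst b)\<^sup>2)"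
      using t by (metis linepath_image_01 imageI)
    moreover have "closed_segment ((fst a)\<^sup>2) ((fst b)\<^sup>2) \<subseteq> K"
      using inK[of 0] inK[of T] T ends by (intro closed_segment_subset cvx) auto
    ultimately show "closed_segment (z (T * t)) (linepath ((fst a)\<^sup>2) ((fst b)\<^sup>2) t) \<subseteq> - {0}"
      using closed_segment_subset[OF _ _ cvx] K0 by blast
  qed (use ends in \<open>simp_all add: pathstart_def pathfinish_def linepath_0' linepath_1'\<close>)
qed

text \<open>The sign of \<open>fst a \<bullet> fst b\<close> separates the two kinds of arcs. Zero
  means antipodal ends. An arc with positive sign is homotopic to its chord, which
  \<open>inner_arc\<close> forbids for distinct parameters, and it cannot return to its starting
  point, which settles equal ones.\<close>

lemma inner_arc_winding:
  assumes arc: "inner_arc B h x y T z v" and H: "energy B + h > 0" and mu: "mu B > 0"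
    and nz: "bdry B x \<noteq> 0" "bdry B y \<noteq> 0" and na: "\<not> antipodal B x y"
  shows "\<exists>S a b. lc_arc B h S a b \<and> bdry B x = (fst a)\<^sup>2 \<and> v 0 = kepler_vel a \<and>
    bdry B y = (fst b)\<^sup>2 \<and> v T = kepler_vel b \<and> fst a \<bullet> fst b < 0"
proof -
  have T: "T > 0" and z: "z 0 = bdry B x" "z T = bdry B y"
    and inside: "\<And>s. s \<in> {0<..<T} \<Longrightarrow> z s \<in> region B"
    and en: "\<And>s. s \<in> {0..T} \<Longrightarrow> z s \<noteq> 0 \<Longrightarrow> (norm (v s))\<^sup>2 / 2 = VI B h (z s)"
    using arc unfolding inner_arc_def by auto
  have nonzero: "fst a \<bullet> fst b \<noteq> 0" if "bdry B x = (fst a)\<^sup>2" "bdry B y = (fst b)\<^sup>2" for a b :: "complex \<times> complex"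
  proof
    assume "fst a \<bullet> fst b = 0"
    then have "norm (bdry B x) * norm (bdry B y) + bdry B x \<bullet> bdry B y = 0"
      using norm_square_inner(1)[of "fst a" "fst b"] that by simp
    then show False using opposite_directions nz na by (simp add: antipodal_def)
  qed
  show ?thesis
  proof (cases "x = y")
    case True
    then have "lc_motion B h T z v" using arc by (simp add: inner_arc_def)
    then obtain S a b where *: "lc_arc B h S a b" "z 0 = (fst a)\<^sup>2" "v 0 = kepler_vel a"
        "z T = (fst b)\<^sup>2" "v T = kepler_vel b"
      using lc_motion_lc_arc[of B h T z v] T H inside nz z by (metis (no_types, lifting))
    have "\<not> fst a \<bullet> fst b > 0"
      using no_direct_return[of B h a b S] * H mu z True by (auto simp: lc_arc_def first_hit_def)
    then show ?thesis using * z nonzero[of a b] by (metis linorder_less_linear)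
  next
    case False
    then have kep: "kepler_motion B T z v"
      and nh: "\<not> homotopic_paths (- {0}) (\<lambda>s. z (T * s)) (linepath (bdry B x) (bdry B y))"
      using arc by (auto simp: inner_arc_def)
    have znz: "z s \<noteq> 0" if "s \<in> {0..T}" for s
      using kep that by (auto simp: kepler_motion_def)
    obtain S a b sg where *: "lc_arc B h S a b" "z 0 = (fst a)\<^sup>2" "v 0 = kepler_vel a"
        "z T = (fst b)\<^sup>2" "v T = kepler_vel b" and
      sg: "continuous_on {0..T} sg" "sg ` {0..T} \<subseteq> {0..S}"
        "\<And>s. s \<in> {0..T} \<Longrightarrow> z s = (fst (hyp_flow (lc_rate B h) (sg s) a))\<^sup>2"
      using kepler_motion_lc_arc[OF kep T H en[OF _ znz] inside] by blast
    have "\<not> fst a \<bullet> fst b > 0"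
    proof
      assume "fst a \<bullet> fst b > 0"
      then have "homotopic_paths (- {0}) (\<lambda>s. z (T * s)) (linepath ((fst a)\<^sup>2) ((fst b)\<^sup>2))"
        using * sg znz T lc_rate_pos[OF H]
        by (intro direct_arc_homotopic[where k = "lc_rate B h" and S = S and sg = sg])
          (auto simp: lc_arc_def first_hit_def)
      then show False using nh * z by simp
    qed
    then show ?thesis using * z nonzero[of a b] by (metis linorder_less_linear)
  qed
qed

subsection \<open>Velocities of outer arcs as functions of their end points\<close>

text \<open>An outer arc of duration \<open>T\<close> between \<open>p\<close> and \<open>q\<close> has \<open>cos (omega T)\<close> equal to a root of
  \<open>R\<^sup>2 c\<^sup>2 - 2 (p \<bullet> q) c + |p|\<^sup>2 + |q|\<^sup>2 - R\<^sup>2 = 0\<close>, where \<open>R\<^sup>2 = 2 energy / omega\<^sup>2\<close>.  The smaller root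
  belongs to the arcs close to radial ones.\<close>

definition R2 :: "billiard \<Rightarrow> real" where
  "R2 B = 2 * energy B / (omega B)\<^sup>2"

definition discE :: "billiard \<Rightarrow> complex \<Rightarrow> complex \<Rightarrow> real" where
  "discE B p q = (p \<bullet> q)\<^sup>2 - R2 B * ((norm p)\<^sup>2 + (norm q)\<^sup>2 - R2 B)"

definition cE :: "billiard \<Rightarrow> complex \<Rightarrow> complex \<Rightarrow> real" where
  "cE B p q = (p \<bullet> q - sqrt (discE B p q)) / R2 B"

text \<open>The solution \<open>v\<close> of
  \<open>q = cos (omega T) p + (sin (omega T) / omega) v\<close> with
  \<open>cos (omega T) = cE B p q\<close> and positive sine, that is, for a time less than half a
  period.\<close>

definition vE :: "billiard \<Rightarrow> complex \<Rightarrow> complex \<Rightarrow> complex" where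
  "vE B p q = (omega B / sqrt (1 - (cE B p q)\<^sup>2)) *\<^sub>R (q - cE B p q *\<^sub>R p)"

lemma cE_commute: "cE B p q = cE B q p"
  by (simp add: cE_def discE_def inner_commute add.commute)

text \<open>The point of an arc at the angle \<open>th\<close> is \<open>al p + be q\<close>. On the
  first half of the arc the excess \<open>al + be - 1\<close> is positive and controls
  \<open>be\<close>, so the point is \<open>p\<close> plus a positive multiple of a vector close to
  \<open>p\<close> when \<open>q\<close> is: the form in which \<open>exterior_cone\<close> applies.
  The bound comes from half-angle formulas in \<open>A = tau / 2\<close> and
  \<open>x = th / 2\<close>.\<close>

lemma arc_coefficients:
  fixes th tau :: real
  assumes "0 < tau" "tau < pi" "0 < th" "th \<le> tau / 2"
  defines "al \<equiv> sin (tau - th) / sin tau" and "be \<equiv> sin th / sin tau"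
  shows "al + be - 1 > 0" "be > 0" "be \<le> (al + be - 1) * (2 / (1 - cos tau))"
proof -
  define A where "A = tau / 2"
  define x where "x = th / 2"
  have eqs: "tau = 2 * A" "th = 2 * x" by (auto simp: A_def x_def)
  have A: "0 < A" "A < pi / 2" "0 < x" "x \<le> A / 2" using assms by (auto simp: A_def x_def)
  have pos: "sin A > 0" "cos A > 0" "sin x > 0" "cos x > 0" "sin (A - x) > 0"
    using A by (auto intro!: sin_gt_zero cos_gt_zero)
  have s2: "sin tau = 2 * sin A * cos A" by (simp add: eqs sin_double)
  have c2: "1 - cos tau = 2 * (sin A)\<^sup>2" by (simp add: eqs cos_double_sin)
  have sA: "sin A = sin (A - x) * cos x + cos (A - x) * sin x"
    using sin_add[of "A - x" x] by simp
  have cA: "cos A = cos (A - x) * cos x - sin (A - x) * sin x"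
    using cos_add[of "A - x" x] by simp
  have cx1: "(cos x)\<^sup>2 = 1 - (sin x)\<^sup>2" by (simp add: cos_squared_eq)
  have lam: "sin (tau - th) + sin th - sin tau = 4 * sin A * sin (A - x) * sin x"
  proof -
    have "sin (tau - th) = 2 * sin (A - x) * cos (A - x)"
      using sin_double[of "A - x"] by (simp add: eqs right_diff_distrib)
    moreover have "sin th = 2 * sin x * cos x" by (simp add: eqs sin_double)
    moreover have "(cos (A - x))\<^sup>2 = 1 - (sin (A - x))\<^sup>2" by (simp add: cos_squared_eq)
    ultimately show ?thesis
      unfolding s2 sA cA using cx1 by algebra
  qed
  have al: "al + be - 1 = 4 * sin A * sin (A - x) * sin x / sin tau"
    using lam pos s2 by (simp add: al_def be_def field_simps)
  have st: "sin tau > 0" using s2 pos by simp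
  show "al + be - 1 > 0" unfolding al using pos st by simp
  show "be > 0" using pos st by (simp add: be_def eqs sin_double)
  have "sin x \<le> sin (A - x)"
    using A by (intro sin_monotone_2pi_le) auto
  moreover have "cos A * sin x \<le> 1 * sin x"
    using pos by (intro mult_right_mono) auto
  moreover have "sin (A - x) = sin A * cos x - cos A * sin x" by (simp add: sin_diff)
  ultimately have key: "sin A * cos x \<le> 2 * sin (A - x)" by linarith
  have "be * (sin A)\<^sup>2 = 2 * sin x * sin A * (sin A * cos x) / sin tau"
    by (simp add: be_def eqs sin_double power2_eq_square)
  also have "\<dots> \<le> 2 * sin x * sin A * (2 * sin (A - x)) / sin tau"
    using pos st key by (intro divide_right_mono mult_left_mono) auto
  also have "\<dots> = al + be - 1" unfolding al by simp
  finally show "be \<le> (al + be - 1) * (2 / (1 - cos tau))"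
    unfolding c2 using pos by (simp add: field_simps)
qed

text \<open>That \<open>cE\<close> is a root of the quadratic is exactly the energy relation at
  \<open>p\<close> for the velocity that reaches \<open>q\<close> at the time \<open>T\<close>. The
  last claim views each half of the arc from its own end: reversal exchanges \<open>p\<close> and
  \<open>q\<close>, and \<open>cE\<close> is symmetric.\<close>

lemma outer_flow_arc:
  assumes om: "omega B > 0" and E: "energy B > 0" and disc: "discE B p q \<ge> 0"
    and c: "\<bar>cE B p q\<bar> < 1"
  defines "T \<equiv> arccos (cE B p q) / omega B"
  shows "T > 0" "osc_flow (omega B) T (p, vE B p q) = (q, - vE B q p)"
    "(norm (vE B p q))\<^sup>2 / 2 = VE B p"
    "\<And>s. 0 < s \<Longrightarrow> s < T \<Longrightarrow> \<exists>lam>0. \<exists>et. \<bar>et\<bar> \<le> 2 / (1 - cE B p q) \<and>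
      (fst (osc_flow (omega B) s (p, vE B p q)) = p + lam *\<^sub>R (p + et *\<^sub>R (q - p)) \<or>
       fst (osc_flow (omega B) s (p, vE B p q)) = q + lam *\<^sub>R (q + et *\<^sub>R (p - q)))"
proof -
  define c where "c = cE B p q"
  define om where "om = omega B"
  define tau where "tau = arccos c"
  have om0: "om > 0" using om by (simp add: om_def)
  have R: "R2 B > 0" using om E by (simp add: R2_def)
  have c1: "\<bar>c\<bar> < 1" using c by (simp add: c_def)
  have tau: "0 < tau" "tau < pi" "cos tau = c" "sin tau = sqrt (1 - c\<^sup>2)"
    using c1 by (auto simp: tau_def arccos_lt_bounded sin_arccos)
  have st: "sin tau > 0" using tau sin_gt_zero by blast
  have omT: "om * T = tau" using om0 by (simp add: T_def om_def tau_def c_def)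
  show "T > 0" using om tau by (simp add: T_def tau_def c_def)
  have v: "vE B p q = (om / sin tau) *\<^sub>R (q - c *\<^sub>R p)"
    by (simp add: vE_def tau c_def om_def)
  have v': "vE B q p = (om / sin tau) *\<^sub>R (p - c *\<^sub>R q)"
    by (simp add: vE_def tau c_def om_def cE_commute)
  have s2: "(sin tau)\<^sup>2 = 1 - c\<^sup>2" using tau by (metis cos_squared_eq diff_diff_eq2 add_diff_cancel_left' sin_squared_eq)
  have ss: "sin tau * sin tau = 1 - c * c" using s2 by (simp add: power2_eq_square)
  show "osc_flow (omega B) T (p, vE B p q) = (q, - vE B q p)"
  proof -
    have "om * sin tau = om * (1 - c * c) / sin tau"
      unfolding ss[symmetric] using st by simp
    then have "c *\<^sub>R ((om / sin tau) *\<^sub>R (q - c *\<^sub>R p)) - (om * sin tau) *\<^sub>R p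
      = (om * c / sin tau) *\<^sub>R q - ((om * c * c / sin tau) + om * (1 - c * c) / sin tau) *\<^sub>R p"
      by (simp add: algebra_simps)
    also have "(om * c * c / sin tau) + om * (1 - c * c) / sin tau = om / sin tau"
      by (simp add: algebra_simps flip: add_divide_distrib)
    finally show ?thesis
      using om0 st unfolding osc_flow_def om_def[symmetric] omT v v' tau(3) fst_conv snd_conv
      by (simp add: algebra_simps)
  qed
  have root: "R2 B * c\<^sup>2 - 2 * (p \<bullet> q) * c + (norm p)\<^sup>2 + (norm q)\<^sup>2 - R2 B = 0"
  proof -
    have "R2 B * c - p \<bullet> q = - sqrt (discE B p q)"
      using R by (simp add: c_def cE_def)
    then have "(R2 B * c - p \<bullet> q)\<^sup>2 = discE B p q" using disc by simp
    then have "R2 B * (R2 B * c\<^sup>2 - 2 * (p \<bullet> q) * c + (norm p)\<^sup>2 + (norm q)\<^sup>2 - R2 B) = 0"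
      by (simp add: discE_def power2_eq_square algebra_simps)
    then show ?thesis using R by simp
  qed
  have "(norm (q - c *\<^sub>R p))\<^sup>2 = (norm q)\<^sup>2 - 2 * c * (p \<bullet> q) + c\<^sup>2 * (norm p)\<^sup>2"
    unfolding power2_norm_eq_inner
    by (simp add: inner_diff_left inner_diff_right inner_commute power2_eq_square algebra_simps)
  also have "\<dots> = (sin tau)\<^sup>2 * (R2 B - (norm p)\<^sup>2)"
    unfolding s2 using root by (simp add: algebra_simps)
  finally have "(norm (vE B p q))\<^sup>2 = om\<^sup>2 * (R2 B - (norm p)\<^sup>2)"
    unfolding v using st by (simp add: power_mult_distrib power_divide)
  then show "(norm (vE B p q))\<^sup>2 / 2 = VE B p"
    using om0 by (simp add: VE_def R2_def om_def field_simps)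
  have pos: "fst (osc_flow (omega B) s (p, vE B p q)) =
      (sin (tau - om * s) / sin tau) *\<^sub>R p + (sin (om * s) / sin tau) *\<^sub>R q" for s
  proof -
    have "sin (tau - om * s) / sin tau = cos (om * s) - sin (om * s) / sin tau * c"
      using st by (simp add: sin_diff tau(3) field_simps)
    then show ?thesis
      using om0 by (simp only:) (simp add: osc_flow_def om_def[symmetric] v algebra_simps)
  qed
  have gen: "al *\<^sub>R x + be *\<^sub>R y = x + (al + be - 1) *\<^sub>R (x + (be / (al + be - 1)) *\<^sub>R (y - x))"
    if "al + be - 1 > 0" for al be :: real and x y :: complex
  proof -
    have "(al + be - 1) *\<^sub>R ((be / (al + be - 1)) *\<^sub>R (y - x)) = be *\<^sub>R (y - x)"
      using that by simp
    then show ?thesis unfolding scaleR_add_right by (simp only:) (simp add: algebra_simps)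
  qed
  have et: "\<bar>be / (al + be - 1)\<bar> \<le> 2 / (1 - c)"
    if "al + be - 1 > 0" "be > 0" "be \<le> (al + be - 1) * (2 / (1 - cos tau))" for al be :: real
    using that tau(3) by (simp add: pos_divide_le_eq mult.commute)
  fix s assume s: "0 < s" "s < T"
  then have th: "0 < om * s" "om * s < tau"
    using om0 omT by (auto simp flip: omT)
  show "\<exists>lam>0. \<exists>et. \<bar>et\<bar> \<le> 2 / (1 - cE B p q) \<and>
      (fst (osc_flow (omega B) s (p, vE B p q)) = p + lam *\<^sub>R (p + et *\<^sub>R (q - p)) \<or>
       fst (osc_flow (omega B) s (p, vE B p q)) = q + lam *\<^sub>R (q + et *\<^sub>R (p - q)))"
  proof (cases "om * s \<le> tau / 2")
    case True
    define al be where "al = sin (tau - om * s) / sin tau" and "be = sin (om * s) / sin tau"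
    have *: "al + be - 1 > 0" "be > 0" "be \<le> (al + be - 1) * (2 / (1 - cos tau))"
      using arc_coefficients[OF tau(1,2) th(1) True] by (auto simp: al_def be_def)
    show ?thesis
      unfolding pos al_def[symmetric] be_def[symmetric] c_def[symmetric]
      using gen[OF *(1), of p q] et[OF *] *(1) by blast
  next
    case False
    define al be where "al = sin (om * s) / sin tau" and "be = sin (tau - om * s) / sin tau"
    have *: "al + be - 1 > 0" "be > 0" "be \<le> (al + be - 1) * (2 / (1 - cos tau))"
      using arc_coefficients[OF tau(1,2), of "tau - om * s"] False th by (auto simp: al_def be_def)
    show ?thesis
      unfolding pos al_def[symmetric] be_def[symmetric] c_def[symmetric]
      using gen[OF *(1), of q p] et[OF *] *(1) by (metis add.commute)
  qed
qed

subsection \<open>The boundary near a central configuration\<close>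

lemma billiardD:
  assumes "refraction_billiard B"
  shows "omega B > 0" "mu B > 0" "energy B > 0" "open (region B)" "bounded (region B)"
    "0 \<in> region B" "closure (region B) \<subseteq> {z. norm z < sqrt (2 * energy B) / omega B}"
    "len B > 0" "frontier (region B) = bdry B ` {0..len B}" "\<And>x. bdry B (x + len B) = bdry B x"
    "inj_on (bdry B) {0..<len B}" "\<And>x. norm (tangent B x) = 1"
    "\<And>x. (bdry B has_vector_derivative tangent B x) (at x)" "isCont (tangent B) x"
proof -
  show "isCont (tangent B) x"
    using assms unfolding refraction_billiard_def C1_curve_def tangent_def[abs_def]
    by (simp add: continuous_on_eq_continuous_at)
  show "(bdry B has_vector_derivative tangent B x) (at x)" for x
    using assms unfolding refraction_billiard_def C1_curve_def tangent_def
    by (simp add: vector_derivative_works)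
qed (use assms in \<open>auto simp: refraction_billiard_def tangent_def\<close>)

lemma bdry_periodic:
  assumes "refraction_billiard B"
  shows "bdry B (x + of_int k * len B) = bdry B x"
proof -
  have per: "bdry B (x + len B) = bdry B x" for x by (rule billiardD[OF assms])
  have nat: "bdry B (x + of_nat n * len B) = bdry B x" for n x
  proof (induction n)
    case (Suc n)
    have "bdry B (x + of_nat (Suc n) * len B) = bdry B (x + of_nat n * len B + len B)"
      by (simp add: algebra_simps)
    then show ?case using Suc per by simp
  qed simp
  show ?thesis
  proof (cases k)
    case (nonneg n)
    then show ?thesis using nat by simp
  next
    case (neg n)
    then have k: "of_int k = - real (Suc n)" by simp
    have eq: "x + of_int k * len B + of_nat (Suc n) * len B = x"
      unfolding k by (simp add: algebra_simps)
    show ?thesis using nat[of "x + of_int k * len B" "Suc n"] unfolding eq by (rule sym)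
  qed
qed

lemma bdry_eq_iff:
  assumes "refraction_billiard B" "\<bar>x - y\<bar> < len B"
  shows "bdry B x = bdry B y \<longleftrightarrow> x = y"
proof
  assume eq: "bdry B x = bdry B y"
  define k where "k x = \<lfloor>x / len B\<rfloor>" for x
  define r where "r x = x - of_int (k x) * len B" for x
  have L: "len B > 0" by (rule billiardD[OF assms(1)])
  have r: "r x \<in> {0..<len B}" for x
  proof -
    have "of_int (k x) \<le> x / len B" "x / len B < of_int (k x) + 1"
      unfolding k_def by linarith+
    then show ?thesis using L by (simp add: r_def field_simps)
  qed
  have "bdry B (r x) = bdry B x" for x
    using bdry_periodic[OF assms(1), of "r x" "k x"] by (simp add: r_def)
  then have "r x = r y"
    using eq r billiardD(11)[OF assms(1)] by (metis inj_onD)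
  then have "x - y = of_int (k x - k y) * len B"
    by (simp add: r_def algebra_simps)
  moreover from this have "\<bar>of_int (k x - k y) :: real\<bar> < 1"
    using assms(2) L by (simp add: abs_mult)
  ultimately have "x - y = of_int (k x - k y) * len B" "k x - k y = 0" by linarith+
  then show "x = y" by simp
qed simp

lemma bdry_frontier:
  assumes "refraction_billiard B"
  shows "bdry B x \<in> frontier (region B)"
proof -
  define k where "k = \<lfloor>x / len B\<rfloor>"
  have L: "len B > 0" by (rule billiardD[OF assms(1)])
  have "of_int k \<le> x / len B" "x / len B < of_int k + 1"
    unfolding k_def by linarith+
  then have "x + of_int (- k) * len B \<in> {0..len B}" using L by (simp add: field_simps)
  then have "bdry B (x + of_int (- k) * len B) \<in> frontier (region B)"
    using billiardD(9)[OF assms] by blast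
  then show ?thesis by (simp only: bdry_periodic[OF assms])
qed

lemma bdry_props:
  assumes "refraction_billiard B"
  shows "bdry B x \<notin> region B" "bdry B x \<in> closure (region B)" "bdry B x \<noteq> 0"
    "norm (bdry B x) < sqrt (2 * energy B) / omega B"
proof -
  have f: "bdry B x \<in> frontier (region B)" by (rule bdry_frontier[OF assms])
  have o: "open (region B)" "0 \<in> region B" by (rule billiardD[OF assms])+
  show "bdry B x \<notin> region B" "bdry B x \<in> closure (region B)"
    using f o by (auto simp: frontier_def interior_open)
  then show "bdry B x \<noteq> 0" using o by metis
  show "norm (bdry B x) < sqrt (2 * energy B) / omega B"
    using \<open>bdry B x \<in> closure (region B)\<close> billiardD(7)[OF assms] by blast
qed

lemma bdry_strict:
  assumes "refraction_billiard B" "k > 0"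
  obtains e where "e > 0" "\<And>x y. dist x a < e \<Longrightarrow> dist y a < e \<Longrightarrow>
    norm (bdry B y - bdry B x - (y - x) *\<^sub>R tangent B a) \<le> k * \<bar>y - x\<bar>"
  by (rule strict_vector_derivative[of "bdry B" "tangent B" a k])
    (use billiardD[OF assms(1)] assms(2) in \<open>auto intro: that\<close>)

lemma bdry_lipschitz:
  assumes "refraction_billiard B"
  shows "norm (bdry B y - bdry B x) \<le> \<bar>y - x\<bar>"
proof -
  have "norm (bdry B y - bdry B x) \<le> 1 * norm (y - x)"
  proof (rule differentiable_bound[where S = UNIV])
    fix z :: real
    show "(bdry B has_derivative (\<lambda>h. h *\<^sub>R tangent B z)) (at z within UNIV)"
      using billiardD(13)[OF assms, of z] by (simp add: has_vector_derivative_def)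
    show "onorm (\<lambda>h. h *\<^sub>R tangent B z) \<le> 1"
      using billiardD(12)[OF assms] by (intro onorm_le) simp
  qed auto
  then show ?thesis by simp
qed

lemma connected_region_iff:
  assumes "connected S" "S \<inter> frontier D = {}" "x \<in> S" "y \<in> S"
  shows "x \<in> D \<longleftrightarrow> y \<in> D"
  using connected_Int_frontier[OF assms(1), of D] assms by blast

text \<open>The ray cut at \<open>s = 1\<close> has two connected pieces avoiding the frontier, so
  each stays on one side. One of them contains the origin; the other leaves every bounded
  set.\<close>

lemma central_ray:
  assumes rb: "refraction_billiard B" and cc: "central_configuration B x0"
  shows "s > 1 \<Longrightarrow> s *\<^sub>R bdry B x0 \<notin> closure (region B)"
    and "0 \<le> s \<Longrightarrow> s < 1 \<Longrightarrow> s *\<^sub>R bdry B x0 \<in> region B"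
proof -
  define P where "P = bdry B x0"
  have P: "P \<noteq> 0" using bdry_props[OF rb] by (simp add: P_def)
  have ray: "s *\<^sub>R P \<in> frontier (region B) \<longleftrightarrow> s = 1" if "s \<ge> 0" for s
  proof -
    have "s *\<^sub>R P \<in> {s *\<^sub>R P | s. s \<ge> 0}" using that by blast
    moreover have "{s *\<^sub>R P | s. s \<ge> 0} \<inter> frontier (region B) = {P}"
      using cc by (simp add: central_configuration_def P_def)
    ultimately have "s *\<^sub>R P \<in> frontier (region B) \<longleftrightarrow> s *\<^sub>R P = P" by blast
    moreover have "s *\<^sub>R P = P \<longleftrightarrow> s = 1"
      using P by (metis scaleR_cancel_right scaleR_one)
    ultimately show ?thesis by simp
  qed
  have conn: "connected ((\<lambda>s. s *\<^sub>R P) ` A)" if "connected A" for A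
    by (intro connected_continuous_image continuous_intros that)
  show "s *\<^sub>R bdry B x0 \<in> region B" if "0 \<le> s" "s < 1" for s
  proof -
    have "s *\<^sub>R P \<in> region B \<longleftrightarrow> 0 *\<^sub>R P \<in> region B"
      by (rule connected_region_iff[OF conn[of "{0..<1}"]]) (use that ray in auto)
    then show ?thesis using billiardD(6)[OF rb] by (simp add: P_def)
  qed
  show "s *\<^sub>R bdry B x0 \<notin> closure (region B)" if "s > 1" for s
  proof -
    obtain M where M: "\<And>z. z \<in> region B \<Longrightarrow> norm z \<le> M"
      using billiardD(5)[OF rb] by (auto simp: bounded_iff)
    define s' where "s' = max 2 ((M + 1) / norm P)"
    have "norm (s' *\<^sub>R P) \<ge> M + 1"
    proof -
      have "M + 1 \<le> s' * norm P"
        using P by (subst pos_divide_le_eq[symmetric]) (auto simp: s'_def)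
      also have "\<dots> \<le> norm (s' *\<^sub>R P)" by (simp add: mult_right_mono)
      finally show ?thesis .
    qed
    then have "s' *\<^sub>R P \<notin> region B" using M by force
    moreover have "s *\<^sub>R P \<in> region B \<longleftrightarrow> s' *\<^sub>R P \<in> region B"
      by (rule connected_region_iff[OF conn[of "{1<..}"]]) (use that ray in \<open>auto simp: s'_def\<close>)
    moreover have "s *\<^sub>R P \<notin> frontier (region B)" using ray[of s] that by simp
    ultimately show ?thesis
      using closure_Un_frontier[of "region B"] by (auto simp: P_def)
  qed
qed


lemma norm_bdry_derivative:
  assumes "refraction_billiard B"
  shows "((\<lambda>y. norm (bdry B y)) has_real_derivative (bdry B x \<bullet> tangent B x) / norm (bdry B x)) (at x)"
proof -
  have d: "(bdry B has_vector_derivative tangent B x) (at x)" by (rule billiardD[OF assms])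
  have "((\<lambda>y. bdry B y \<bullet> bdry B y) has_vector_derivative
      bdry B x \<bullet> tangent B x + tangent B x \<bullet> bdry B x) (at x)"
    by (rule bounded_bilinear.has_vector_derivative[OF bounded_bilinear_inner d d])
  moreover have "bdry B x \<bullet> bdry B x > 0" using bdry_props(3)[OF assms, of x] by simp
  ultimately have "((\<lambda>y. sqrt (bdry B y \<bullet> bdry B y)) has_real_derivative
      (bdry B x \<bullet> tangent B x) / norm (bdry B x)) (at x)"
    unfolding has_real_derivative_iff_has_vector_derivative[symmetric]
    by (auto intro!: derivative_eq_intros simp: inner_commute norm_eq_sqrt_inner divide_simps
        simp del: inner_gt_zero_iff)
  then show ?thesis by (simp add: norm_eq_sqrt_inner)
qed

lemma central_configuration_tangent:
  assumes "refraction_billiard B" "central_configuration B x0"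
  shows "bdry B x0 \<bullet> tangent B x0 = 0"
proof -
  have "(bdry B x0 \<bullet> tangent B x0) / norm (bdry B x0) = 0"
    using norm_bdry_derivative[OF assms(1), of x0] assms(2)
    unfolding central_configuration_def by (blast intro: DERIV_unique)
  then show ?thesis using bdry_props(3)[OF assms(1)] by simp
qed

text \<open>A simple closed curve does not come back: the rest of a period, without the parameters
  in \<open>(x0 - e1, x0 + e1)\<close>, has a compact image that misses \<open>bdry B x0\<close> and
  hence keeps a positive distance from it.\<close>

lemma frontier_near:
  assumes rb: "refraction_billiard B" and e: "e > 0"
  obtains r where "r > 0"
    "\<And>q. q \<in> frontier (region B) \<Longrightarrow> dist q (bdry B x0) < r \<Longrightarrow> \<exists>y. \<bar>y - x0\<bar> < e \<and> q = bdry B y"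
proof -
  define L where "L = len B"
  have L: "L > 0" using billiardD(8)[OF rb] by (simp add: L_def)
  define e1 where "e1 = min e (L / 2)"
  have e1: "e1 > 0" "e1 \<le> L / 2" "e1 \<le> e" using e L by (auto simp: e1_def)
  define K where "K = bdry B ` {x0 + e1..x0 + L - e1}"
  have cont: "continuous_on A (bdry B)" for A
    using billiardD(13)[OF rb] has_vector_derivative_continuous continuous_at_imp_continuous_on by blast
  have "compact K" unfolding K_def by (intro compact_continuous_image cont) simp
  then have "closed K" by (rule compact_imp_closed)
  moreover have "bdry B x0 \<notin> K"
  proof
    assume "bdry B x0 \<in> K"
    then obtain y where "y \<in> {x0 + e1..x0 + L - e1}" "bdry B x0 = bdry B y"
      by (auto simp: K_def)
    then show False using bdry_eq_iff[OF rb, of x0 y] e1 L by (auto simp: L_def)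
  qed
  ultimately obtain r where r: "r > 0" "\<And>q. q \<in> K \<Longrightarrow> r \<le> dist (bdry B x0) q"
    using separate_point_closed by metis
  show ?thesis
  proof (rule that[OF r(1)])
    fix q assume q: "q \<in> frontier (region B)" "dist q (bdry B x0) < r"
    then obtain x where x: "q = bdry B x" using billiardD(9)[OF rb] by auto
    \<comment> \<open>Shifting by full periods moves the parameter into
      \<open>[x0 - e1, x0 - e1 + L)\<close>. The left end represents the same point as
      \<open>x0 + L - e1\<close>, whose image belongs to \<open>K\<close>.\<close>
    define j where "j = \<lfloor>(x - x0 + e1) / L\<rfloor>"
    define y where "y = x + of_int (- j) * L"
    have "of_int j \<le> (x - x0 + e1) / L" "(x - x0 + e1) / L < of_int j + 1"
      unfolding j_def by linarith+
    then have y: "x0 - e1 \<le> y" "y < x0 - e1 + L" using L by (auto simp: y_def field_simps)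
    have qy: "q = bdry B y" unfolding x y_def L_def by (simp only: bdry_periodic[OF rb])
    have "q \<notin> K" using r(2)[of q] q(2) by (auto simp: dist_commute)
    have "\<not> y \<ge> x0 + e1"
    proof
      assume "y \<ge> x0 + e1"
      then have "q \<in> K" using y qy by (auto simp: K_def)
      then show False using \<open>q \<notin> K\<close> by simp
    qed
    moreover have "y \<noteq> x0 - e1"
    proof
      assume "y = x0 - e1"
      then have "x0 + L - e1 = y + len B" by (simp add: L_def)
      then have "q = bdry B (x0 + L - e1)"
        using billiardD(10)[OF rb, of y] qy by simp
      then have "q \<in> K" using e1 by (auto simp: K_def)
      then show False using \<open>q \<notin> K\<close> by simp
    qed
    ultimately have "\<bar>y - x0\<bar> < e" using y e1 by auto
    then show "\<exists>y. \<bar>y - x0\<bar> < e \<and> q = bdry B y" using qy by blast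
  qed
qed

text \<open>At a central configuration the tangent is orthogonal to \<open>P\<close>, so near
  \<open>P\<close> chords of the boundary have slope at most 1 over the tangent line. A direction
  \<open>w\<close> close to \<open>P\<close> is steeper, hence moving along it does not cross the
  boundary again. Connectedness then reduces the question to the central ray, where the sides are
  known.\<close>

lemma local_cone:
  assumes rb: "refraction_billiard B" and cc: "central_configuration B x0"
  obtains e where "e > 0"
    "\<And>x w l. \<bar>x - x0\<bar> < e \<Longrightarrow> norm (w - bdry B x0) < e \<Longrightarrow> 0 < l \<Longrightarrow> l < e \<Longrightarrow>
       bdry B x + l *\<^sub>R w \<notin> closure (region B) \<and> bdry B x - l *\<^sub>R w \<in> region B"
proof -
  define P where "P = bdry B x0"
  define rP where "rP = norm P"
  define u where "u = P /\<^sub>R rP"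
  define t0 where "t0 = tangent B x0"
  have rP: "rP > 0" using bdry_props(3)[OF rb] by (simp add: rP_def P_def)
  have u: "norm u = 1" "P \<bullet> u = rP" "t0 \<bullet> u = 0" "P = rP *\<^sub>R u" "u \<bullet> u = 1"
    using rP central_configuration_tangent[OF rb cc]
    by (auto simp: u_def rP_def t0_def P_def inner_commute dot_square_norm power2_eq_square)
  have t0: "norm t0 = 1" "P \<bullet> t0 = 0" "t0 \<bullet> t0 = 1" "u \<bullet> t0 = 0"
    using billiardD(12)[OF rb, of x0] central_configuration_tangent[OF rb cc] u(3)
    by (auto simp: t0_def P_def dot_square_norm inner_commute)
  have leu: "\<bar>v \<bullet> u\<bar> \<le> norm v" "\<bar>v \<bullet> t0\<bar> \<le> norm v" for v
    using Cauchy_Schwarz_ineq2[of v u] Cauchy_Schwarz_ineq2[of v t0] u t0 by auto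
  obtain e1 where e1: "e1 > 0" "\<And>x y. dist x x0 < e1 \<Longrightarrow> dist y x0 < e1 \<Longrightarrow>
      norm (bdry B y - bdry B x - (y - x) *\<^sub>R tangent B x0) \<le> 1/2 * \<bar>y - x\<bar>"
    using bdry_strict[OF rb, of "1/2" x0] by auto
  have slope: "\<bar>(bdry B y - bdry B x) \<bullet> u\<bar> \<le> \<bar>(bdry B y - bdry B x) \<bullet> t0\<bar>"
    if "\<bar>x - x0\<bar> < e1" "\<bar>y - x0\<bar> < e1" for x y
  proof -
    define v where "v = bdry B y - bdry B x - (y - x) *\<^sub>R t0"
    have v: "norm v \<le> 1/2 * \<bar>y - x\<bar>" using e1(2)[of x y] that by (simp add: v_def t0_def dist_real_def)
    have eq1: "(bdry B y - bdry B x) \<bullet> u = v \<bullet> u"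
      by (simp add: v_def inner_diff_left u)
    have eq2: "(bdry B y - bdry B x) \<bullet> t0 = v \<bullet> t0 + (y - x)"
      by (simp add: v_def inner_diff_left t0)
    have "\<bar>v \<bullet> u\<bar> \<le> 1/2 * \<bar>y - x\<bar>" using v leu(1)[of v] by (rule order_trans[rotated])
    moreover have "1/2 * \<bar>y - x\<bar> \<le> \<bar>v \<bullet> t0 + (y - x)\<bar>"
    proof -
      have "\<bar>y - x\<bar> \<le> \<bar>v \<bullet> t0 + (y - x)\<bar> + \<bar>v \<bullet> t0\<bar>"
        using abs_triangle_ineq4[of "v \<bullet> t0 + (y - x)" "v \<bullet> t0"] by simp
      moreover have "1/2 * a \<le> b" if "a \<le> b + c" "c \<le> 1/2 * a" for a b c :: real
        using that by linarith
      ultimately show ?thesis using order_trans[OF leu(2)[of v] v] by blast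
    qed
    ultimately show ?thesis unfolding eq1 eq2 by (rule order_trans)
  qed
  obtain r where r: "r > 0" "\<And>q. q \<in> frontier (region B) \<Longrightarrow> dist q P < r \<Longrightarrow>
      \<exists>y. \<bar>y - x0\<bar> < e1 \<and> q = bdry B y"
    using frontier_near[OF rb e1(1), of x0] unfolding P_def by blast
  \<comment> \<open>\<open>m + S < r\<close> keeps both connecting segments where the frontier is
    the local curve, and \<open>S < rP\<close> keeps the inner test point between the origin and
    \<open>P\<close>. With \<open>m\<close> a quarter of \<open>S\<close>, an offset below
    \<open>m\<close> is too small for slope 1 to reach the height \<open>S\<close>.\<close>
  define S where "S = min r rP / 2"
  define m where "m = S / 4"
  have S: "S > 0" "S < rP" "m > 0" "m + S < r" "4 * m = S"
    using r rP by (auto simp: S_def m_def min_def)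
  define e where "e = min (min e1 (m / 2)) (min (rP / 4) (m / (4 * rP)))"
  have e: "e > 0" "e \<le> e1" "e \<le> m / 2" "e \<le> rP / 4" "e \<le> m / (4 * rP)"
    using e1 S rP by (auto simp: e_def)
  have main: "bdry B x + (sg * l) *\<^sub>R w \<notin> frontier (region B) \<and>
      (bdry B x + (sg * l) *\<^sub>R w \<in> region B \<longleftrightarrow> P + (sg * S) *\<^sub>R u \<in> region B)"
    if x: "\<bar>x - x0\<bar> < e" and w: "norm (w - P) < e" and l: "0 < l" "l < e" and sg: "\<bar>sg\<bar> = 1" for x w l sg
  proof -
    define q where "q = bdry B x + (sg * l) *\<^sub>R w"
    have wu: "w \<bullet> u \<ge> rP - rP / 4" "\<bar>w \<bullet> t0\<bar> \<le> rP / 4"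
    proof -
      have "w \<bullet> u = rP + (w - P) \<bullet> u" "w \<bullet> t0 = (w - P) \<bullet> t0"
        by (simp_all add: inner_diff_left u t0)
      then show "w \<bullet> u \<ge> rP - rP / 4" "\<bar>w \<bullet> t0\<bar> \<le> rP / 4"
        using leu[of "w - P"] w e(4) by linarith+
    qed
    have qP: "norm (q - P) < m"
    proof -
      have "norm (q - P) \<le> norm (bdry B x - P) + norm ((sg * l) *\<^sub>R w)"
        unfolding q_def by (metis add_diff_eq add.commute norm_triangle_ineq diff_add_eq)
      moreover have "norm (bdry B x - P) \<le> \<bar>x - x0\<bar>"
        using bdry_lipschitz[OF rb] by (simp add: P_def)
      moreover have "norm ((sg * l) *\<^sub>R w) < m / 2"
      proof -
        have "norm w \<le> rP + norm (w - P)"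
          using norm_triangle_ineq[of P "w - P"] by (simp add: rP_def)
        then have "norm w \<le> 2 * rP" using w e(4) rP by linarith
        then have "norm ((sg * l) *\<^sub>R w) \<le> l * (2 * rP)"
          using l sg by (simp add: abs_mult mult_left_mono)
        also have "\<dots> < e * (2 * rP)" using l rP by simp
        also have "\<dots> \<le> m / (4 * rP) * (2 * rP)" using e(5) rP by (intro mult_right_mono) auto
        also have "\<dots> = m / 2" using rP by simp
        finally show ?thesis .
      qed
      ultimately show ?thesis using x e(3) by linarith
    qed
    have seg1: "q + (sg * s) *\<^sub>R u \<notin> frontier (region B)" if s: "0 \<le> s" "s \<le> S" for s
    proof
      assume fr: "q + (sg * s) *\<^sub>R u \<in> frontier (region B)"
      have "dist (q + (sg * s) *\<^sub>R u) P \<le> norm (q - P) + norm ((sg * s) *\<^sub>R u)"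
        unfolding dist_norm by (metis add_diff_eq add.commute norm_triangle_ineq diff_add_eq)
      also have "\<dots> < r" using qP s S sg u by (simp add: abs_mult)
      finally obtain y where y: "\<bar>y - x0\<bar> < e1" "q + (sg * s) *\<^sub>R u = bdry B y"
        using r(2)[OF fr] by blast
      have *: "bdry B y - bdry B x = sg *\<^sub>R (l *\<^sub>R w + s *\<^sub>R u)"
        unfolding y(2)[symmetric] q_def by (simp add: algebra_simps)
      have "l * (w \<bullet> u) + s \<le> \<bar>(bdry B y - bdry B x) \<bullet> u\<bar>"
        unfolding * using sg by (simp add: inner_add_left abs_mult u)
      also have "\<dots> \<le> \<bar>(bdry B y - bdry B x) \<bullet> t0\<bar>"
        using slope x y e(2) by auto
      also have "\<dots> = l * \<bar>w \<bullet> t0\<bar>"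
        unfolding * using sg l by (simp add: inner_add_left abs_mult t0)
      also have "\<dots> \<le> l * (rP / 4)" using l wu by (intro mult_left_mono) auto
      finally have "l * (w \<bullet> u) \<le> l * (rP / 4)" using s by linarith
      then have "w \<bullet> u \<le> rP / 4" using l by simp
      then show False using wu rP by linarith
    qed
    have seg2: "P + (sg * S) *\<^sub>R u + s *\<^sub>R (q - P) \<notin> frontier (region B)" if s: "0 \<le> s" "s \<le> 1" for s
    proof
      assume fr: "P + (sg * S) *\<^sub>R u + s *\<^sub>R (q - P) \<in> frontier (region B)"
      have sq: "norm (s *\<^sub>R (q - P)) \<le> norm (q - P)"
        using s by (simp add: mult_left_le_one_le)
      have "dist (P + (sg * S) *\<^sub>R u + s *\<^sub>R (q - P)) P \<le> norm ((sg * S) *\<^sub>R u) + norm (s *\<^sub>R (q - P))"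
        unfolding dist_norm using norm_triangle_ineq[of "(sg * S) *\<^sub>R u" "s *\<^sub>R (q - P)"]
        by (simp add: algebra_simps)
      also have "\<dots> < r" using qP sq S sg u by (simp add: abs_mult)
      finally obtain y where y: "\<bar>y - x0\<bar> < e1" "P + (sg * S) *\<^sub>R u + s *\<^sub>R (q - P) = bdry B y"
        using r(2)[OF fr] by blast
      have *: "bdry B y - bdry B x0 = (sg * S) *\<^sub>R u + s *\<^sub>R (q - P)"
        unfolding y(2)[symmetric] P_def by simp
      have "(bdry B y - bdry B x0) \<bullet> u = sg * S + (s *\<^sub>R (q - P)) \<bullet> u"
        unfolding * inner_add_left by (simp add: u)
      then have "S - norm (s *\<^sub>R (q - P)) \<le> \<bar>(bdry B y - bdry B x0) \<bullet> u\<bar>"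
      proof -
        have "S - N \<le> \<bar>X\<bar>" if "X = sg * S + Y" "\<bar>Y\<bar> \<le> N" for X Y N :: real
          using that sg by (cases "sg \<ge> 0") auto
        then show ?thesis using leu(1)[of "s *\<^sub>R (q - P)"] \<open>(bdry B y - bdry B x0) \<bullet> u = _\<close> by blast
      qed
      moreover have "\<bar>(bdry B y - bdry B x0) \<bullet> t0\<bar> \<le> norm (s *\<^sub>R (q - P))"
        unfolding * inner_add_left using leu(2)[of "s *\<^sub>R (q - P)"] by (simp add: t0)
      moreover have "\<bar>(bdry B y - bdry B x0) \<bullet> u\<bar> \<le> \<bar>(bdry B y - bdry B x0) \<bullet> t0\<bar>"
        using slope[of x0 y] y e1 by auto
      ultimately show False using sq qP S by linarith
    qed
    \<comment> \<open>From \<open>q\<close> by \<open>S\<close> along \<open>u\<close>, up or down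
      according to \<open>sg\<close>, then parallel to \<open>q - P\<close> across to the central
      ray: neither segment meets the frontier.\<close>
    define A where "A = (\<lambda>s. q + (sg * s) *\<^sub>R u) ` {0..S}"
    define A' where "A' = (\<lambda>s. P + (sg * S) *\<^sub>R u + s *\<^sub>R (q - P)) ` {0..1}"
    have conn: "connected A" "connected A'"
      unfolding A_def A'_def by (rule connected_continuous_image; auto intro!: continuous_intros)+
    have mem: "q \<in> A" "q + (sg * S) *\<^sub>R u \<in> A" "q + (sg * S) *\<^sub>R u \<in> A'" "P + (sg * S) *\<^sub>R u \<in> A'"
    proof -
      show "q \<in> A" unfolding A_def by (rule image_eqI[of _ _ 0]) (use S in auto)
      show "q + (sg * S) *\<^sub>R u \<in> A" unfolding A_def by (rule image_eqI[of _ _ S]) (use S in auto)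
      show "q + (sg * S) *\<^sub>R u \<in> A'" unfolding A'_def by (rule image_eqI[of _ _ 1]) auto
      show "P + (sg * S) *\<^sub>R u \<in> A'" unfolding A'_def by (rule image_eqI[of _ _ 0]) auto
    qed
    have disj: "A \<inter> frontier (region B) = {}" "A' \<inter> frontier (region B) = {}"
      using seg1 seg2 by (auto simp: A_def A'_def)
    show ?thesis
      using connected_region_iff[OF conn(1) disj(1) mem(1,2)]
        connected_region_iff[OF conn(2) disj(2) mem(3,4)] disj mem
      unfolding q_def by blast
  qed
  have ray: "P + (1 * S) *\<^sub>R u \<notin> region B" "P + (- 1 * S) *\<^sub>R u \<in> region B"
  proof -
    have "P + (1 * S) *\<^sub>R u = (1 + S / rP) *\<^sub>R P" "P + (- 1 * S) *\<^sub>R u = (1 - S / rP) *\<^sub>R P"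
      unfolding u_def using rP by (simp_all add: algebra_simps divide_inverse)
    moreover have "(1 + S / rP) *\<^sub>R P \<notin> region B" "(1 - S / rP) *\<^sub>R P \<in> region B"
      using central_ray[OF rb cc] S rP closure_subset[of "region B"] unfolding P_def by force+
    ultimately show "P + (1 * S) *\<^sub>R u \<notin> region B" "P + (- 1 * S) *\<^sub>R u \<in> region B" by auto
  qed
  show ?thesis
  proof (rule that[OF e(1)])
    fix x w l assume *: "\<bar>x - x0\<bar> < e" "norm (w - bdry B x0) < e" "0 < l" "l < e"
    have "bdry B x + l *\<^sub>R w \<notin> frontier (region B)" "bdry B x + l *\<^sub>R w \<notin> region B"
      using main[of x w l 1] * ray by (auto simp: P_def)
    moreover have "bdry B x - l *\<^sub>R w \<in> region B"
      using main[of x w l "-1"] * ray by (simp add: P_def)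
    ultimately show "bdry B x + l *\<^sub>R w \<notin> closure (region B) \<and> bdry B x - l *\<^sub>R w \<in> region B"
      using closure_Un_frontier[of "region B"] by auto
  qed
qed

text \<open>The outer half of \<open>local_cone\<close> extends to all \<open>l > 0\<close>: small
  \<open>l\<close> is local, for middle values the compact piece of the central ray has a positive
  distance \<open>d\<close> from the closed region, and for \<open>l > La\<close> the point is too
  far out.\<close>

lemma exterior_cone:
  assumes rb: "refraction_billiard B" and cc: "central_configuration B x0"
  obtains e where "e > 0"
    "\<And>x w l. \<bar>x - x0\<bar> < e \<Longrightarrow> norm (w - bdry B x0) < e \<Longrightarrow> 0 < l \<Longrightarrow>
       bdry B x + l *\<^sub>R w \<notin> closure (region B)"
    "\<And>x w l. \<bar>x - x0\<bar> < e \<Longrightarrow> norm (w - bdry B x0) < e \<Longrightarrow> 0 < l \<Longrightarrow> l < e \<Longrightarrow>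
       bdry B x - l *\<^sub>R w \<in> region B"
proof -
  define P where "P = bdry B x0"
  define rP where "rP = norm P"
  define M where "M = sqrt (2 * energy B) / omega B"
  have rP: "rP > 0" using bdry_props(3)[OF rb] by (simp add: rP_def P_def)
  have M: "norm z < M" if "z \<in> closure (region B)" for z
    using billiardD(7)[OF rb] that by (auto simp: M_def)
  obtain e0 where e0: "e0 > 0"
    "\<And>x w l. \<bar>x - x0\<bar> < e0 \<Longrightarrow> norm (w - P) < e0 \<Longrightarrow> 0 < l \<Longrightarrow> l < e0 \<Longrightarrow>
       bdry B x + l *\<^sub>R w \<notin> closure (region B) \<and> bdry B x - l *\<^sub>R w \<in> region B"
    using local_cone[OF rb cc] unfolding P_def by blast
  \<comment> \<open>For \<open>l > La\<close> and \<open>norm w \<ge> 3/4 * rP\<close> the vector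
    \<open>l w\<close> has norm at least \<open>3 * M\<close>, more than \<open>bdry B x\<close>, of
    norm below \<open>M\<close>, can bring back into the region.\<close>
  define La where "La = 4 * M / rP"
  have M0: "M > 0" using M[OF bdry_props(2)[OF rb]] norm_ge_zero by (rule le_less_trans[rotated])
  have La: "La > 0" using M0 rP by (simp add: La_def)
  define A where "A = (\<lambda>l. P + l *\<^sub>R P) ` {e0..La}"
  have "compact A" unfolding A_def by (intro compact_continuous_image continuous_intros) auto
  moreover have "A \<inter> closure (region B) = {}"
  proof -
    have "P + l *\<^sub>R P \<notin> closure (region B)" if "l \<in> {e0..La}" for l
      using central_ray(1)[OF rb cc, of "1 + l"] that e0(1) by (simp add: P_def algebra_simps)
    then show ?thesis by (auto simp: A_def)
  qed
  ultimately obtain d where d: "d > 0" "\<And>a z. a \<in> A \<Longrightarrow> z \<in> closure (region B) \<Longrightarrow> d \<le> dist a z"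
    using separate_compact_closed[OF _ closed_closure] by metis
  define e where "e = min (min e0 (rP / 4)) (min (d / 2) (d / (2 * La)))"
  have e: "e > 0" "e \<le> e0" "e \<le> rP / 4" "e \<le> d / 2" "e \<le> d / (2 * La)"
    using e0(1) rP d(1) La by (auto simp: e_def)
  show ?thesis
  proof (rule that[OF e(1)])
    fix x w and l :: real assume *: "\<bar>x - x0\<bar> < e" "norm (w - bdry B x0) < e" "0 < l"
    show "bdry B x - l *\<^sub>R w \<in> region B" if "l < e"
      using e0(2)[of x w l] * that e by (simp add: P_def)
    consider "l < e0" | "e0 \<le> l" "l \<le> La" | "l > La" by linarith
    then show "bdry B x + l *\<^sub>R w \<notin> closure (region B)"
    proof cases
      case 1
      then show ?thesis using e0(2)[of x w l] * e by (simp add: P_def)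
    next
      case 2
      have "norm ((bdry B x + l *\<^sub>R w) - (P + l *\<^sub>R P)) \<le> norm (bdry B x - P) + norm (l *\<^sub>R (w - P))"
        using norm_triangle_ineq[of "bdry B x - P" "l *\<^sub>R (w - P)"] by (simp add: algebra_simps)
      also have "\<dots> \<le> \<bar>x - x0\<bar> + La * norm (w - P)"
        using bdry_lipschitz[OF rb, of x x0] 2 *(3)
        by (intro add_mono) (auto simp: P_def intro: mult_right_mono)
      also have "\<dots> < d / 2 + La * (d / (2 * La))"
        using * e La by (intro add_less_le_mono mult_left_mono) (auto simp: P_def)
      also have "\<dots> = d" using La by simp
      finally have "dist (P + l *\<^sub>R P) (bdry B x + l *\<^sub>R w) < d"
        by (simp add: dist_norm norm_minus_commute)
      then show ?thesis using d(2)[of "P + l *\<^sub>R P" "bdry B x + l *\<^sub>R w"] 2 unfolding A_def by fastforce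
    next
      case 3
      have "norm w \<ge> rP - norm (w - P)"
        using norm_triangle_ineq2[of P "P - w"] by (simp add: rP_def norm_minus_commute)
      then have "norm w \<ge> 3/4 * rP" using * e by (simp add: P_def)
      then have "La * (3/4 * rP) \<le> l * norm w"
        using 3 La rP by (intro mult_mono) auto
      then have "3 * M \<le> norm (l *\<^sub>R w)" using rP *(3) by (simp add: La_def)
      moreover have "norm (bdry B x) < M" using bdry_props(2)[OF rb] M by blast
      moreover have "norm (l *\<^sub>R w) \<le> norm (bdry B x + l *\<^sub>R w) + norm (bdry B x)"
        using norm_triangle_ineq4[of "bdry B x + l *\<^sub>R w" "bdry B x"] by simp
      ultimately have "norm (bdry B x + l *\<^sub>R w) > M" using M0 by linarith
      then show ?thesis using M by force
    qed
  qed
qed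

text \<open>Statements about all points closer than \<open>d\<close> are put as eventual ones for
  \<open>d\<close> tending to \<open>0\<close> from the right. Finitely many of them can then be
  intersected, which yields a single \<open>\<delta>\<close> in the end.\<close>

lemma eventually_near_pair:
  fixes P :: "real \<Rightarrow> real \<Rightarrow> bool"
  assumes "\<forall>\<^sub>F z in nhds (a, b). P (fst z) (snd z)"
  shows "\<forall>\<^sub>F d in at_right 0. \<forall>x y. \<bar>x - a\<bar> < d \<longrightarrow> \<bar>y - b\<bar> < d \<longrightarrow> P x y"
proof -
  obtain e where e: "e > 0" "\<And>z. dist z (a, b) < e \<Longrightarrow> P (fst z) (snd z)"
    using assms unfolding eventually_nhds_metric by blast
  show ?thesis
    unfolding eventually_at_right_field
  proof (intro exI[of _ "e / 2"] conjI allI impI)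
    fix d x y assume d: "0 < d" "d < e / 2" and xy: "\<bar>x - a\<bar> < d" "\<bar>y - b\<bar> < d"
    have "dist (x, y) (a, b) \<le> \<bar>x - a\<bar> + \<bar>y - b\<bar>"
      using sqrt_sum_squares_le_sum_abs[of "x - a" "y - b"] by (simp add: dist_Pair_Pair dist_real_def)
    then show "P x y" using e(2)[of "(x, y)"] d xy by simp
  qed (use e in auto)
qed

lemma eventually_near_triple:
  fixes P :: "real \<Rightarrow> real \<Rightarrow> real \<Rightarrow> bool"
  assumes "\<forall>\<^sub>F z in nhds (c, a, b). P (fst z) (fst (snd z)) (snd (snd z))"
  shows "\<forall>\<^sub>F d in at_right 0. \<forall>e x y. \<bar>e - c\<bar> < d \<longrightarrow> \<bar>x - a\<bar> < d \<longrightarrow> \<bar>y - b\<bar> < d \<longrightarrow> P e x y"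
proof -
  obtain r where r: "r > 0" "\<And>z. dist z (c, a, b) < r \<Longrightarrow> P (fst z) (fst (snd z)) (snd (snd z))"
    using assms unfolding eventually_nhds_metric by blast
  show ?thesis
    unfolding eventually_at_right_field
  proof (intro exI[of _ "r / 3"] conjI allI impI)
    fix d e x y assume d: "0 < d" "d < r / 3" and xy: "\<bar>e - c\<bar> < d" "\<bar>x - a\<bar> < d" "\<bar>y - b\<bar> < d"
    have "dist (x, y) (a, b) \<le> \<bar>x - a\<bar> + \<bar>y - b\<bar>"
      using sqrt_sum_squares_le_sum_abs[of "x - a" "y - b"] by (simp add: dist_Pair_Pair dist_real_def)
    moreover have "dist (e, x, y) (c, a, b) \<le> \<bar>e - c\<bar> + dist (x, y) (a, b)"
      using sqrt_sum_squares_le_sum_abs[of "e - c" "dist (x, y) (a, b)"]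
      by (simp add: dist_Pair_Pair[of e] dist_real_def)
    ultimately show "P e x y" using r(2)[of "(e, x, y)"] d xy by simp
  qed (use r in auto)
qed

lemma isCont_eventually_less:
  fixes f g :: "'a::t2_space \<Rightarrow> real"
  assumes "isCont f a" "isCont g a" "f a < g a"
  shows "\<forall>\<^sub>F x in nhds a. f x < g x"
proof -
  have "isCont (\<lambda>x. g x - f x) a" using assms by (intro continuous_intros)
  then have "((\<lambda>x. g x - f x) \<longlongrightarrow> g a - f a) (nhds a)" using tendsto_at_iff_tendsto_nhds[of "\<lambda>x. g x - f x" a] by (simp add: isCont_def)
  then have "\<forall>\<^sub>F x in nhds a. g x - f x > 0" by (rule order_tendstoD) (use assms in simp)
  then show ?thesis by eventually_elim simp
qed

lemma loclip_pair_eventually: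
  fixes f :: "real \<times> real \<Rightarrow> real"
  assumes "loclip f (a, b)"
  shows "\<exists>C\<ge>0. \<forall>\<^sub>F d in at_right 0. \<forall>x y. \<bar>x - a\<bar> < d \<longrightarrow> \<bar>y - b\<bar> < d \<longrightarrow>
    \<bar>f (x, y)\<bar> \<le> C \<and> (\<forall>x' y'. \<bar>x' - a\<bar> < d \<longrightarrow> \<bar>y' - b\<bar> < d \<longrightarrow>
      \<bar>f (x, y) - f (x', y')\<bar> \<le> C * (\<bar>x - x'\<bar> + \<bar>y - y'\<bar>))"
proof -
  obtain C M e where C: "C \<ge> 0" "M \<ge> 0" "e > 0"
    "\<And>p q. dist p (a, b) < e \<Longrightarrow> dist q (a, b) < e \<Longrightarrow> norm (f p - f q) \<le> C * dist p q"
    "\<And>p. dist p (a, b) < e \<Longrightarrow> norm (f p) \<le> M"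
    using assms by (rule loclip_bounded) (rule that)
  have d: "dist (x, y) (x', y') \<le> \<bar>x - x'\<bar> + \<bar>y - y'\<bar>" for x y x' y' :: real
    using sqrt_sum_squares_le_sum_abs[of "x - x'" "y - y'"] by (simp add: dist_Pair_Pair dist_real_def)
  show ?thesis
  proof (intro exI[of _ "max C M"] conjI)
    show "\<forall>\<^sub>F d in at_right 0. \<forall>x y. \<bar>x - a\<bar> < d \<longrightarrow> \<bar>y - b\<bar> < d \<longrightarrow>
      \<bar>f (x, y)\<bar> \<le> max C M \<and> (\<forall>x' y'. \<bar>x' - a\<bar> < d \<longrightarrow> \<bar>y' - b\<bar> < d \<longrightarrow>
        \<bar>f (x, y) - f (x', y')\<bar> \<le> max C M * (\<bar>x - x'\<bar> + \<bar>y - y'\<bar>))"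
      unfolding eventually_at_right_field
    proof (intro exI[of _ "e / 2"] conjI allI impI)
      fix r x y assume r: "0 < r" "r < e / 2" and xy: "\<bar>x - a\<bar> < r" "\<bar>y - b\<bar> < r"
      have near: "dist (x, y) (a, b) < e" using d[of x y a b] r xy by simp
      then show "\<bar>f (x, y)\<bar> \<le> max C M" using C(5)[of "(x, y)"] by auto
      fix x' y' assume xy': "\<bar>x' - a\<bar> < r" "\<bar>y' - b\<bar> < r"
      have near': "dist (x', y') (a, b) < e" using d[of x' y' a b] r xy' by simp
      have "\<bar>f (x, y) - f (x', y')\<bar> \<le> C * dist (x, y) (x', y')" using C(4)[OF near near'] by simp
      also have "\<dots> \<le> max C M * (\<bar>x - x'\<bar> + \<bar>y - y'\<bar>)" using C(1) d by (intro mult_mono) auto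
      finally show "\<bar>f (x, y) - f (x', y')\<bar> \<le> max C M * (\<bar>x - x'\<bar> + \<bar>y - y'\<bar>)" .
    qed (use C in auto)
  qed (use C in auto)
qed

text \<open>The first argument will be \<open>\<epsilon> = mu / H\<close>, fixed once
  \<open>h\<close> is. Lipschitz bounds are therefore kept in the last two arguments only, while the
  range of the first one includes the values of all large \<open>h\<close>.\<close>

lemma loclip_triple_eventually:
  fixes f :: "real \<times> real \<times> real \<Rightarrow> real"
  assumes "loclip f (c, a, b)"
  shows "\<exists>C\<ge>0. \<forall>\<^sub>F d in at_right 0. \<forall>e x y. \<bar>e - c\<bar> < d \<longrightarrow> \<bar>x - a\<bar> < d \<longrightarrow> \<bar>y - b\<bar> < d \<longrightarrow>
    \<bar>f (e, x, y)\<bar> \<le> C \<and> (\<forall>x' y'. \<bar>x' - a\<bar> < d \<longrightarrow> \<bar>y' - b\<bar> < d \<longrightarrow>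
      \<bar>f (e, x, y) - f (e, x', y')\<bar> \<le> C * (\<bar>x - x'\<bar> + \<bar>y - y'\<bar>))"
proof -
  obtain C M r where C: "C \<ge> 0" "M \<ge> 0" "r > 0"
    "\<And>p q. dist p (c, a, b) < r \<Longrightarrow> dist q (c, a, b) < r \<Longrightarrow> norm (f p - f q) \<le> C * dist p q"
    "\<And>p. dist p (c, a, b) < r \<Longrightarrow> norm (f p) \<le> M"
    using assms by (rule loclip_bounded) (rule that)
  have d: "dist (e, x, y) (e', x', y') \<le> \<bar>e - e'\<bar> + (\<bar>x - x'\<bar> + \<bar>y - y'\<bar>)"
    for e x y e' x' y' :: real
  proof -
    have "dist (x, y) (x', y') \<le> \<bar>x - x'\<bar> + \<bar>y - y'\<bar>"
      using sqrt_sum_squares_le_sum_abs[of "x - x'" "y - y'"] by (simp add: dist_Pair_Pair dist_real_def)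
    moreover have "dist (e, x, y) (e', x', y') \<le> \<bar>e - e'\<bar> + dist (x, y) (x', y')"
      using sqrt_sum_squares_le_sum_abs[of "e - e'" "dist (x, y) (x', y')"]
      by (simp add: dist_Pair_Pair[of e] dist_real_def)
    ultimately show ?thesis by linarith
  qed
  show ?thesis
  proof (intro exI[of _ "max C M"] conjI)
    show "\<forall>\<^sub>F d in at_right 0. \<forall>e x y. \<bar>e - c\<bar> < d \<longrightarrow> \<bar>x - a\<bar> < d \<longrightarrow> \<bar>y - b\<bar> < d \<longrightarrow>
      \<bar>f (e, x, y)\<bar> \<le> max C M \<and> (\<forall>x' y'. \<bar>x' - a\<bar> < d \<longrightarrow> \<bar>y' - b\<bar> < d \<longrightarrow>
        \<bar>f (e, x, y) - f (e, x', y')\<bar> \<le> max C M * (\<bar>x - x'\<bar> + \<bar>y - y'\<bar>))"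
      unfolding eventually_at_right_field
    proof (intro exI[of _ "r / 3"] conjI allI impI)
      fix s e x y assume r: "0 < s" "s < r / 3"
        and xy: "\<bar>e - c\<bar> < s" "\<bar>x - a\<bar> < s" "\<bar>y - b\<bar> < s"
      have near: "dist (e, x, y) (c, a, b) < r" using d[of e x y c a b] r xy by simp
      then show "\<bar>f (e, x, y)\<bar> \<le> max C M" using C(5)[of "(e, x, y)"] by auto
      fix x' y' assume xy': "\<bar>x' - a\<bar> < s" "\<bar>y' - b\<bar> < s"
      have near': "dist (e, x', y') (c, a, b) < r" using d[of e x' y' c a b] r xy xy' by simp
      have "\<bar>f (e, x, y) - f (e, x', y')\<bar> \<le> C * dist (e, x, y) (e, x', y')"
        using C(4)[OF near near'] by simp
      also have "\<dots> \<le> max C M * (\<bar>x - x'\<bar> + \<bar>y - y'\<bar>)"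
        using C(1) d[of e x y e x' y'] by (intro mult_mono) auto
      finally show "\<bar>f (e, x, y) - f (e, x', y')\<bar> \<le> max C M * (\<bar>x - x'\<bar> + \<bar>y - y'\<bar>)" .
    qed (use C in auto)
  qed (use C in auto)
qed

section \<open>Tangent, normal and derivative of the distance near a central configuration\<close>

lemma tangent_C1_near:
  assumes "C2_near (bdry B) x0"
  obtains t' where "\<forall>\<^sub>F x in nhds x0. (tangent B has_vector_derivative t' x) (at x)" "isCont t' x0"
proof -
  obtain U where U: "open U" "x0 \<in> U"
    "\<And>x. x \<in> U \<Longrightarrow> (\<lambda>y. vector_derivative (bdry B) (at y)) differentiable at x"
    "continuous_on U (\<lambda>x. vector_derivative (\<lambda>y. vector_derivative (bdry B) (at y)) (at x))"
    using assms unfolding C2_near_def by blast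
  have "\<forall>\<^sub>F x in nhds x0. x \<in> U" using U by (simp add: eventually_nhds_in_open)
  then have "\<forall>\<^sub>F x in nhds x0. (tangent B has_vector_derivative vector_derivative (tangent B) (at x)) (at x)"
    unfolding tangent_def[abs_def] by eventually_elim (use U(3) vector_derivative_works in blast)
  moreover have "isCont (\<lambda>x. vector_derivative (tangent B) (at x)) x0"
    using U by (simp add: continuous_on_eq_continuous_at tangent_def[abs_def])
  ultimately show ?thesis by (rule that)
qed

lemma loclip_tangent: "C2_near (bdry B) x0 \<Longrightarrow> loclip (tangent B) x0"
  by (rule tangent_C1_near) (auto intro: loclip_C1)

lemma loclip_bdry: "refraction_billiard B \<Longrightarrow> loclip (bdry B) x0"
  by (rule loclip_C1[of _ "tangent B"]) (auto intro!: always_eventually billiardD)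

text \<open>The derivative \<open>\<rho>'\<close> of the distance to the centre along the boundary,
  see \<open>norm_bdry_derivative\<close>.\<close>

definition rho1 :: "billiard \<Rightarrow> real \<Rightarrow> real" where
  "rho1 B x = (bdry B x \<bullet> tangent B x) / norm (bdry B x)"

lemma rho1_central:
  "refraction_billiard B \<Longrightarrow> central_configuration B x0 \<Longrightarrow> rho1 B x0 = 0"
  by (simp add: rho1_def central_configuration_tangent)

text \<open>\<open>sg\<close> is the sign of \<open>\<rho>''\<close> at the central configuration
  and \<open>c\<close> half of its modulus; the other half absorbs the error of the strict
  derivative.\<close>

lemma rho1_monotone:
  assumes rb: "refraction_billiard B" and nd: "nondegenerate_cc B x0"
  shows "\<exists>sg c. \<bar>sg\<bar> = 1 \<and> c > 0 \<and> (\<forall>\<^sub>F d in at_right 0. \<forall>x y. \<bar>x - x0\<bar> < d \<longrightarrow> \<bar>y - x0\<bar> < d \<longrightarrow> x \<le> y \<longrightarrow>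
    c * (y - x) \<le> sg * (rho1 B y - rho1 B x))"
proof -
  obtain t' where t': "\<forall>\<^sub>F x in nhds x0. (tangent B has_vector_derivative t' x) (at x)" "isCont t' x0"
    using tangent_C1_near nd unfolding nondegenerate_cc_def by blast
  define rho2 where "rho2 x = ((bdry B x \<bullet> t' x + tangent B x \<bullet> tangent B x) * norm (bdry B x)
      - (bdry B x \<bullet> tangent B x) * rho1 B x) / (norm (bdry B x) * norm (bdry B x))" for x
  have nz: "bdry B x \<noteq> 0" for x by (rule bdry_props[OF rb])
  have ct: "isCont (tangent B) x" for x by (rule billiardD[OF rb])
  have cb: "isCont (bdry B) x" for x by (rule loclip_isCont[OF loclip_bdry[OF rb]])
  have "isCont rho2 x0"
    unfolding rho2_def rho1_def using nz by (intro continuous_intros ct cb t') auto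
  moreover have der: "\<forall>\<^sub>F x in nhds x0. (rho1 B has_vector_derivative rho2 x) (at x)"
    using t'(1)
  proof eventually_elim
    case (elim x)
    have "((\<lambda>x. bdry B x \<bullet> tangent B x) has_vector_derivative
        bdry B x \<bullet> t' x + tangent B x \<bullet> tangent B x) (at x)"
      by (rule bounded_bilinear.has_vector_derivative[OF bounded_bilinear_inner billiardD(13)[OF rb] elim])
    then have 1: "((\<lambda>x. bdry B x \<bullet> tangent B x) has_real_derivative
        bdry B x \<bullet> t' x + tangent B x \<bullet> tangent B x) (at x)"
      by (simp add: has_real_derivative_iff_has_vector_derivative)
    have 2: "((\<lambda>x. norm (bdry B x)) has_real_derivative rho1 B x) (at x)"
      using norm_bdry_derivative[OF rb] by (simp add: rho1_def)
    have "(rho1 B has_real_derivative rho2 x) (at x)"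
      using DERIV_divide[OF 1 2] nz unfolding rho1_def[abs_def] rho2_def by simp
    then show ?case by (simp add: has_real_derivative_iff_has_vector_derivative)
  qed
  moreover have "rho2 x0 \<noteq> 0"
  proof -
    have "deriv (\<lambda>y. norm (bdry B y)) = rho1 B"
      using norm_bdry_derivative[OF rb] by (intro ext DERIV_imp_deriv) (simp add: rho1_def)
    moreover have "deriv (rho1 B) x0 = rho2 x0"
      using eventually_nhds_x_imp_x[OF der]
      by (intro DERIV_imp_deriv) (simp add: has_real_derivative_iff_has_vector_derivative)
    ultimately show ?thesis using nd by (simp add: nondegenerate_cc_def)
  qed
  ultimately have r2: "\<forall>\<^sub>F x in nhds x0. (rho1 B has_vector_derivative rho2 x) (at x)"
      "isCont rho2 x0" "rho2 x0 \<noteq> 0" "\<bar>rho2 x0\<bar> / 2 > 0" by auto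
  obtain e where e: "e > 0" "\<And>x y. dist x x0 < e \<Longrightarrow> dist y x0 < e \<Longrightarrow>
      norm (rho1 B y - rho1 B x - (y - x) *\<^sub>R rho2 x0) \<le> \<bar>rho2 x0\<bar> / 2 * \<bar>y - x\<bar>"
    by (rule strict_vector_derivative[OF r2(1,2,4)]) (rule that)
  define c where "c = \<bar>rho2 x0\<bar> / 2"
  have main: "c * (y - x) \<le> sgn (rho2 x0) * (rho1 B y - rho1 B x)"
    if "dist x x0 < e" "dist y x0 < e" "x \<le> y" for x y
  proof -
    have "\<bar>rho1 B y - rho1 B x - (y - x) * rho2 x0\<bar> \<le> c * (y - x)"
      using e(2)[OF that(1,2)] that(3) by (simp add: c_def)
    moreover have "\<bar>rho2 x0\<bar> * (y - x) = 2 * c * (y - x)" by (simp add: c_def)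
    ultimately show ?thesis
      using r2(3) by (cases "rho2 x0 > 0") (auto simp: sgn_if algebra_simps abs_le_iff)
  qed
  show ?thesis
  proof (rule exI[of _ "sgn (rho2 x0)"], rule exI[of _ c], intro conjI)
    show "\<forall>\<^sub>F d in at_right 0. \<forall>x y. \<bar>x - x0\<bar> < d \<longrightarrow> \<bar>y - x0\<bar> < d \<longrightarrow> x \<le> y \<longrightarrow>
        c * (y - x) \<le> sgn (rho2 x0) * (rho1 B y - rho1 B x)"
      unfolding eventually_at_right_field
      by (intro exI[of _ e] conjI allI impI main) (use e in \<open>auto simp: dist_real_def\<close>)
  qed (use r2(3) in \<open>auto simp: c_def sgn_if\<close>)
qed

lemma orthogonal_unit:
  fixes n t :: complex
  assumes "norm n = 1" "n \<bullet> t = 0" "norm t = 1"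
  shows "n = \<i> * t \<or> n = - (\<i> * t)"
proof -
  define z where "z = n * cnj t"
  have "Re z = 0" using assms(2) by (simp add: z_def inner_complex_def)
  moreover have "norm z = 1" using assms by (simp add: z_def norm_mult)
  ultimately have "z = \<i> \<or> z = - \<i>"
    by (auto simp: complex_eq_iff cmod_def abs_if split: if_splits)
  moreover have "n = z * t"
    using assms(3) complex_norm_square[of t] by (simp add: z_def mult.assoc mult.commute[of t])
  ultimately show ?thesis by auto
qed

text \<open>\<open>sg\<close> records the orientation of the curve. At \<open>x0\<close> the outward
  direction is that of the position itself, since the ray leaves the region there;
  \<open>exterior_cone\<close> carries this to nearby points, with the same \<open>sg\<close>
  because the tangent is continuous.\<close>

lemma normal_near:
  assumes rb: "refraction_billiard B" and cc: "central_configuration B x0"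
  shows "\<exists>sg. \<bar>sg\<bar> = 1 \<and> bdry B x0 = (norm (bdry B x0) * sg) *\<^sub>R (\<i> * tangent B x0) \<and>
    (\<forall>\<^sub>F x in nhds x0. normal B x = sg *\<^sub>R (\<i> * tangent B x))"
proof -
  define P where "P = bdry B x0"
  define rP where "rP = norm P"
  have rP: "rP > 0" using bdry_props(3)[OF rb] by (simp add: rP_def P_def)
  have t1: "norm (tangent B x) = 1" for x by (rule billiardD[OF rb])
  have "norm (P /\<^sub>R rP) = 1" "(P /\<^sub>R rP) \<bullet> tangent B x0 = 0"
    using rP central_configuration_tangent[OF rb cc] by (auto simp: rP_def P_def)
  from orthogonal_unit[OF this t1] obtain sg :: real where sg: "\<bar>sg\<bar> = 1" "P /\<^sub>R rP = sg *\<^sub>R (\<i> * tangent B x0)"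
    by (metis abs_1 abs_minus scaleR_minus1_left scaleR_one)
  have Peq: "P = (rP * sg) *\<^sub>R (\<i> * tangent B x0)"
    using sg(2) rP by (metis divideR_right less_irrefl scaleR_scaleR)
  obtain e where e': "e > 0"
    "\<And>x w l. \<bar>x - x0\<bar> < e \<Longrightarrow> norm (w - bdry B x0) < e \<Longrightarrow> 0 < l \<Longrightarrow>
      bdry B x + l *\<^sub>R w \<notin> closure (region B)"
    "\<And>x w l. \<bar>x - x0\<bar> < e \<Longrightarrow> norm (w - bdry B x0) < e \<Longrightarrow> 0 < l \<Longrightarrow> l < e \<Longrightarrow>
      bdry B x - l *\<^sub>R w \<in> region B"
    by (rule exterior_cone[OF rb cc]) (rule that)
  note e = e'[folded P_def]
  have "isCont (\<lambda>x. norm ((rP * sg) *\<^sub>R (\<i> * tangent B x) - P)) x0"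
    by (intro continuous_intros billiardD(14)[OF rb])
  then have "\<forall>\<^sub>F x in nhds x0. norm ((rP * sg) *\<^sub>R (\<i> * tangent B x) - P) < e"
    by (rule isCont_eventually_less) (use Peq e in auto)
  moreover have "\<forall>\<^sub>F x in nhds x0. \<bar>x - x0\<bar> < e"
    using e(1) by (auto simp: eventually_nhds_metric dist_real_def)
  ultimately have "\<forall>\<^sub>F x in nhds x0. normal B x = sg *\<^sub>R (\<i> * tangent B x)"
  proof eventually_elim
    case (elim x)
    define n where "n = sg *\<^sub>R (\<i> * tangent B x)"
    have n: "norm n = 1" "n \<bullet> tangent B x = 0"
      using sg(1) t1[of x] by (auto simp: n_def norm_mult inner_complex_def)
    have w: "(rP * sg) *\<^sub>R (\<i> * tangent B x) = rP *\<^sub>R n" by (simp add: n_def)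
    have out: "bdry B x + s *\<^sub>R n \<notin> closure (region B)" if "s > 0" for s
      using e(2)[of x "rP *\<^sub>R n" "s / rP"] elim that rP w by simp
    have ins: "bdry B x - s *\<^sub>R n \<in> region B" if "s > 0" "s < e * rP" for s
      using e(3)[of x "rP *\<^sub>R n" "s / rP"] elim that rP w by (simp add: field_simps)
    show ?case
      unfolding normal_def n_def[symmetric]
    proof (rule the_equality)
      show "norm n = 1 \<and> n \<bullet> tangent B x = 0 \<and> (\<forall>\<^sub>F e in at_right 0. bdry B x + e *\<^sub>R n \<notin> closure (region B))"
        using n out by (auto simp: eventually_at_right_field intro: exI[of _ 1])
      fix k assume k: "norm k = 1 \<and> k \<bullet> tangent B x = 0 \<and>
        (\<forall>\<^sub>F e in at_right 0. bdry B x + e *\<^sub>R k \<notin> closure (region B))"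
      then have "k = n \<or> k = - n"
        using orthogonal_unit[of k "tangent B x"] t1 sg(1) by (auto simp: n_def abs_if split: if_splits)
      \<comment> \<open>The opposite unit vector points into the region, by the inner part of the
        cone, so it fails the condition in \<open>normal\<close>.\<close>
      moreover have "k \<noteq> - n"
      proof
        assume "k = - n"
        then have "\<forall>\<^sub>F s in at_right 0. bdry B x - s *\<^sub>R n \<notin> closure (region B)" using k by simp
        moreover have "\<forall>\<^sub>F s in at_right 0. bdry B x - s *\<^sub>R n \<in> region B"
          unfolding eventually_at_right_field using ins e(1) rP by (intro exI[of _ "e * rP"]) auto
        ultimately have "\<forall>\<^sub>F s in at_right (0::real). False"
          by eventually_elim (use closure_subset[of "region B"] in blast)
        then show False by (simp add: trivial_limit_at_right_real)
      qed
      ultimately show "k = n" by blast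
    qed
  qed
  then show ?thesis using sg(1) Peq unfolding P_def rP_def by blast
qed

section \<open>Outer velocities near a central configuration\<close>

lemma bdry_R2:
  assumes rb: "refraction_billiard B"
  shows "(norm (bdry B x))\<^sup>2 < R2 B" "R2 B > 0"
proof -
  have pos: "omega B > 0" "energy B > 0" by (rule billiardD[OF rb])+
  have "(norm (bdry B x))\<^sup>2 < (sqrt (2 * energy B) / omega B)\<^sup>2"
    using bdry_props(4)[OF rb] by (intro power_strict_mono) auto
  also have "\<dots> = R2 B" using pos by (simp add: R2_def power_divide)
  finally show "(norm (bdry B x))\<^sup>2 < R2 B" .
  show "R2 B > 0" using pos by (simp add: R2_def)
qed

text \<open>For equal ends the arc is radial, going out and falling back. The discriminant is then
  the square of \<open>R2 - |P|^2\<close>; as \<open>0 < |P|^2 < R2\<close>, it is positive and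
  \<open>cE\<close> lies strictly between \<open>-1\<close> and \<open>1\<close>. This is what keeps
  the root and the denominator of \<open>vE\<close> harmless near the diagonal.\<close>

lemma outer_data_diagonal:
  fixes x :: real
  assumes rb: "refraction_billiard B"
  defines "P \<equiv> bdry B x"
  shows "discE B P P = (R2 B - (norm P)\<^sup>2)\<^sup>2" "discE B P P > 0"
    "cE B P P = 2 * (norm P)\<^sup>2 / R2 B - 1" "\<bar>cE B P P\<bar> < 1"
proof -
  have P: "(norm P)\<^sup>2 < R2 B" "R2 B > 0" "(norm P)\<^sup>2 > 0"
    using bdry_R2[OF rb] bdry_props(3)[OF rb] by (auto simp: P_def)
  show d: "discE B P P = (R2 B - (norm P)\<^sup>2)\<^sup>2"
    by (simp add: discE_def dot_square_norm) (simp add: power2_eq_square power4_eq_xxxx algebra_simps)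
  then show "discE B P P > 0" using P by simp
  show c: "cE B P P = 2 * (norm P)\<^sup>2 / R2 B - 1"
    using P bdry_R2(2)[OF rb, THEN less_imp_neq] by (simp add: cE_def d dot_square_norm diff_divide_distrib add_divide_distrib)
  have "0 < 2 * (norm P)\<^sup>2 / R2 B" using P(3) by (intro divide_pos_pos[OF _ P(2)]) simp
  moreover have "2 * (norm P)\<^sup>2 / R2 B < 2" using P(1) by (simp add: divide_less_eq bdry_R2(2)[OF rb])
  ultimately show "\<bar>cE B P P\<bar> < 1" unfolding c by (simp add: abs_less_iff)
qed

lemma loclip_outer:
  assumes rb: "refraction_billiard B" and "loclip p a" "loclip q a" "p a = bdry B x" "q a = bdry B x"
  shows "loclip (\<lambda>z. discE B (p z) (q z)) a" "loclip (\<lambda>z. cE B (p z) (q z)) a"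
    "loclip (\<lambda>z. vE B (p z) (q z)) a"
proof -
  note diag = outer_data_diagonal[OF rb, of x]
  show d: "loclip (\<lambda>z. discE B (p z) (q z)) a"
    unfolding discE_def by (intro loclip_intros assms)
  show c: "loclip (\<lambda>z. cE B (p z) (q z)) a"
    unfolding cE_def by (intro loclip_intros d assms) (use diag(2) assms(4,5) bdry_R2[OF rb] in auto)
  have "(cE B (p a) (q a))\<^sup>2 < 1"
    using diag(4) assms(4,5) by (simp add: abs_square_less_1)
  then show "loclip (\<lambda>z. vE B (p z) (q z)) a"
    unfolding vE_def by (intro loclip_intros d c assms) auto
qed

text \<open>The analytic conditions are open and hold at \<open>x = y = x0\<close>, where
  \<open>vE\<close> is a positive multiple of \<open>P\<close>. The geometric one follows from
  \<open>exterior_cone\<close>, since the vector \<open>p + et (q - p)\<close> stays close to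
  \<open>P\<close>.\<close>

lemma outer_near:
  assumes rb: "refraction_billiard B" and cc: "central_configuration B x0"
  shows "\<forall>\<^sub>F d in at_right 0. \<forall>x y. \<bar>x - x0\<bar> < d \<longrightarrow> \<bar>y - x0\<bar> < d \<longrightarrow>
    discE B (bdry B x) (bdry B y) \<ge> 0 \<and> \<bar>cE B (bdry B x) (bdry B y)\<bar> < 1 \<and>
    normal B x \<bullet> vE B (bdry B x) (bdry B y) > 0 \<and>
    (\<forall>lam et. lam > 0 \<longrightarrow> \<bar>et\<bar> \<le> 2 / (1 - cE B (bdry B x) (bdry B y)) \<longrightarrow>
       bdry B x + lam *\<^sub>R (bdry B x + et *\<^sub>R (bdry B y - bdry B x)) \<notin> closure (region B))"
proof (rule eventually_near_pair)
  define P where "P = bdry B x0"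
  define p q :: "real \<times> real \<Rightarrow> complex" where "p = (\<lambda>z. bdry B (fst z))" and "q = (\<lambda>z. bdry B (snd z))"
  have lip: "loclip p (x0, x0)" "loclip q (x0, x0)"
    unfolding p_def q_def by (intro loclip_intros loclip_bdry[OF rb])+
  have at: "p (x0, x0) = bdry B x0" "q (x0, x0) = bdry B x0" by (auto simp: p_def q_def)
  note cont = loclip_isCont[OF loclip_outer(1)[OF rb lip at]] loclip_isCont[OF loclip_outer(2)[OF rb lip at]]
    loclip_isCont[OF loclip_outer(3)[OF rb lip at]] loclip_isCont[OF lip(1)] loclip_isCont[OF lip(2)]
  note diag = outer_data_diagonal[OF rb, of x0, folded P_def]
  obtain sg where sg: "\<bar>sg\<bar> = 1" "P = (norm P * sg) *\<^sub>R (\<i> * tangent B x0)"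
    "\<forall>\<^sub>F x in nhds x0. normal B x = sg *\<^sub>R (\<i> * tangent B x)"
    using normal_near[OF rb cc] unfolding P_def by blast
  have P0: "P \<noteq> 0" using bdry_props(3)[OF rb] by (simp add: P_def)
  define c0 where "c0 = cE B P P"
  \<comment> \<open>Twice the limit value \<open>2 / (1 - c0)\<close>, so that \<open>K\<close>
    bounds \<open>2 / (1 - cE)\<close> in a neighbourhood.\<close>
  define K where "K = 4 / (1 - c0)"
  have c0: "\<bar>c0\<bar> < 1" using diag by (simp add: c0_def)
  have K: "K > 0" using c0 by (simp add: K_def)
  obtain e where e: "e > 0"
    "\<And>x w l. \<bar>x - x0\<bar> < e \<Longrightarrow> norm (w - bdry B x0) < e \<Longrightarrow> 0 < l \<Longrightarrow>
      bdry B x + l *\<^sub>R w \<notin> closure (region B)"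
    by (rule exterior_cone[OF rb cc]) (rule that)
  have ct: "isCont (tangent B) x" for x by (rule billiardD[OF rb])
  have "isCont (\<lambda>z. tangent B (fst z)) (x0, x0)"
    by (rule isCont_o2[OF _ ct]) (intro continuous_intros)
  then have n: "isCont (\<lambda>z. (sg *\<^sub>R (\<i> * tangent B (fst z))) \<bullet> vE B (p z) (q z)) (x0, x0)"
    by (intro continuous_intros cont)
  have n0: "(sg *\<^sub>R (\<i> * tangent B (fst (x0, x0)))) \<bullet> vE B (p (x0, x0)) (q (x0, x0)) > 0"
  proof -
    define k where "k = omega B / sqrt (1 - c0\<^sup>2) * (1 - c0)"
    have "vE B P P = k *\<^sub>R P"
    proof -
      have "P - c0 *\<^sub>R P = (1 - c0) *\<^sub>R P" by (simp add: scaleR_diff_left)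
      then show ?thesis by (simp add: vE_def c0_def[symmetric] k_def)
    qed
    moreover have "(sg *\<^sub>R (\<i> * tangent B x0)) \<bullet> P = norm P"
    proof -
      have "sg * sg = 1" using sg(1) by (metis abs_mult_self_eq mult_1)
      moreover have "(\<i> * tangent B x0) \<bullet> (\<i> * tangent B x0) = 1"
        using billiardD(12)[OF rb, of x0] by (simp add: dot_square_norm norm_mult)
      ultimately show ?thesis
        by (subst sg(2)) simp
    qed
    moreover have "k > 0"
      using c0 billiardD(1)[OF rb] by (simp add: k_def abs_square_less_1)
    ultimately have "(sg *\<^sub>R (\<i> * tangent B x0)) \<bullet> vE B P P > 0"
      using P0 by simp
    then show ?thesis by (simp add: at P_def[symmetric])
  qed
  have ev: "\<forall>\<^sub>F z in nhds (x0, x0). 0 < discE B (p z) (q z)"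
    "\<forall>\<^sub>F z in nhds (x0, x0). \<bar>cE B (p z) (q z)\<bar> < 1"
    "\<forall>\<^sub>F z in nhds (x0, x0). 0 < (sg *\<^sub>R (\<i> * tangent B (fst z))) \<bullet> vE B (p z) (q z)"
    "\<forall>\<^sub>F z in nhds (x0, x0). (1 - c0) / 2 < 1 - cE B (p z) (q z)"
    "\<forall>\<^sub>F z in nhds (x0, x0). \<bar>fst z - x0\<bar> < e"
    "\<forall>\<^sub>F z in nhds (x0, x0). norm (p z - P) + K * norm (q z - p z) < e"
    by (rule isCont_eventually_less; (intro continuous_intros cont n)?;
        use diag n0 e c0 in \<open>auto simp: at P_def[symmetric] c0_def[symmetric]\<close>)+
  have "\<forall>\<^sub>F z in nhds (x0, x0). normal B (fst z) = sg *\<^sub>R (\<i> * tangent B (fst z))"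
  proof (rule eventually_compose_filterlim[OF sg(3)])
    show "filterlim fst (nhds x0) (nhds (x0, x0))"
      using tendsto_fst[OF filterlim_ident, of "(x0, x0)"] by (simp add: nhds_prod)
  qed
  then show "\<forall>\<^sub>F z in nhds (x0, x0). discE B (bdry B (fst z)) (bdry B (snd z)) \<ge> 0 \<and>
      \<bar>cE B (bdry B (fst z)) (bdry B (snd z))\<bar> < 1 \<and>
      normal B (fst z) \<bullet> vE B (bdry B (fst z)) (bdry B (snd z)) > 0 \<and>
      (\<forall>lam et. lam > 0 \<longrightarrow> \<bar>et\<bar> \<le> 2 / (1 - cE B (bdry B (fst z)) (bdry B (snd z))) \<longrightarrow>
       bdry B (fst z) + lam *\<^sub>R (bdry B (fst z) + et *\<^sub>R (bdry B (snd z) - bdry B (fst z))) \<notin> closure (region B))"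
    using ev
  proof eventually_elim
    case (elim z)
    have "bdry B (fst z) + lam *\<^sub>R (p z + et *\<^sub>R (q z - p z)) \<notin> closure (region B)"
      if "lam > 0" "\<bar>et\<bar> \<le> 2 / (1 - cE B (p z) (q z))" for lam et
    proof (rule e(2))
      have "2 / (1 - cE B (p z) (q z)) \<le> K"
        unfolding K_def using elim(5) c0 by (simp add: field_simps)
      then have "norm (et *\<^sub>R (q z - p z)) \<le> K * norm (q z - p z)"
        using that by (simp add: mult_right_mono)
      then show "norm (p z + et *\<^sub>R (q z - p z) - bdry B x0) < e"
        using norm_triangle_ineq[of "p z - P" "et *\<^sub>R (q z - p z)"] elim(7)
        by (simp add: P_def algebra_simps)
    qed (use elim that in auto)
    then show ?case using elim by (auto simp: p_def q_def)
  qed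
qed

definition NE :: "billiard \<Rightarrow> real \<Rightarrow> real \<Rightarrow> real" where
  "NE B x y = vE B (bdry B x) (bdry B y) \<bullet> tangent B x"

lemma NE_lipschitz:
  assumes rb: "refraction_billiard B" and "C2_near (bdry B) x0"
  shows "\<exists>C\<ge>0. \<forall>\<^sub>F d in at_right 0. \<forall>x y. \<bar>x - x0\<bar> < d \<longrightarrow> \<bar>y - x0\<bar> < d \<longrightarrow>
    \<bar>NE B x y\<bar> \<le> C \<and> (\<forall>x' y'. \<bar>x' - x0\<bar> < d \<longrightarrow> \<bar>y' - x0\<bar> < d \<longrightarrow>
      \<bar>NE B x y - NE B x' y'\<bar> \<le> C * (\<bar>x - x'\<bar> + \<bar>y - y'\<bar>))"
proof -
  have p: "loclip (\<lambda>z. bdry B (fst z)) (x0, x0)" "loclip (\<lambda>z. bdry B (snd z)) (x0, x0)"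
    by (intro loclip_intros loclip_bdry[OF rb])+
  have "loclip (\<lambda>z. vE B (bdry B (fst z)) (bdry B (snd z)) \<bullet> tangent B (fst z)) (x0, x0)"
    using loclip_outer(3)[OF rb p, of x0] loclip_tangent[OF assms(2)]
    by (intro loclip_inner loclip_fst) simp_all
  from loclip_pair_eventually[OF this] show ?thesis by (simp add: NE_def)
qed

section \<open>Inner velocities for small \<open>mu / H\<close>\<close>

definition GI :: "real \<Rightarrow> complex \<Rightarrow> complex \<Rightarrow> complex" where
  "GI e p q = (1 / (2 * QI e p q * dI p q * norm p)) *\<^sub>R (norm q *\<^sub>R p + norm p *\<^sub>R q)
     - (e / (QI e p q * (DI e p q + QI e p q) * norm p)) *\<^sub>R p"

text \<open>\<open>GI\<close> is the deviation from the radial direction divided by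
  \<open>e\<close>. It is regular at \<open>e = 0\<close> since \<open>Q^2 = D^2 - e^2\<close> turns
  \<open>D / Q - 1\<close> into \<open>e^2 / (Q (D + Q))\<close>.\<close>

lemma wI_expansion:
  assumes "p \<noteq> 0" "DI e p q > 0" "(DI e p q)\<^sup>2 - e\<^sup>2 > 0"
  shows "wI e p q = e *\<^sub>R GI e p q - (1 / norm p) *\<^sub>R p"
proof -
  define D Q r where "D = DI e p q" and "Q = QI e p q" and "r = norm p"
  have pos: "D > 0" "Q > 0" "r > 0" using assms by (auto simp: D_def Q_def QI_def r_def)
  have "Q\<^sup>2 = D\<^sup>2 - e\<^sup>2" using assms by (simp add: Q_def QI_def D_def)
  then have "e * e = (D - Q) * (D + Q)" by (simp add: power2_eq_square algebra_simps)
  then have "e * (e / (Q * (D + Q) * r)) = (D - Q) * (D + Q) / (Q * (D + Q) * r)" by simp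
  also have "\<dots> = (D - Q) / (Q * r)" using pos by simp
  also have "\<dots> = D / (Q * r) - 1 / r" using pos by (simp add: field_simps)
  finally have key: "e * (e / (Q * (D + Q) * r)) = D / (Q * r) - 1 / r" .
  show ?thesis
    unfolding wI_def GI_def D_def[symmetric] Q_def[symmetric] r_def[symmetric] scaleR_diff_right scaleR_scaleR key
    by (simp add: scaleR_diff_left)
qed

text \<open>The limit of infinite inner energy, \<open>e = 0\<close>. The denominators of
  \<open>GI\<close> do not vanish there as long as the end points are not in opposite
  directions.\<close>

lemma inner_limit:
  assumes "norm p * norm q + p \<bullet> q > 0" "p \<noteq> 0"
  shows "dI p q < 0" "DI 0 p q = - 2 * dI p q" "QI 0 p q = - 2 * dI p q"
proof -
  show d: "dI p q < 0" using assms by (simp add: dI_def)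
  show D: "DI 0 p q = - 2 * dI p q" using d by (simp add: DI_def)
  then show "QI 0 p q = - 2 * dI p q" using d by (simp add: QI_def real_sqrt_mult)
qed

lemma loclip_inner_data:
  assumes f: "loclip f a" "f a = 0" and p: "loclip p a" "p a = P" and q: "loclip q a" "q a = Q"
    and pos: "norm P * norm Q + P \<bullet> Q > 0" "P \<noteq> 0"
  shows "loclip (\<lambda>z. DI (f z) (p z) (q z)) a" "loclip (\<lambda>z. GI (f z) (p z) (q z)) a"
proof -
  note lim = inner_limit[OF pos]
  have d: "loclip (\<lambda>z. dI (p z) (q z)) a"
    unfolding dI_def by (intro loclip_intros p q) (use pos p(2) q(2) in auto)
  show D: "loclip (\<lambda>z. DI (f z) (p z) (q z)) a"
    unfolding DI_def by (intro loclip_intros d f p q) (use lim f(2) p(2) q(2) in auto)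
  have Q: "loclip (\<lambda>z. QI (f z) (p z) (q z)) a"
    unfolding QI_def by (intro loclip_intros D f) (use lim f(2) p(2) q(2) in auto)
  show "loclip (\<lambda>z. GI (f z) (p z) (q z)) a"
    unfolding GI_def by (intro loclip_intros Q D d f p q) (use lim f(2) p(2) q(2) pos in auto)
qed

definition NI :: "billiard \<Rightarrow> real \<Rightarrow> real \<Rightarrow> real \<Rightarrow> real" where
  "NI B e x y = GI e (bdry B x) (bdry B y) \<bullet> tangent B x"

lemma NI_lipschitz:
  assumes rb: "refraction_billiard B" and "C2_near (bdry B) x0"
    and pos: "norm (bdry B x0) * norm (bdry B y0) + bdry B x0 \<bullet> bdry B y0 > 0"
  shows "\<exists>C\<ge>0. \<forall>\<^sub>F d in at_right 0. \<forall>e x y. \<bar>e - 0\<bar> < d \<longrightarrow> \<bar>x - x0\<bar> < d \<longrightarrow> \<bar>y - y0\<bar> < d \<longrightarrow>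
    \<bar>NI B e x y\<bar> \<le> C \<and> (\<forall>x' y'. \<bar>x' - x0\<bar> < d \<longrightarrow> \<bar>y' - y0\<bar> < d \<longrightarrow>
      \<bar>NI B e x y - NI B e x' y'\<bar> \<le> C * (\<bar>x - x'\<bar> + \<bar>y - y'\<bar>))"
proof -
  have p: "loclip (\<lambda>z. bdry B (fst (snd z))) (0, x0, y0)" "loclip (\<lambda>z. bdry B (snd (snd z))) (0, x0, y0)"
    "loclip (\<lambda>z. tangent B (fst (snd z))) (0, x0, y0)"
    using loclip_bdry[OF rb] loclip_tangent[OF assms(2)] by (auto intro!: loclip_snd loclip_fst)
  have f: "loclip fst (0, x0, y0)"
    using loclip_fst[OF loclip_ident, of "(0, x0, y0)"] by simp
  have "loclip (\<lambda>z. GI (fst z) (bdry B (fst (snd z))) (bdry B (snd (snd z))) \<bullet> tangent B (fst (snd z))) (0, x0, y0)"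
    by (intro loclip_inner p loclip_inner_data(2)[OF f _ p(1) _ p(2) _ pos]) (use bdry_props[OF rb] in auto)
  from loclip_triple_eventually[OF this] show ?thesis by (simp add: NI_def)
qed

text \<open>The leading term \<open>- p / |p|\<close> of \<open>wI\<close> contributes
  \<open>- rho1\<close> to the tangential component and points straight inwards at a central
  configuration; the rest carries the factor \<open>e\<close>.\<close>

lemma inner_near:
  assumes rb: "refraction_billiard B" and cc: "central_configuration B x0"
    and pos: "norm (bdry B x0) * norm (bdry B y0) + bdry B x0 \<bullet> bdry B y0 > 0"
  shows "\<forall>\<^sub>F d in at_right 0. \<forall>e x y. \<bar>e - 0\<bar> < d \<longrightarrow> \<bar>x - x0\<bar> < d \<longrightarrow> \<bar>y - y0\<bar> < d \<longrightarrow>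
    wI e (bdry B x) (bdry B y) \<bullet> tangent B x = e * NI B e x y - rho1 B x \<and>
    normal B x \<bullet> wI e (bdry B x) (bdry B y) < 0"
proof (rule eventually_near_triple)
  define a where "a = (0::real, x0, y0)"
  define p q :: "real \<times> real \<times> real \<Rightarrow> complex"
    where "p = (\<lambda>z. bdry B (fst (snd z)))" and "q = (\<lambda>z. bdry B (snd (snd z)))"
  have lip: "loclip p a" "loclip q a" "loclip fst a"
    unfolding p_def q_def a_def using loclip_bdry[OF rb] loclip_fst[OF loclip_ident, of "(0, x0, y0)"]
    by (auto intro!: loclip_snd loclip_fst)
  have at: "fst a = 0" "p a = bdry B x0" "q a = bdry B y0" "fst (snd a) = x0" by (auto simp: p_def q_def a_def)
  have nz: "bdry B x \<noteq> 0" for x by (rule bdry_props[OF rb])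
  note lip2 = loclip_inner_data[OF lip(3) at(1) lip(1) at(2) lip(2) at(3) pos nz]
  note lim = inner_limit[OF pos nz]
  obtain sg where sg: "\<bar>sg\<bar> = 1" "bdry B x0 = (norm (bdry B x0) * sg) *\<^sub>R (\<i> * tangent B x0)"
    "\<forall>\<^sub>F x in nhds x0. normal B x = sg *\<^sub>R (\<i> * tangent B x)"
    using normal_near[OF rb cc] by blast
  have ct: "isCont (tangent B) x" for x by (rule billiardD[OF rb])
  have tn: "isCont (\<lambda>z. tangent B (fst (snd z))) a"
    by (rule isCont_o2[OF _ ct]) (intro continuous_intros)
  have n: "isCont (\<lambda>z. (sg *\<^sub>R (\<i> * tangent B (fst (snd z)))) \<bullet>
      (fst z *\<^sub>R GI (fst z) (p z) (q z) - (1 / norm (p z)) *\<^sub>R p z)) a"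
    by (intro continuous_intros tn lip2[THEN loclip_isCont] lip[THEN loclip_isCont]) (simp add: at nz)
  have n0: "(sg *\<^sub>R (\<i> * tangent B (fst (snd a)))) \<bullet>
      (fst a *\<^sub>R GI (fst a) (p a) (q a) - (1 / norm (p a)) *\<^sub>R p a) < 0"
  proof -
    have "sg * sg = 1" using sg(1) by (metis abs_mult_self_eq mult_1)
    moreover have "(\<i> * tangent B x0) \<bullet> (\<i> * tangent B x0) = 1"
      using billiardD(12)[OF rb, of x0] by (simp add: dot_square_norm norm_mult)
    moreover have "(1 / norm (bdry B x0)) *\<^sub>R bdry B x0 = sg *\<^sub>R (\<i> * tangent B x0)"
      by (subst (2) sg(2)) (use nz in simp)
    ultimately show ?thesis by (simp add: at)
  qed
  have ev: "\<forall>\<^sub>F z in nhds a. 0 < DI (fst z) (p z) (q z)"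
    "\<forall>\<^sub>F z in nhds a. 0 < (DI (fst z) (p z) (q z))\<^sup>2 - (fst z)\<^sup>2"
    "\<forall>\<^sub>F z in nhds a. (sg *\<^sub>R (\<i> * tangent B (fst (snd z)))) \<bullet>
      (fst z *\<^sub>R GI (fst z) (p z) (q z) - (1 / norm (p z)) *\<^sub>R p z) < 0"
    by (rule isCont_eventually_less; (intro continuous_intros lip2[THEN loclip_isCont] lip[THEN loclip_isCont] n)?;
        use lim n0 in \<open>simp add: at\<close>)+
  have "\<forall>\<^sub>F z in nhds a. normal B (fst (snd z)) = sg *\<^sub>R (\<i> * tangent B (fst (snd z)))"
  proof (rule eventually_compose_filterlim[OF sg(3)])
    show "filterlim (\<lambda>z. fst (snd z)) (nhds x0) (nhds a)"
      using tendsto_fst[OF tendsto_snd[OF filterlim_ident], of "(0, x0, y0)"] by (simp add: a_def)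
  qed
  then have "\<forall>\<^sub>F z in nhds a. wI (fst z) (p z) (q z) \<bullet> tangent B (fst (snd z)) =
      fst z * NI B (fst z) (fst (snd z)) (snd (snd z)) - rho1 B (fst (snd z)) \<and>
    normal B (fst (snd z)) \<bullet> wI (fst z) (p z) (q z) < 0"
    using ev
  proof eventually_elim
    case (elim z)
    have "wI (fst z) (p z) (q z) = fst z *\<^sub>R GI (fst z) (p z) (q z) - (1 / norm (p z)) *\<^sub>R p z"
      by (rule wI_expansion) (use elim nz in \<open>auto simp: p_def\<close>)
    then show ?case
      using elim by (simp add: NI_def rho1_def p_def q_def inner_diff_left)
  qed
  then show "\<forall>\<^sub>F z in nhds (0, x0, y0). wI (fst z) (bdry B (fst (snd z))) (bdry B (snd (snd z))) \<bullet> tangent B (fst (snd z)) =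
      fst z * NI B (fst z) (fst (snd z)) (snd (snd z)) - rho1 B (fst (snd z)) \<and>
    normal B (fst (snd z)) \<bullet> wI (fst z) (bdry B (fst (snd z))) (bdry B (snd (snd z))) < 0"
    by (simp add: p_def q_def a_def)
qed

section \<open>Directions of chords near central configurations\<close>

lemma not_antipodal_pos:
  assumes rb: "refraction_billiard B" and "\<not> antipodal B x y"
  shows "norm (bdry B x) * norm (bdry B y) + bdry B x \<bullet> bdry B y > 0"
proof -
  have "norm (bdry B x) * norm (bdry B y) + bdry B x \<bullet> bdry B y \<noteq> 0"
    using opposite_directions[OF _ bdry_props(3)[OF rb]] assms(2) unfolding antipodal_def by blast
  moreover have "\<bar>bdry B x \<bullet> bdry B y\<bar> \<le> norm (bdry B x) * norm (bdry B y)"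
    by (rule Cauchy_Schwarz_ineq2)
  ultimately show ?thesis by linarith
qed

lemma Re_cnj_mult: "Re (cnj p * q) = p \<bullet> q"
  by (simp add: inner_complex_def)

text \<open>Parallel position vectors that are not opposite lie on one ray, and the ray of a central
  configuration meets the boundary only once.\<close>

lemma distinct_rays:
  assumes rb: "refraction_billiard B" and cc: "central_configuration B x"
    and na: "\<not> antipodal B x y" and ne: "bdry B x \<noteq> bdry B y"
  shows "Im (cnj (bdry B x) * bdry B y) \<noteq> 0"
proof
  define P Q where "P = bdry B x" and "Q = bdry B y"
  assume "Im (cnj (bdry B x) * bdry B y) = 0"
  then have real: "cnj P * Q = of_real (P \<bullet> Q)"
    by (simp add: complex_eq_iff P_def Q_def inner_complex_def)
  have P: "P \<noteq> 0" using bdry_props(3)[OF rb] by (simp add: P_def)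
  have "norm P * norm Q + P \<bullet> Q > 0"
    using not_antipodal_pos[OF rb na] by (simp add: P_def Q_def)
  moreover have "norm P * norm Q = \<bar>P \<bullet> Q\<bar>"
    using arg_cong[OF real, of norm] by (simp add: norm_mult)
  ultimately have pos: "P \<bullet> Q > 0" by linarith
  have "of_real ((norm P)\<^sup>2) * Q = P * (cnj P * Q)"
    by (simp add: complex_norm_square mult.assoc del: of_real_power)
  also have "\<dots> = of_real (P \<bullet> Q) * P" unfolding real by simp
  finally have "(norm P)\<^sup>2 *\<^sub>R Q = (P \<bullet> Q) *\<^sub>R P" by (simp only: scaleR_conv_of_real)
  then have "Q = (P \<bullet> Q / (norm P)\<^sup>2) *\<^sub>R P"
    using P by (metis (no_types, lifting) divide_inverse_commute norm_eq_zero power_not_zero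
        scaleR_scaleR scaleR_left_imp_eq scaleR_one left_inverse)
  moreover have "P \<bullet> Q / (norm P)\<^sup>2 \<ge> 0" using pos by simp
  ultimately have "Q \<in> {s *\<^sub>R P | s. s \<ge> 0}" by blast
  moreover have "Q \<in> frontier (region B)" unfolding Q_def by (rule bdry_frontier[OF rb])
  ultimately have "Q = P"
    using cc unfolding central_configuration_def P_def by blast
  then show False using ne by (simp add: P_def Q_def)
qed

text \<open>A short chord is almost tangent, hence almost orthogonal to the position vector. With
  derivative error \<open>1/8\<close> its transverse part is at least \<open>5/8\<close>, its radial
  part at most \<open>3/8\<close> of \<open>|y - x| |P|\<close>, both multiplied by
  \<open>|p|\<close>.\<close>

lemma chord_near_same:
  assumes rb: "refraction_billiard B" and cc: "central_configuration B x0"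
  shows "\<forall>\<^sub>F d in at_right 0. \<forall>x y. \<bar>x - x0\<bar> < d \<longrightarrow> \<bar>y - x0\<bar> < d \<longrightarrow> bdry B x \<noteq> bdry B y \<longrightarrow>
    1 * ((norm (bdry B x))\<^sup>2 - bdry B x \<bullet> bdry B y) < \<bar>Im (cnj (bdry B x) * bdry B y)\<bar>"
proof -
  define P t0 where "P = bdry B x0" and "t0 = tangent B x0"
  have P: "norm P > 0" using bdry_props(3)[OF rb] by (simp add: P_def)
  have t0: "norm t0 = 1" "P \<bullet> t0 = 0"
    using billiardD(12)[OF rb] central_configuration_tangent[OF rb cc] by (auto simp: t0_def P_def)
  have im: "\<bar>Im (cnj P * t0)\<bar> = norm P"
  proof -
    have "(norm (cnj P * t0))\<^sup>2 = (Re (cnj P * t0))\<^sup>2 + (Im (cnj P * t0))\<^sup>2" by (rule cmod_power2)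
    then have "(norm P)\<^sup>2 = (Im (cnj P * t0))\<^sup>2"
      unfolding Re_cnj_mult using t0 by (simp add: norm_mult)
    then show ?thesis by (metis abs_norm_cancel power2_eq_iff abs_minus abs_if)
  qed
  obtain e where e: "e > 0" "\<And>x y. dist x x0 < e \<Longrightarrow> dist y x0 < e \<Longrightarrow>
      norm (bdry B y - bdry B x - (y - x) *\<^sub>R tangent B x0) \<le> 1/8 * \<bar>y - x\<bar>"
    by (rule bdry_strict[OF rb, of "1/8" x0]) (simp, rule that)
  show ?thesis
    unfolding eventually_at_right_field
  proof (intro exI[of _ "min e (norm P / 8)"] conjI allI impI)
    fix d x y assume d: "0 < d" "d < min e (norm P / 8)" and xy: "\<bar>x - x0\<bar> < d" "\<bar>y - x0\<bar> < d"
      and ne: "bdry B x \<noteq> bdry B y"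
    define p v er where "p = bdry B x" and "v = bdry B y - bdry B x"
      and "er = bdry B y - bdry B x - (y - x) *\<^sub>R t0"
    have h: "\<bar>y - x\<bar> > 0" using ne by auto
    have er: "norm er \<le> 1/8 * \<bar>y - x\<bar>"
      using e(2)[of x y] xy d by (simp add: er_def t0_def dist_real_def)
    have pP: "norm (p - P) \<le> norm P / 8"
      using bdry_lipschitz[OF rb, of x x0] xy d by (simp add: p_def P_def)
    have np: "norm p \<le> 9/8 * norm P"
      using norm_triangle_ineq[of P "p - P"] pP by simp
    have exp: "cnj p * v = of_real (y - x) * (cnj P * t0) + (of_real (y - x) * (cnj (p - P) * t0) + cnj p * er)"
      by (simp add: v_def er_def scaleR_conv_of_real algebra_simps)
    define R where "R = of_real (y - x) * (cnj (p - P) * t0) + cnj p * er"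
    have R: "norm R \<le> 3/8 * (\<bar>y - x\<bar> * norm P)"
    proof -
      have "norm R \<le> \<bar>y - x\<bar> * norm (p - P) + norm p * norm er"
        unfolding R_def by (rule order_trans[OF norm_triangle_ineq])
          (simp add: norm_mult t0 flip: complex_cnj_diff of_real_diff del: complex_cnj_diff of_real_diff)
      also have "\<dots> \<le> \<bar>y - x\<bar> * (norm P / 8) + (9/8 * norm P) * (1/8 * \<bar>y - x\<bar>)"
        by (intro add_mono mult_mono pP np er) (use P in auto)
      also have "\<dots> \<le> 3/8 * (\<bar>y - x\<bar> * norm P)" by (simp add: mult.commute)
      finally show ?thesis .
    qed
    have eq: "Im (cnj p * v) = (y - x) * Im (cnj P * t0) + Im R"
      unfolding exp R_def by simp
    have "\<bar>(y - x) * Im (cnj P * t0)\<bar> = \<bar>y - x\<bar> * norm P"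
      unfolding abs_mult im ..
    then have "\<bar>Im (cnj p * v)\<bar> \<ge> \<bar>y - x\<bar> * norm P - \<bar>Im R\<bar>"
      unfolding eq by linarith
    then have 1: "\<bar>Im (cnj p * v)\<bar> \<ge> 5/8 * (\<bar>y - x\<bar> * norm P)"
      using abs_Im_le_cmod[of R] R by linarith
    have "p \<bullet> v = (y - x) * (P \<bullet> t0) + Re R"
      unfolding Re_cnj_mult[symmetric] exp R_def by simp
    then have 2: "\<bar>p \<bullet> v\<bar> \<le> 3/8 * (\<bar>y - x\<bar> * norm P)"
      using abs_Re_le_cmod[of R] R t0 by simp
    have "\<bar>y - x\<bar> * norm P > 0" using h P by simp
    then have "- (p \<bullet> v) < \<bar>Im (cnj p * v)\<bar>" using 1 2 by linarith
    moreover have "Im (cnj p * v) = Im (cnj (bdry B x) * bdry B y)"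
      by (simp add: v_def p_def right_diff_distrib)
    moreover have "- (p \<bullet> v) = (norm (bdry B x))\<^sup>2 - bdry B x \<bullet> bdry B y"
      by (simp add: v_def p_def inner_diff_right power2_norm_eq_inner)
    ultimately show "1 * ((norm (bdry B x))\<^sup>2 - bdry B x \<bullet> bdry B y) < \<bar>Im (cnj (bdry B x) * bdry B y)\<bar>"
      by simp
  qed (use e P in auto)
qed

text \<open>Divided by \<open>|p|\<close>, the two sides compare the inward radial with the
  transverse part of the chord \<open>q - p\<close>. A direct arc starting with slope at most
  \<open>k\<close> would contradict this by \<open>direct_velocity\<close>. For distinct
  configurations the transverse part does not vanish in the limit, and \<open>k\<close> is chosen
  from the limit values with a factor 2 to spare.\<close>

lemma chord_near:
  assumes rb: "refraction_billiard B" and cc: "central_configuration B x0"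
    and dir: "y0 = x0 \<or> Im (cnj (bdry B x0) * bdry B y0) \<noteq> 0"
  shows "\<exists>k>0. \<forall>\<^sub>F d in at_right 0. \<forall>x y. \<bar>x - x0\<bar> < d \<longrightarrow> \<bar>y - y0\<bar> < d \<longrightarrow> bdry B x \<noteq> bdry B y \<longrightarrow>
    k * ((norm (bdry B x))\<^sup>2 - bdry B x \<bullet> bdry B y) < \<bar>Im (cnj (bdry B x) * bdry B y)\<bar>"
proof (cases "y0 = x0")
  case True
  then show ?thesis using chord_near_same[OF rb cc] zero_less_one by blast
next
  case False
  define f where "f z = (norm (bdry B (fst z)))\<^sup>2 - bdry B (fst z) \<bullet> bdry B (snd z)" for z
  define g where "g z = \<bar>Im (cnj (bdry B (fst z)) * bdry B (snd z))\<bar>" for z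
  define k where "k = g (x0, y0) / (2 * (1 + \<bar>f (x0, y0)\<bar>))"
  have g0: "g (x0, y0) > 0" using dir False by (simp add: g_def)
  have k: "k > 0" using g0 by (simp add: k_def add_pos_nonneg)
  have "k * f (x0, y0) \<le> k * (1 + \<bar>f (x0, y0)\<bar>)" using k by (intro mult_left_mono) auto
  also have "\<dots> = g (x0, y0) / 2"
  proof -
    have "1 + \<bar>f (x0, y0)\<bar> > 0" by (intro add_pos_nonneg) auto
    moreover have "a / (2 * b) * b = a / 2" if "b > 0" for a b :: real
      using that by simp
    ultimately show ?thesis unfolding k_def by blast
  qed
  also have "\<dots> < g (x0, y0)" using g0 by simp
  finally have less: "k * f (x0, y0) < g (x0, y0)" .
  have cb: "isCont (bdry B) x" for x by (rule loclip_isCont[OF loclip_bdry[OF rb]])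
  have c: "isCont (\<lambda>z. bdry B (fst z)) (x0, y0)" "isCont (\<lambda>z. bdry B (snd z)) (x0, y0)"
    by (rule isCont_o2[OF _ cb]; intro continuous_intros)+
  have "isCont f (x0, y0)" "isCont g (x0, y0)"
    unfolding f_def g_def by (intro continuous_intros c isCont_Im isCont_cnj)+
  then have "\<forall>\<^sub>F z in nhds (x0, y0). k * f z < g z"
    by (intro isCont_eventually_less continuous_intros less)
  then have "\<forall>\<^sub>F z in nhds (x0, y0). bdry B (fst z) \<noteq> bdry B (snd z) \<longrightarrow>
      k * ((norm (bdry B (fst z)))\<^sup>2 - bdry B (fst z) \<bullet> bdry B (snd z))
        < \<bar>Im (cnj (bdry B (fst z)) * bdry B (snd z))\<bar>"
    by eventually_elim (simp add: f_def g_def)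
  from eventually_near_pair[OF this] show ?thesis using k by blast
qed

lemma radial_near:
  assumes rb: "refraction_billiard B" and cc: "central_configuration B x0" and k: "k > 0"
  shows "\<forall>\<^sub>F d in at_right 0. \<forall>x. \<bar>x - x0\<bar> < d \<longrightarrow>
    norm (normal B x) = 1 \<and> normal B x \<bullet> tangent B x = 0 \<and>
    \<bar>bdry B x \<bullet> tangent B x\<bar> \<le> k * (bdry B x \<bullet> normal B x) \<and>
    bdry B x \<bullet> normal B x \<ge> norm (bdry B x0) / 2"
proof -
  obtain sg where sg: "\<bar>sg\<bar> = 1" "bdry B x0 = (norm (bdry B x0) * sg) *\<^sub>R (\<i> * tangent B x0)"
    "\<forall>\<^sub>F x in nhds x0. normal B x = sg *\<^sub>R (\<i> * tangent B x)"
    using normal_near[OF rb cc] by blast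
  have P: "norm (bdry B x0) > 0" using bdry_props(3)[OF rb] by simp
  have ct: "isCont (tangent B) x" for x by (rule billiardD[OF rb])
  have cb: "isCont (bdry B) x" for x by (rule loclip_isCont[OF loclip_bdry[OF rb]])
  have at: "bdry B x0 \<bullet> (sg *\<^sub>R (\<i> * tangent B x0)) = norm (bdry B x0)"
  proof -
    have "sg * sg = 1" using sg(1) by (metis abs_mult_self_eq mult_1)
    moreover have "(\<i> * tangent B x0) \<bullet> (\<i> * tangent B x0) = 1"
      using billiardD(12)[OF rb, of x0] by (simp add: dot_square_norm norm_mult)
    ultimately show ?thesis by (subst sg(2)) simp
  qed
  have ev: "\<forall>\<^sub>F x in nhds x0. \<bar>bdry B x \<bullet> tangent B x\<bar> < k * (bdry B x \<bullet> (sg *\<^sub>R (\<i> * tangent B x)))"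
    "\<forall>\<^sub>F x in nhds x0. norm (bdry B x0) / 2 < bdry B x \<bullet> (sg *\<^sub>R (\<i> * tangent B x))"
    by (rule isCont_eventually_less; (intro continuous_intros ct cb)?;
        use at P k central_configuration_tangent[OF rb cc] in simp)+
  have "\<forall>\<^sub>F x in nhds x0. norm (normal B x) = 1 \<and> normal B x \<bullet> tangent B x = 0 \<and>
    \<bar>bdry B x \<bullet> tangent B x\<bar> \<le> k * (bdry B x \<bullet> normal B x) \<and>
    bdry B x \<bullet> normal B x \<ge> norm (bdry B x0) / 2"
    using sg(3) ev
  proof eventually_elim
    case (elim x)
    have "norm (normal B x) = 1" "normal B x \<bullet> tangent B x = 0"
      unfolding elim(1) using sg(1) billiardD(12)[OF rb, of x] by (auto simp: norm_mult inner_complex_def)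
    then show ?case using elim by simp
  qed
  then obtain e where "e > 0" "\<And>x. dist x x0 < e \<Longrightarrow> norm (normal B x) = 1 \<and> normal B x \<bullet> tangent B x = 0 \<and>
    \<bar>bdry B x \<bullet> tangent B x\<bar> \<le> k * (bdry B x \<bullet> normal B x) \<and>
    bdry B x \<bullet> normal B x \<ge> norm (bdry B x0) / 2"
    unfolding eventually_nhds_metric by blast
  then show ?thesis
    unfolding eventually_at_right_field by (intro exI[of _ e]) (auto simp: dist_real_def)
qed

section \<open>Components of velocities and refraction\<close>

lemma orthonormal_expansion:
  fixes v n t :: complex
  assumes "norm n = 1" "n \<bullet> t = 0" "norm t = 1"
  shows "v = (v \<bullet> t) *\<^sub>R t + (v \<bullet> n) *\<^sub>R n" "(norm v)\<^sup>2 = (v \<bullet> t)\<^sup>2 + (v \<bullet> n)\<^sup>2"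
proof -
  have tt: "Re t * Re t + Im t * Im t = 1"
    using assms(3) cmod_power2[of t] by (simp add: power2_eq_square)
  have "v = (v \<bullet> t) *\<^sub>R t + (v \<bullet> (\<i> * t)) *\<^sub>R (\<i> * t)"
  proof (rule complex_eqI)
    have "Re ((v \<bullet> t) *\<^sub>R t + (v \<bullet> (\<i> * t)) *\<^sub>R (\<i> * t)) = Re v * (Re t * Re t + Im t * Im t)"
      by (simp add: inner_complex_def algebra_simps)
    then show "Re v = Re ((v \<bullet> t) *\<^sub>R t + (v \<bullet> (\<i> * t)) *\<^sub>R (\<i> * t))" by (simp add: tt)
    have "Im ((v \<bullet> t) *\<^sub>R t + (v \<bullet> (\<i> * t)) *\<^sub>R (\<i> * t)) = Im v * (Re t * Re t + Im t * Im t)"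
      by (simp add: inner_complex_def algebra_simps)
    then show "Im v = Im ((v \<bullet> t) *\<^sub>R t + (v \<bullet> (\<i> * t)) *\<^sub>R (\<i> * t))" by (simp add: tt)
  qed
  then show exp: "v = (v \<bullet> t) *\<^sub>R t + (v \<bullet> n) *\<^sub>R n"
    using orthogonal_unit[OF assms] by auto
  have "t \<bullet> t = 1" "n \<bullet> n = 1" using assms by (auto simp: dot_square_norm)
  then show "(norm v)\<^sup>2 = (v \<bullet> t)\<^sup>2 + (v \<bullet> n)\<^sup>2"
    unfolding power2_norm_eq_inner
    by (subst (1 2) exp) (use assms(2) in \<open>simp add: inner_add_left inner_add_right inner_commute power2_eq_square\<close>)
qed

lemma equal_vectors:
  fixes v w n t :: complex
  assumes "norm n = 1" "n \<bullet> t = 0" "norm t = 1" "(norm v)\<^sup>2 = (norm w)\<^sup>2" "v \<bullet> t = w \<bullet> t"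
    "sgn (v \<bullet> n) = sgn (w \<bullet> n)"
  shows "v = w"
proof -
  note e = orthonormal_expansion[OF assms(1-3)]
  have "(v \<bullet> n)\<^sup>2 = (w \<bullet> n)\<^sup>2" using e(2)[of v] e(2)[of w] assms(4,5) by simp
  then have "\<bar>v \<bullet> n\<bar> = \<bar>w \<bullet> n\<bar>" by (simp add: power2_eq_iff abs_eq_iff)
  then have "v \<bullet> n = w \<bullet> n" using assms(6) by (metis sgn_mult_abs mult.commute)
  then show ?thesis using e(1)[of v] e(1)[of w] assms(5) by simp
qed

lemma refract_props:
  fixes v :: complex
  assumes n: "norm (normal B x) = 1" "normal B x \<bullet> tangent B x = 0" "norm (tangent B x) = 1"
    and v: "(v \<bullet> tangent B x)\<^sup>2 < 2 * VI B h (bdry B x)" "v \<bullet> normal B x \<noteq> 0"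
  shows "refract B h x v \<bullet> tangent B x = v \<bullet> tangent B x"
    "sgn (refract B h x v \<bullet> normal B x) = sgn (v \<bullet> normal B x)"
    "(norm (refract B h x v))\<^sup>2 / 2 = VI B h (bdry B x)"
    "\<bar>refract B h x v \<bullet> normal B x\<bar> = sqrt (2 * VI B h (bdry B x) - (v \<bullet> tangent B x)\<^sup>2)"
proof -
  have nn: "tangent B x \<bullet> tangent B x = 1" "normal B x \<bullet> normal B x = 1" "tangent B x \<bullet> normal B x = 0"
    using n by (auto simp: dot_square_norm inner_commute)
  show 1: "refract B h x v \<bullet> tangent B x = v \<bullet> tangent B x"
    by (simp add: refract_def Let_def inner_add_left nn n)
  have 2: "refract B h x v \<bullet> normal B x
      = sgn (v \<bullet> normal B x) * sqrt (2 * VI B h (bdry B x) - (v \<bullet> tangent B x)\<^sup>2)"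
    by (simp add: refract_def Let_def inner_add_left nn n)
  have pos: "sqrt (2 * VI B h (bdry B x) - (v \<bullet> tangent B x)\<^sup>2) > 0" using v by simp
  show "sgn (refract B h x v \<bullet> normal B x) = sgn (v \<bullet> normal B x)"
    unfolding 2 sgn_mult using pos by simp
  show 3: "\<bar>refract B h x v \<bullet> normal B x\<bar> = sqrt (2 * VI B h (bdry B x) - (v \<bullet> tangent B x)\<^sup>2)"
    unfolding 2 abs_mult using pos v(2) by (simp add: abs_sgn_eq)
  have "(norm (refract B h x v))\<^sup>2
      = (v \<bullet> tangent B x)\<^sup>2 + \<bar>refract B h x v \<bullet> normal B x\<bar>\<^sup>2"
    using orthonormal_expansion(2)[OF n, of "refract B h x v"] 1 by simp
  then show "(norm (refract B h x v))\<^sup>2 / 2 = VI B h (bdry B x)"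
    unfolding 3 using v by simp
qed

subsection \<open>Steps of the return map\<close>

text \<open>Snell's law at the vertex \<open>x\<close>, where \<open>y\<close> and \<open>z\<close>
  are the other ends of the outer and the inner arc. Both velocities are taken as leaving
  \<open>x\<close>, whichever arc is traversed first; one of them is thus reversed, which is why the
  condition is a sum.\<close>

definition vertex_eq :: "billiard \<Rightarrow> real \<Rightarrow> real \<Rightarrow> real \<Rightarrow> real \<Rightarrow> real" where
  "vertex_eq B h x y z = vE B (bdry B x) (bdry B y) \<bullet> tangent B x
     + sqrt (2 * (energy B + h)) * (wI (mu B / (energy B + h)) (bdry B x) (bdry B z) \<bullet> tangent B x)"

lemma NA_commute: "i < num J \<Longrightarrow> j \<in> NA B J i \<Longrightarrow> i \<in> NA B J j"
  unfolding NA_def not_antipodal_def antipodal_def mem_Collect_eq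
  by (subst closed_segment_commute) blast

lemma VE_less_VI:
  assumes "refraction_billiard B" "h > 0"
  shows "VE B z < VI B h z"
proof -
  have "mu B / norm z \<ge> 0" using billiardD(2)[OF assms(1)] by simp
  moreover have "(omega B)\<^sup>2 / 2 * (norm z)\<^sup>2 \<ge> 0" by simp
  ultimately show ?thesis using assms(2) unfolding VE_def VI_def by linarith
qed

text \<open>\<open>unique_arc\<close> compares durations and positions only; velocities are
  recovered as derivatives, one-sided at the ends of the interval.\<close>

lemma motion_velocity_unique:
  assumes "is_motion acc T z v" "is_motion acc' T z' v'" "T > 0" "\<And>s. s \<in> {0..T} \<Longrightarrow> z' s = z s" "s \<in> {0..T}"
  shows "v' s = v s"
proof -
  have "(z has_vector_derivative v s) (at s within {0..T})"
    and z': "(z' has_vector_derivative v' s) (at s within {0..T})"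
    using assms by (auto simp: is_motion_def)
  moreover have "(z has_vector_derivative v' s) (at s within {0..T})"
    by (rule has_vector_derivative_transform[OF assms(5) _ z']) (simp add: assms(4))
  ultimately show ?thesis
    using vector_derivative_unique_within_closed_interval[OF assms(3), of s z "v' s" "v s"] assms(5)
    by (simp add: cbox_interval)
qed

text \<open>What the coding of orbits uses about one fixed \<open>h\<close>; the estimates near the
  central configurations enter only when these assumptions are verified. \<open>outer\<close>
  supplies what keeps the arcs of \<open>outer_flow_arc\<close> outside, and
  \<open>no_direct\<close> puts the initial slope of an inner step strictly below that of the
  chord.\<close>

locale coded_billiard =
  fixes B :: billiard and J :: intervals and h :: real
  assumes rb: "refraction_billiard B" and h: "h > 0"
    and disjoint: "\<And>i j x y. i < num J \<Longrightarrow> j < num J \<Longrightarrow> x \<in> cinterval J i \<Longrightarrow> y \<in> cinterval J j \<Longrightarrow>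
      bdry B x = bdry B y \<Longrightarrow> i = j \<and> x = y"
    and normal: "\<And>i x. i < num J \<Longrightarrow> x \<in> cinterval J i \<Longrightarrow>
      norm (normal B x) = 1 \<and> normal B x \<bullet> tangent B x = 0"
    and outer: "\<And>i x y. i < num J \<Longrightarrow> x \<in> cinterval J i \<Longrightarrow> y \<in> cinterval J i \<Longrightarrow>
      discE B (bdry B x) (bdry B y) \<ge> 0 \<and> \<bar>cE B (bdry B x) (bdry B y)\<bar> < 1 \<and>
      normal B x \<bullet> vE B (bdry B x) (bdry B y) > 0 \<and>
      (\<forall>lam et. lam > 0 \<longrightarrow> \<bar>et\<bar> \<le> 2 / (1 - cE B (bdry B x) (bdry B y)) \<longrightarrow>
         bdry B x + lam *\<^sub>R (bdry B x + et *\<^sub>R (bdry B y - bdry B x)) \<notin> closure (region B))"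
    and outer_unique: "\<And>i x y. i < num J \<Longrightarrow> x \<in> cinterval J i \<Longrightarrow> y \<in> cinterval J i \<Longrightarrow>
      unique_arc (outer_arc B x y)"
    and inner: "\<And>i j x y. i < num J \<Longrightarrow> j \<in> NA B J i \<Longrightarrow> x \<in> cinterval J i \<Longrightarrow> y \<in> cinterval J j \<Longrightarrow>
      (\<exists>T z v. inner_arc B h x y T z v) \<and> \<not> antipodal B x y \<and>
      normal B x \<bullet> wI (mu B / (energy B + h)) (bdry B x) (bdry B y) < 0"
    and no_direct: "\<And>i j x y v. i < num J \<Longrightarrow> j \<in> NA B J i \<Longrightarrow> x \<in> cinterval J i \<Longrightarrow> y \<in> cinterval J j \<Longrightarrow>
      (norm v)\<^sup>2 / 2 = VE B (bdry B x) \<Longrightarrow> normal B x \<bullet> v < 0 \<Longrightarrow>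
      \<exists>k\<ge>0. \<bar>Im (cnj (bdry B x) * refract B h x v)\<bar> \<le> k * (- (bdry B x \<bullet> refract B h x v)) \<and>
        (bdry B x \<noteq> bdry B y \<longrightarrow>
          k * ((norm (bdry B x))\<^sup>2 - bdry B x \<bullet> bdry B y) < \<bar>Im (cnj (bdry B x) * bdry B y)\<bar>)"
    and unique_solution: "\<And>l. l \<in> words B J \<Longrightarrow> \<exists>!x. \<forall>n. x n \<in> cinterval J (l (n div 2)) \<and>
      vertex_eq B h (x n) (x (if even n then n + 1 else n - 1)) (x (if even n then n - 1 else n + 1)) = 0"
begin

abbreviation "bd \<equiv> bdry B"
abbreviation "vO x y \<equiv> vE B (bd x) (bd y)"
abbreviation "wN x y \<equiv> sqrt (2 * (energy B + h)) *\<^sub>R wI (mu B / (energy B + h)) (bd x) (bd y)"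

lemma om: "omega B > 0" and E: "energy B > 0" and mu: "mu B > 0" and H: "energy B + h > 0"
  using billiardD(1-3)[OF rb] h by auto

lemma tan1: "norm (tangent B x) = 1"
  by (rule billiardD[OF rb])

lemma vertex_eq_inner: "vertex_eq B h x y z = vO x y \<bullet> tangent B x + wN x z \<bullet> tangent B x"
  by (simp add: vertex_eq_def)

lemma NA_less: "j \<in> NA B J i \<Longrightarrow> j < num J"
  by (simp add: NA_def)

lemma outer_phase:
  assumes "i < num J" "x \<in> cinterval J i" "y \<in> cinterval J i"
  shows "(x, vO x y) \<in> phase_out B J i" "(x, - vO x y) \<in> phase_in B J i"
    "(norm (vO x y))\<^sup>2 / 2 = VE B (bd x)" "normal B x \<bullet> vO x y > 0"
proof -
  show 1: "(norm (vO x y))\<^sup>2 / 2 = VE B (bd x)"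
    using outer[OF assms] by (intro outer_flow_arc(3) om E) auto
  show 2: "normal B x \<bullet> vO x y > 0" using outer[OF assms] by blast
  show "(x, vO x y) \<in> phase_out B J i" "(x, - vO x y) \<in> phase_in B J i"
    using 1 2 assms by (auto simp: phase_def)
qed

lemma outer_flow_outside:
  assumes "i < num J" "x \<in> cinterval J i" "y \<in> cinterval J i"
  defines "T \<equiv> arccos (cE B (bd x) (bd y)) / omega B"
  shows "first_hit (osc_flow (omega B)) {a. fst a \<in> closure (region B)} T (bd x, vO x y) (bd y, - vO y x)"
  unfolding first_hit_def
proof (intro conjI ballI)
  note o = outer[OF assms(1-3)] and o' = outer[OF assms(1,3,2)]
  have d: "discE B (bd x) (bd y) \<ge> 0" "\<bar>cE B (bd x) (bd y)\<bar> < 1" using o by auto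
  note arc = outer_flow_arc[OF om E d, folded T_def]
  show "0 < T" "osc_flow (omega B) T (bd x, vO x y) = (bd y, - vO y x)" by (rule arc)+
  fix s assume "s \<in> {0<..<T}"
  then obtain lam et where "lam > 0" "\<bar>et\<bar> \<le> 2 / (1 - cE B (bd x) (bd y))"
    "fst (osc_flow (omega B) s (bd x, vO x y)) = bd x + lam *\<^sub>R (bd x + et *\<^sub>R (bd y - bd x)) \<or>
     fst (osc_flow (omega B) s (bd x, vO x y)) = bd y + lam *\<^sub>R (bd y + et *\<^sub>R (bd x - bd y))"
    using arc(4)[of s] by auto
  then show "osc_flow (omega B) s (bd x, vO x y) \<notin> {a. fst a \<in> closure (region B)}"
    using o o' cE_commute[of B "bd x" "bd y"] by auto
qed

lemma outer_step_exists:
  assumes "i < num J" "x \<in> cinterval J i" "y \<in> cinterval J i"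
  shows "outer_step B (x, vO x y) (y, - vO y x)"
proof -
  define T where "T = arccos (cE B (bd x) (bd y)) / omega B"
  define f where "f s = osc_flow (omega B) s (bd x, vO x y)" for s
  have hit: "T > 0" "f T = (bd y, - vO y x)" "\<forall>s\<in>{0<..<T}. fst (f s) \<notin> closure (region B)"
    using outer_flow_outside[OF assms] by (auto simp: first_hit_def T_def f_def)
  have "outer_motion B T (\<lambda>s. fst (f s)) (\<lambda>s. snd (f s))"
    unfolding f_def using om by (intro outer_motion_osc_flow) simp
  moreover have "f 0 = (bd x, vO x y)" by (simp add: f_def osc_flow_0)
  ultimately show ?thesis
    unfolding outer_step_def using hit
    by (intro exI[of _ T] conjI exI[of _ "\<lambda>s. fst (f s)"] exI[of _ "\<lambda>s. snd (f s)"]) auto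
qed

lemma outer_step_arc:
  assumes "outer_step B p q" "(norm (snd p))\<^sup>2 / 2 = VE B (bd (fst p))"
  obtains T z v where "outer_arc B (fst p) (fst q) T z v" "v 0 = snd p" "v T = snd q"
proof -
  obtain T z v where T: "T > 0" and mot: "outer_motion B T z v"
    and z: "z 0 = bd (fst p)" "v 0 = snd p" "z T = bd (fst q)" "v T = snd q"
    and out: "\<forall>s\<in>{0<..<T}. z s \<notin> closure (region B)"
    using assms(1) unfolding outer_step_def by blast
  have "(norm (v s))\<^sup>2 / 2 = VE B (z s)" if "s \<in> {0..T}" for s
    using outer_motion_energy[OF mot that] assms(2) z by simp
  moreover have "z s \<notin> region B" if "s \<in> {0<..<T}" for s
    using out that closure_subset[of "region B"] by blast
  ultimately have "outer_arc B (fst p) (fst q) T z v"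
    using T mot z by (auto simp: outer_arc_def)
  then show ?thesis using z that by blast
qed

text \<open>Any \<open>outer_step\<close> is an \<open>outer_arc\<close>, and so is the explicit one
  between the same end points. Uniqueness of outer arcs identifies them, and their velocities with
  them.\<close>

lemma outer_step_velocities:
  assumes i: "i < num J" and p: "(x, v) \<in> phase_out B J i" and q: "(y, w) \<in> phase_in B J i"
    and step: "outer_step B (x, v) (y, w)"
  shows "v = vO x y \<and> w = - vO y x"
proof -
  have xy: "x \<in> cinterval J i" "y \<in> cinterval J i" and en: "(norm v)\<^sup>2 / 2 = VE B (bd x)"
    using p q by (auto simp: phase_def)
  obtain T z u where 1: "outer_arc B x y T z u" "u 0 = v" "u T = w"
    by (rule outer_step_arc[OF step]) (use en in auto)
  obtain T' z' u' where 2: "outer_arc B x y T' z' u'" "u' 0 = vO x y" "u' T' = - vO y x"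
    by (rule outer_step_arc[OF outer_step_exists[OF i xy]]) (use outer_phase(3)[OF i xy] in auto)
  have "T' = T \<and> (\<forall>s\<in>{0..T}. z' s = z s)"
    using outer_unique[OF i xy] 1(1) 2(1) unfolding unique_arc_def by metis
  moreover have "T > 0" "is_motion (\<lambda>w. - ((omega B)\<^sup>2 *\<^sub>R w)) T z u"
    "is_motion (\<lambda>w. - ((omega B)\<^sup>2 *\<^sub>R w)) T' z' u'"
    using 1 2 by (auto simp: outer_arc_def outer_motion_def)
  ultimately have "u' s = u s" if "s \<in> {0..T}" for s
    using motion_velocity_unique[of _ T z u _ z' u' s] that by blast
  then show ?thesis using 1 2 \<open>T > 0\<close> \<open>T' = T \<and> _\<close> by fastforce
qed

lemma refract_phase:
  assumes "i < num J" "x \<in> cinterval J i" "(norm v)\<^sup>2 / 2 = VE B (bd x)" "normal B x \<bullet> v \<noteq> 0"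
  shows "refract B h x v \<bullet> tangent B x = v \<bullet> tangent B x"
    "sgn (refract B h x v \<bullet> normal B x) = sgn (v \<bullet> normal B x)"
    "(norm (refract B h x v))\<^sup>2 / 2 = VI B h (bd x)"
proof -
  have "(v \<bullet> tangent B x)\<^sup>2 \<le> (norm v)\<^sup>2"
    using Cauchy_Schwarz_ineq[of v "tangent B x"] tan1[of x] by (simp add: dot_square_norm)
  then have "(v \<bullet> tangent B x)\<^sup>2 < 2 * VI B h (bd x)"
    using assms(3) VE_less_VI[OF rb h, of "bd x"] by linarith
  then show "refract B h x v \<bullet> tangent B x = v \<bullet> tangent B x"
    "sgn (refract B h x v \<bullet> normal B x) = sgn (v \<bullet> normal B x)"
    "(norm (refract B h x v))\<^sup>2 / 2 = VI B h (bd x)"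
    using refract_props[of B x v h] normal[OF assms(1,2)] tan1[of x] assms(4) by (auto simp: inner_commute)
qed

lemma refract_eqI:
  assumes "i < num J" "x \<in> cinterval J i" "(norm v)\<^sup>2 / 2 = VE B (bd x)" "normal B x \<bullet> v \<noteq> 0"
    "(norm w)\<^sup>2 / 2 = VI B h (bd x)" "w \<bullet> tangent B x = v \<bullet> tangent B x"
    "sgn (normal B x \<bullet> w) = sgn (normal B x \<bullet> v)"
  shows "refract B h x v = w"
  using refract_phase[OF assms(1-4)] normal[OF assms(1,2)] tan1[of x] assms(5-7)
  by (intro equal_vectors[of "normal B x" "tangent B x"]) (auto simp: inner_commute)

lemma refract_inject:
  assumes "i < num J" "x \<in> cinterval J i" "(norm v)\<^sup>2 / 2 = VE B (bd x)" "(norm w)\<^sup>2 / 2 = VE B (bd x)"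
    "normal B x \<bullet> v \<noteq> 0" "normal B x \<bullet> w \<noteq> 0" "refract B h x v = refract B h x w"
  shows "v = w"
proof -
  note v = refract_phase[OF assms(1,2,3,5)] and w = refract_phase[OF assms(1,2,4,6)]
  show ?thesis
    using normal[OF assms(1,2)] tan1[of x] assms(3,4) v(1,2) w(1,2) assms(7)
    by (intro equal_vectors[of "normal B x" "tangent B x"]) auto
qed

lemma inner_step_lc:
  assumes "i < num J" "p \<in> phase_in B J i" "inner_step B h p q"
  obtains S a b where "lc_arc B h S a b" "bd (fst p) = (fst a)\<^sup>2" "refract B h (fst p) (snd p) = kepler_vel a"
    "bd (fst q) = (fst b)\<^sup>2" "refract B h (fst q) (snd q) = kepler_vel b" "fst a \<noteq> 0" "fst b \<noteq> 0"
    "(fst a)\<^sup>2 \<notin> region B" "(fst b)\<^sup>2 \<notin> region B"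
proof -
  obtain T z v where *: "T > 0" "inner_motion B h T z v" "z 0 = bd (fst p)"
      "v 0 = refract B h (fst p) (snd p)" "\<forall>s\<in>{0<..<T}. z s \<in> region B"
      "z T = bd (fst q)" "v T = refract B h (fst q) (snd q)"
    using assms(3) unfolding inner_step_def by blast
  have p: "fst p \<in> cinterval J i" "(norm (snd p))\<^sup>2 / 2 = VE B (bd (fst p))" "normal B (fst p) \<bullet> snd p \<noteq> 0"
    using assms(2) by (auto simp: phase_def)
  have "\<exists>S a b. lc_arc B h S a b \<and> z 0 = (fst a)\<^sup>2 \<and> v 0 = kepler_vel a \<and>
      z T = (fst b)\<^sup>2 \<and> v T = kepler_vel b"
    using refract_phase(3)[OF assms(1) p] * bdry_props(3)[OF rb]
    by (intro inner_motion_lc_arc H) auto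
  then obtain S a b where "lc_arc B h S a b" "bd (fst p) = (fst a)\<^sup>2" "refract B h (fst p) (snd p) = kepler_vel a"
    "bd (fst q) = (fst b)\<^sup>2" "refract B h (fst q) (snd q) = kepler_vel b"
    using * by auto
  moreover have "fst a \<noteq> 0 \<and> fst b \<noteq> 0" "(fst a)\<^sup>2 \<notin> region B" "(fst b)\<^sup>2 \<notin> region B"
    using bdry_props(1,3)[OF rb] calculation(2,4) by (metis zero_power2)+
  ultimately show ?thesis using that by blast
qed

text \<open>An \<open>inner_step\<close> carries no homotopy condition, so direct arcs have to be
  excluded: by \<open>direct_velocity\<close> they would transfer the bound on the initial slope to
  the chord, against \<open>no_direct\<close>. As the ends are not antipodal either, the arc winds
  and its velocities are explicit.\<close>

lemma inner_step_velocities: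
  assumes i: "i < num J" "j \<in> NA B J i" and p: "(x, v) \<in> phase_in B J i" and y: "y \<in> cinterval J j"
    and step: "inner_step B h (x, v) (y, w)"
  shows "refract B h x v = wN x y" "refract B h y w = - wN y x"
proof -
  have x: "x \<in> cinterval J i" "(norm v)\<^sup>2 / 2 = VE B (bd x)" "normal B x \<bullet> v < 0"
    using p by (auto simp: phase_def)
  obtain S a b where *: "lc_arc B h S a b" "bd x = (fst a)\<^sup>2" "refract B h x v = kepler_vel a"
    "bd y = (fst b)\<^sup>2" "refract B h y w = kepler_vel b" "fst a \<noteq> 0" "fst b \<noteq> 0"
    by (rule inner_step_lc[OF i(1) p step]) simp
  have lc: "lc_energy B h a" "b = hyp_flow (lc_rate B h) S a" "S > 0"
    using *(1) by (auto simp: lc_arc_def first_hit_def)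
  have "fst a \<bullet> fst b \<noteq> 0"
  proof
    assume "fst a \<bullet> fst b = 0"
    then have "norm (bd x) * norm (bd y) + bd x \<bullet> bd y = 0"
      using norm_square_inner(1)[of "fst a" "fst b"] * by simp
    then show False
      using not_antipodal_pos[OF rb] inner[OF i x(1) y] by force
  qed
  moreover have "\<not> fst a \<bullet> fst b > 0"
  proof
    assume d: "fst a \<bullet> fst b > 0"
    have ne: "bd x \<noteq> bd y"
      using no_direct_return[OF lc(1,2) H lc(3) mu d] * by simp
    obtain k where k: "k \<ge> 0" "\<bar>Im (cnj (bd x) * kepler_vel a)\<bar> \<le> k * (- (bd x \<bullet> kepler_vel a))"
        "k * ((norm (bd x))\<^sup>2 - bd x \<bullet> bd y) < \<bar>Im (cnj (bd x) * bd y)\<bar>"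
      using no_direct[OF i x(1) y x(2,3)] ne unfolding *(3) by blast
    then show False
      using direct_velocity[OF lc(1,2) H lc(3) mu d, of k] * by simp
  qed
  ultimately have "fst a \<bullet> fst b < 0" by linarith
  then show "refract B h x v = wN x y" "refract B h y w = - wN y x"
    using winding_velocity[OF lc(1,2) H lc(3) mu] winding_velocity_end[OF lc(1,2) H lc(3) mu] * by auto
qed

text \<open>Existence is taken from the inner arc granted by the locale; it winds around the centre
  by \<open>inner_arc_winding\<close>, after which both end velocities are known.\<close>

lemma inner_motion_exists:
  assumes i: "i < num J" "j \<in> NA B J i" and x: "x \<in> cinterval J i" and y: "y \<in> cinterval J j"
  obtains T z v where "T > 0" "inner_motion B h T z v" "z 0 = bd x" "v 0 = wN x y"
    "\<forall>s\<in>{0<..<T}. z s \<in> region B" "z T = bd y" "v T = - wN y x"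
    "(norm (wN x y))\<^sup>2 / 2 = VI B h (bd x)" "(norm (wN y x))\<^sup>2 / 2 = VI B h (bd y)"
proof -
  obtain T z v where arc: "inner_arc B h x y T z v" using inner[OF assms] by blast
  have nz: "bd x \<noteq> 0" "bd y \<noteq> 0" by (rule bdry_props[OF rb])+
  obtain S a b where *: "lc_arc B h S a b" "bd x = (fst a)\<^sup>2" "v 0 = kepler_vel a"
      "bd y = (fst b)\<^sup>2" "v T = kepler_vel b" "fst a \<bullet> fst b < 0"
    using inner_arc_winding[OF arc H mu nz] inner[OF assms] by blast
  have lc: "lc_energy B h a" "b = hyp_flow (lc_rate B h) S a" "S > 0"
    using *(1) by (auto simp: lc_arc_def first_hit_def)
  have ab: "fst a \<noteq> 0" "fst b \<noteq> 0" using * nz by auto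
  have v: "v 0 = wN x y" "v T = - wN y x"
    using winding_velocity[OF lc(1,2) H lc(3) mu ab(1) *(6)]
      winding_velocity_end[OF lc(1,2) H lc(3) mu ab(2) *(6)] * by auto
  have arc': "T > 0" "z 0 = bd x" "z T = bd y" "\<forall>s\<in>{0<..<T}. z s \<in> region B"
    "\<forall>s\<in>{0..T}. z s \<noteq> 0 \<longrightarrow> (norm (v s))\<^sup>2 / 2 = VI B h (z s)"
    and mot: "inner_motion B h T z v"
    using arc by (auto simp: inner_arc_def inner_motion_def split: if_splits)
  have "(norm (v 0))\<^sup>2 / 2 = VI B h (z 0)" "(norm (v T))\<^sup>2 / 2 = VI B h (z T)"
    using arc' nz by auto
  then have "(norm (wN x y))\<^sup>2 / 2 = VI B h (bd x)" "(norm (wN y x))\<^sup>2 / 2 = VI B h (bd y)"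
    unfolding v arc' by (simp_all only: norm_minus_cancel)
  then show ?thesis using that[OF arc'(1) mot arc'(2) v(1) arc'(4,3) v(2)] by blast
qed

lemma wN_normal:
  assumes "i < num J" "j \<in> NA B J i" "x \<in> cinterval J i" "y \<in> cinterval J j"
  shows "normal B x \<bullet> wN x y < 0"
proof -
  have "normal B x \<bullet> wI (mu B / (energy B + h)) (bd x) (bd y) < 0" using inner[OF assms] by blast
  moreover have "sqrt (2 * (energy B + h)) > 0" using H by simp
  ultimately show ?thesis unfolding inner_scaleR_right by (rule mult_pos_neg[rotated])
qed

text \<open>A refracted velocity is fixed by its norm, its tangential component and the side to
  which it points. Energy supplies the first, the vertex equations the second,
  \<open>wN_normal\<close> the third.\<close>

lemma inner_step_exists:
  assumes i: "i < num J" "j \<in> NA B J i"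
    and x: "x \<in> cinterval J i" "x' \<in> cinterval J i" and y: "y \<in> cinterval J j" "y' \<in> cinterval J j"
    and eqs: "vertex_eq B h x x' y = 0" "vertex_eq B h y y' x = 0"
  shows "inner_step B h (x, - vO x x') (y, vO y y')"
proof -
  have j: "j < num J" "i \<in> NA B J j" using NA_less[OF i(2)] NA_commute[OF i] by auto
  obtain T z v where *: "T > 0" "inner_motion B h T z v" "z 0 = bd x" "v 0 = wN x y"
    "\<forall>s\<in>{0<..<T}. z s \<in> region B" "z T = bd y" "v T = - wN y x"
    "(norm (wN x y))\<^sup>2 / 2 = VI B h (bd x)" "(norm (wN y x))\<^sup>2 / 2 = VI B h (bd y)"
    by (rule inner_motion_exists[OF i x(1) y(1)])
  note ox = outer_phase[OF i(1) x] and oy = outer_phase[OF j(1) y]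
  have "refract B h x (- vO x x') = wN x y"
  proof (rule refract_eqI[OF i(1) x(1)])
    show "wN x y \<bullet> tangent B x = - vO x x' \<bullet> tangent B x"
      using eqs(1) unfolding vertex_eq_inner inner_minus_left by linarith
    show "sgn (normal B x \<bullet> wN x y) = sgn (normal B x \<bullet> - vO x x')"
      using wN_normal[OF i x(1) y(1)] ox(4) by (simp only: inner_minus_right sgn_neg neg_less_0_iff_less)
  qed (use ox * in auto)
  moreover have "refract B h y (vO y y') = - wN y x"
  proof (rule refract_eqI[OF j(1) y(1)])
    show "- wN y x \<bullet> tangent B y = vO y y' \<bullet> tangent B y"
      using eqs(2) unfolding vertex_eq_inner inner_minus_left by linarith
    show "sgn (normal B y \<bullet> - wN y x) = sgn (normal B y \<bullet> vO y y')"
      using wN_normal[OF j y(1) x(1)] oy(4) by (simp only: inner_minus_right sgn_pos neg_0_less_iff_less)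
  qed (use oy * in auto)
  ultimately show ?thesis
    unfolding inner_step_def using * by auto
qed

lemma return_rel_intro:
  assumes i: "i < num J" "j \<in> NA B J i"
    and x: "x0 \<in> cinterval J i" "x1 \<in> cinterval J i" and y: "x2 \<in> cinterval J j" "x3 \<in> cinterval J j"
    and eqs: "vertex_eq B h x1 x0 x2 = 0" "vertex_eq B h x2 x3 x1 = 0"
  shows "return_rel B J h (x0, vO x0 x1) (x2, vO x2 x3)"
  unfolding return_rel_def
  by (intro exI[of _ i] conjI exI[of _ "(x1, - vO x1 x0)"] bexI[of _ j] i
      outer_phase(1)[OF i(1) x] outer_step_exists[OF i(1) x] outer_phase(2)[OF i(1) x(2,1)]
      inner_step_exists[OF i x(2,1) y eqs] outer_phase(1)[OF NA_less[OF i(2)] y])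

text \<open>Snell's law at \<open>fst q\<close> is stated with the velocity \<open>snd q\<close>,
  because the end of the following outer arc is not part of this step; only the next step turns it
  into a vertex equation.\<close>

lemma return_rel_elim:
  assumes "return_rel B J h p q"
  obtains i j x1 where "i < num J" "j \<in> NA B J i" "fst p \<in> cinterval J i" "x1 \<in> cinterval J i"
    "fst q \<in> cinterval J j" "snd p = vO (fst p) x1" "vertex_eq B h x1 (fst p) (fst q) = 0"
    "snd q \<bullet> tangent B (fst q) + wN (fst q) x1 \<bullet> tangent B (fst q) = 0"
proof -
  obtain i p1 j where i: "i < num J" "j \<in> NA B J i" and p: "p \<in> phase_out B J i" "outer_step B p p1"
      "p1 \<in> phase_in B J i" "inner_step B h p1 q" "q \<in> phase_out B J j"
    using assms unfolding return_rel_def by blast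
  obtain x1 v1 where p1: "p1 = (x1, v1)" by (cases p1)
  have c: "fst p \<in> cinterval J i" "x1 \<in> cinterval J i" "fst q \<in> cinterval J j"
    and ph: "(norm v1)\<^sup>2 / 2 = VE B (bd x1)" "normal B x1 \<bullet> v1 \<noteq> 0"
      "(norm (snd q))\<^sup>2 / 2 = VE B (bd (fst q))" "normal B (fst q) \<bullet> snd q \<noteq> 0"
    using p p1 by (auto simp: phase_def)
  have v: "snd p = vO (fst p) x1" "v1 = - vO x1 (fst p)"
    using outer_step_velocities[OF i(1), of "fst p" "snd p" x1 v1] p p1 by auto
  have w: "refract B h x1 v1 = wN x1 (fst q)" "refract B h (fst q) (snd q) = - wN (fst q) x1"
    using inner_step_velocities[OF i, of x1 v1 "fst q" "snd q"] p p1 c by auto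
  have "wN x1 (fst q) \<bullet> tangent B x1 = v1 \<bullet> tangent B x1"
    using refract_phase(1)[OF i(1) c(2) ph(1,2)] w by simp
  then have "vertex_eq B h x1 (fst p) (fst q) = 0"
    unfolding vertex_eq_inner v(2) inner_minus_left by linarith
  moreover have "snd q \<bullet> tangent B (fst q) + wN (fst q) x1 \<bullet> tangent B (fst q) = 0"
  proof -
    have "(- wN (fst q) x1) \<bullet> tangent B (fst q) = snd q \<bullet> tangent B (fst q)"
      using refract_phase(1)[OF NA_less[OF i(2)] c(3) ph(3,4)] w by simp
    then show ?thesis unfolding inner_minus_left by linarith
  qed
  ultimately show ?thesis using that i c v by blast
qed

lemma outer_step_hit:
  assumes "outer_step B p q"
  obtains T where "first_hit (osc_flow (omega B)) {a. fst a \<in> closure (region B)} T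
    (bd (fst p), snd p) (bd (fst q), snd q)"
proof -
  obtain T z v where *: "T > 0" "outer_motion B T z v" "z 0 = bd (fst p)" "v 0 = snd p"
      "\<forall>s\<in>{0<..<T}. z s \<notin> closure (region B)" "z T = bd (fst q)" "v T = snd q"
    using assms unfolding outer_step_def by blast
  have "osc_flow (omega B) s (bd (fst p), snd p) = (z s, v s)" if "s \<in> {0..T}" for s
    using outer_motion_flow[OF *(2) _ that] om * by simp
  then have "first_hit (osc_flow (omega B)) {a. fst a \<in> closure (region B)} T
      (bd (fst p), snd p) (bd (fst q), snd q)"
    using * by (auto simp: first_hit_def)
  then show ?thesis by (rule that)
qed

lemma phaseD:
  assumes "p \<in> phase B J sg i"
  shows "fst p \<in> cinterval J i" "(norm (snd p))\<^sup>2 / 2 = VE B (bd (fst p))"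
    "sg * (normal B (fst p) \<bullet> snd p) > 0"
  using assms by (auto simp: phase_def)

text \<open>A step follows two flows, each up to a first hit: of the closed region outside, of the
  complement of the region in Levi-Civita coordinates inside. Points of the curve determine
  parameters by \<open>disjoint\<close>, refracted velocities determine velocities by
  \<open>refract_inject\<close>. This gives the \<open>THE\<close> in \<open>return_map\<close> its
  meaning.\<close>

lemma return_rel_unique:
  assumes "return_rel B J h p q" "return_rel B J h p q'"
  shows "q = q'"
proof -
  obtain i p1 j where i: "i < num J" "j \<in> NA B J i" and p: "p \<in> phase_out B J i" "outer_step B p p1"
      "p1 \<in> phase_in B J i" "inner_step B h p1 q" "q \<in> phase_out B J j"
    using assms unfolding return_rel_def by blast
  obtain i' p1' j' where i': "i' < num J" "j' \<in> NA B J i'" and p': "p \<in> phase_out B J i'" "outer_step B p p1'"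
      "p1' \<in> phase_in B J i'" "inner_step B h p1' q'" "q' \<in> phase_out B J j'"
    using assms unfolding return_rel_def by blast
  obtain T T' where "first_hit (osc_flow (omega B)) {a. fst a \<in> closure (region B)} T
      (bd (fst p), snd p) (bd (fst p1), snd p1)"
    "first_hit (osc_flow (omega B)) {a. fst a \<in> closure (region B)} T'
      (bd (fst p), snd p) (bd (fst p1'), snd p1')"
    using outer_step_hit[OF p(2)] outer_step_hit[OF p'(2)] by metis
  then have "(bd (fst p1), snd p1) = (bd (fst p1'), snd p1')"
    by (rule first_hit_unique) (use bdry_props(2)[OF rb] in auto)
  then have p1: "p1 = p1'"
    using disjoint[OF i(1) i'(1), of "fst p1" "fst p1'"] p(3) p'(3) by (auto simp: phase_def prod_eq_iff)
  obtain S a b where lc1: "lc_arc B h S a b" "bd (fst p1) = (fst a)\<^sup>2" "refract B h (fst p1) (snd p1) = kepler_vel a"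
    "bd (fst q) = (fst b)\<^sup>2" "refract B h (fst q) (snd q) = kepler_vel b" "fst a \<noteq> 0" "(fst b)\<^sup>2 \<notin> region B"
    by (rule inner_step_lc[OF i(1) p(3,4)])
  obtain S' a' b' where lc2: "lc_arc B h S' a' b'" "bd (fst p1) = (fst a')\<^sup>2" "refract B h (fst p1) (snd p1) = kepler_vel a'"
    "bd (fst q') = (fst b')\<^sup>2" "refract B h (fst q') (snd q') = kepler_vel b'" "(fst b')\<^sup>2 \<notin> region B"
    by (rule inner_step_lc[OF i'(1) p'(3,4)[folded p1]])
  have eq: "bd (fst q) = bd (fst q')" "refract B h (fst q) (snd q) = refract B h (fst q') (snd q')"
    using lc_arc_unique[OF lc1(1) lc2(1)] lc1 lc2 by auto
  note ph = phaseD[OF p(5)] phaseD[OF p'(5)]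
  have x: "fst q = fst q'"
    using disjoint[OF NA_less[OF i(2)] NA_less[OF i'(2)], of "fst q" "fst q'"] eq ph by simp
  moreover have "snd q = snd q'"
    using refract_inject[OF NA_less[OF i(2)], of "fst q" "snd q" "snd q'"] eq(2) ph unfolding x by simp
  ultimately show ?thesis by (simp add: prod_eq_iff)
qed

text \<open>The same two flows read backwards; the starting points lie in the hitting sets
  themselves, as \<open>first_hit_unique_start\<close> requires.\<close>

lemma return_rel_unique_start:
  assumes "return_rel B J h p q" "return_rel B J h p' q"
  shows "p = p'"
proof -
  obtain i p1 j where i: "i < num J" "j \<in> NA B J i" and p: "p \<in> phase_out B J i" "outer_step B p p1"
      "p1 \<in> phase_in B J i" "inner_step B h p1 q"
    using assms unfolding return_rel_def by blast
  obtain i' p1' j' where i': "i' < num J" "j' \<in> NA B J i'" and p': "p' \<in> phase_out B J i'" "outer_step B p' p1'"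
      "p1' \<in> phase_in B J i'" "inner_step B h p1' q"
    using assms unfolding return_rel_def by blast
  obtain S a b where lc1: "lc_arc B h S a b" "bd (fst p1) = (fst a)\<^sup>2" "refract B h (fst p1) (snd p1) = kepler_vel a"
    "bd (fst q) = (fst b)\<^sup>2" "refract B h (fst q) (snd q) = kepler_vel b" "fst b \<noteq> 0" "(fst a)\<^sup>2 \<notin> region B"
    by (rule inner_step_lc[OF i(1) p(3,4)])
  obtain S' a' b' where lc2: "lc_arc B h S' a' b'" "bd (fst p1') = (fst a')\<^sup>2" "refract B h (fst p1') (snd p1') = kepler_vel a'"
    "bd (fst q) = (fst b')\<^sup>2" "refract B h (fst q) (snd q) = kepler_vel b'" "(fst a')\<^sup>2 \<notin> region B"
    by (rule inner_step_lc[OF i'(1) p'(3,4)])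
  have eq: "bd (fst p1) = bd (fst p1')" "refract B h (fst p1) (snd p1) = refract B h (fst p1') (snd p1')"
    using lc_arc_unique_start[OF lc1(1) lc2(1)] lc1 lc2 H by auto
  note ph = phaseD[OF p(3)] phaseD[OF p'(3)]
  have x: "fst p1 = fst p1'"
    using disjoint[OF i(1) i'(1), of "fst p1" "fst p1'"] eq ph by simp
  moreover have "snd p1 = snd p1'"
    using refract_inject[OF i(1), of "fst p1" "snd p1" "snd p1'"] eq(2) ph unfolding x by simp
  ultimately have p1: "p1 = p1'" by (simp add: prod_eq_iff)
  obtain T T' where hits: "first_hit (osc_flow (omega B)) {a. fst a \<in> closure (region B)} T
      (bd (fst p), snd p) (bd (fst p1), snd p1)"
    "first_hit (osc_flow (omega B)) {a. fst a \<in> closure (region B)} T'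
      (bd (fst p'), snd p') (bd (fst p1), snd p1)"
    using outer_step_hit[OF p(2)] outer_step_hit[OF p'(2)] unfolding p1 by metis
  have "(bd (fst p), snd p) = (bd (fst p'), snd p')"
    by (rule first_hit_unique_start[OF osc_flow_0 _ hits])
      (use bdry_props(2)[OF rb] om in \<open>auto intro!: osc_flow_add\<close>)
  then show ?thesis
    using disjoint[OF i(1) i'(1), of "fst p" "fst p'"] p(1) p'(1) by (auto simp: phase_def prod_eq_iff)
qed

end

subsection \<open>Coding of orbits by words\<close>

text \<open>The closed graph theorem for a compact range. \<open>G\<close> may have further points
  over the outside of \<open>S\<close>; over \<open>S\<close> it has to be the graph of
  \<open>f\<close>.\<close>

lemma continuous_on_compact_graph:
  fixes f :: "'a::euclidean_space \<Rightarrow> 'b::euclidean_space"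
  assumes "compact G" "\<And>x. x \<in> S \<Longrightarrow> (x, f x) \<in> G" "\<And>x y. x \<in> S \<Longrightarrow> (x, y) \<in> G \<Longrightarrow> y = f x"
  shows "continuous_on S f"
proof -
  define T where "T = snd ` G"
  have "compact T" unfolding T_def by (intro compact_continuous_image continuous_intros assms)
  moreover have fT: "f \<in> S \<rightarrow> T" using assms(2) by (force simp: T_def)
  moreover have "(\<lambda>x. (x, f x)) ` S = (S \<times> T) \<inter> G"
    using assms fT by auto
  then have "closedin (top_of_set (S \<times> T)) ((\<lambda>x. (x, f x)) ` S)"
    using compact_imp_closed[OF assms(1)] by (simp add: closedin_closed_Int)
  ultimately show ?thesis by (simp add: continuous_closed_graph_eq)
qed

lemma continuous_funpow:
  assumes "continuous_on S f" "f ` S \<subseteq> S"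
  shows "continuous_on S (f ^^ n) \<and> (f ^^ n) ` S \<subseteq> S"
proof (induction n)
  case (Suc n)
  then have "continuous_on S (f \<circ> (f ^^ n))"
    by (intro continuous_on_compose) (auto intro: continuous_on_subset[OF assms(1)])
  then show ?case using Suc assms(2) by (auto simp: image_subset_iff)
qed auto

lemma word_dist_small:
  assumes "\<epsilon> > 0"
  obtains N where "finite N" "\<And>l l'. (\<forall>k\<in>N. l k = l' k) \<Longrightarrow> word_dist l l' < \<epsilon>"
proof -
  define t where "t k = (1 / 4 ^ nat \<bar>k\<bar> :: real)" for k :: int
  have s: "t summable_on UNIV" unfolding t_def by (rule summable_4)
  have "((\<lambda>F. sum t F) \<longlongrightarrow> infsum t UNIV) (finite_subsets_at_top UNIV)"
    by (rule infsum_tendsto[OF s])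
  then have "\<forall>\<^sub>F F in finite_subsets_at_top UNIV. infsum t UNIV - \<epsilon> < sum t F"
    by (rule order_tendstoD) (use assms in simp)
  then obtain N where N: "finite N" "infsum t UNIV - \<epsilon> < sum t N"
    by (auto simp: eventually_finite_subsets_at_top)
  have tail: "infsum t (UNIV - N) < \<epsilon>"
    using infsum_Diff[OF s summable_on_finite[OF N(1)]] N by simp
  have "word_dist l l' < \<epsilon>" if eq: "\<forall>k\<in>N. l k = l' k" for l l'
  proof -
    have "word_dist l l' = (\<Sum>\<^sub>\<infinity>k\<in>UNIV - N. (if l k = l' k then 0 else 1) / 4 ^ nat \<bar>k\<bar>)"
      unfolding word_dist_def by (rule infsum_cong_neutral) (use eq in auto)
    also have "\<dots> \<le> infsum t (UNIV - N)"
      by (rule infsum_mono) (auto simp: t_def intro: summable_on_subset_banach[OF summable_word_dist]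
          summable_on_subset_banach[OF s])
    finally show ?thesis using tail by simp
  qed
  then show ?thesis using N(1) that by blast
qed

context coded_billiard
begin

text \<open>Vertex \<open>2 k\<close> starts the outer arc of the letter \<open>l k\<close> and
  vertex \<open>2 k + 1\<close> ends it, hence \<open>n div 2\<close>. An even vertex has its outer
  neighbour after it and its inner one before it, an odd vertex the other way round.\<close>

definition solution :: "word \<Rightarrow> (int \<Rightarrow> real) \<Rightarrow> bool" where
  "solution l x \<longleftrightarrow> (\<forall>n. x n \<in> cinterval J (l (n div 2)) \<and>
    vertex_eq B h (x n) (x (if even n then n + 1 else n - 1)) (x (if even n then n - 1 else n + 1)) = 0)"

definition state :: "(int \<Rightarrow> real) \<Rightarrow> int \<Rightarrow> state" where
  "state x k = (x (2 * k), vO (x (2 * k)) (x (2 * k + 1)))"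

definition orbit :: "(int \<Rightarrow> state) \<Rightarrow> bool" where
  "orbit q \<longleftrightarrow> (\<forall>k. return_rel B J h (q k) (q (k + 1)))"

lemma solution_ex1: "l \<in> words B J \<Longrightarrow> \<exists>!x. solution l x"
  unfolding solution_def by (rule unique_solution)

lemma words_less: "l \<in> words B J \<Longrightarrow> l k < num J"
  and words_NA: "l \<in> words B J \<Longrightarrow> l (k + 1) \<in> NA B J (l k)"
  by (auto simp: words_def)

lemma solution_orbit:
  assumes l: "l \<in> words B J" and x: "solution l x"
  shows "orbit (state x)"
  unfolding orbit_def
proof
  fix k :: int
  have d: "(2 * k + 1) div 2 = k" "(2 * k + 2) div 2 = k + 1" "(2 * k + 3) div 2 = k + 1" by simp_all
  have mem: "x (2 * k) \<in> cinterval J (l k)" "x (2 * k + 1) \<in> cinterval J (l k)"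
    "x (2 * k + 2) \<in> cinterval J (l (k + 1))" "x (2 * k + 3) \<in> cinterval J (l (k + 1))"
    using x[unfolded solution_def, rule_format, of "2 * k"] x[unfolded solution_def, rule_format, of "2 * k + 1"]
      x[unfolded solution_def, rule_format, of "2 * k + 2"] x[unfolded solution_def, rule_format, of "2 * k + 3"]
    unfolding d by simp_all
  have "vertex_eq B h (x (2 * k + 1)) (x (2 * k)) (x (2 * k + 2)) = 0"
    using x[unfolded solution_def, rule_format, of "2 * k + 1"] by (simp add: add.assoc)
  moreover have "vertex_eq B h (x (2 * k + 2)) (x (2 * k + 3)) (x (2 * k + 1)) = 0"
    using x[unfolded solution_def, rule_format, of "2 * k + 2"]
    by (simp add: add.assoc add.commute[of 1 "2 * k"])
  ultimately have "return_rel B J h (x (2 * k), vO (x (2 * k)) (x (2 * k + 1)))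
      (x (2 * k + 2), vO (x (2 * k + 2)) (x (2 * k + 3)))"
    by (rule return_rel_intro[OF words_less[OF l] words_NA[OF l] mem])
  moreover have "2 * (k + 1) = 2 * k + 2" "2 * k + 2 + 1 = 2 * k + 3" by simp_all
  ultimately show "return_rel B J h (state x k) (state x (k + 1))"
    by (simp only: state_def)
qed

lemma orbit_solution:
  assumes q: "orbit q"
  obtains l x where "l \<in> words B J" "solution l x" "q = state x"
proof -
  have "\<exists>i j y. i < num J \<and> j \<in> NA B J i \<and> fst (q k) \<in> cinterval J i \<and> y \<in> cinterval J i \<and>
      fst (q (k + 1)) \<in> cinterval J j \<and> snd (q k) = vO (fst (q k)) y \<and>
      vertex_eq B h y (fst (q k)) (fst (q (k + 1))) = 0 \<and>
      snd (q (k + 1)) \<bullet> tangent B (fst (q (k + 1))) + wN (fst (q (k + 1))) y \<bullet> tangent B (fst (q (k + 1))) = 0" for k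
  proof -
    have "return_rel B J h (q k) (q (k + 1))" using q by (simp add: orbit_def)
    then show ?thesis by (rule return_rel_elim) blast
  qed
  then obtain i j y where i: "i k < num J" "j k \<in> NA B J (i k)" "fst (q k) \<in> cinterval J (i k)"
      "y k \<in> cinterval J (i k)" "fst (q (k + 1)) \<in> cinterval J (j k)" "snd (q k) = vO (fst (q k)) (y k)"
      "vertex_eq B h (y k) (fst (q k)) (fst (q (k + 1))) = 0"
      "snd (q (k + 1)) \<bullet> tangent B (fst (q (k + 1)))
        + wN (fst (q (k + 1))) (y k) \<bullet> tangent B (fst (q (k + 1))) = 0" for k
    by metis
  \<comment> \<open>Arrival in \<open>j k\<close> and departure in \<open>i (k + 1)\<close> concern
    the same point, so disjointness identifies the indices and the letters form a word.\<close>
  have ji: "j k = i (k + 1)" for k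
    using disjoint[OF NA_less[OF i(2)[of k]] i(1)[of "k + 1"] i(5)[of k] i(3)[of "k + 1"]] by simp
  have word: "i \<in> words B J"
    using i(1,2) ji by (auto simp: words_def)
  define x where "x n = (if even n then fst (q (n div 2)) else y (n div 2))" for n
  have "solution i x"
    unfolding solution_def
  proof
    fix n :: int
    show "x n \<in> cinterval J (i (n div 2)) \<and>
      vertex_eq B h (x n) (x (if even n then n + 1 else n - 1)) (x (if even n then n - 1 else n + 1)) = 0"
    proof (cases "even n")
      case True
      \<comment> \<open>An even vertex needs two steps: step \<open>k\<close> supplies Snell's law
        with the velocity of \<open>q (k + 1)\<close>, and step \<open>k + 1\<close> identifies that
        velocity as an outer one.\<close>
      then obtain k where n: "n = 2 * (k + 1)" by (metis evenE diff_add_cancel)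
      have x: "x n = fst (q (k + 1))" "x (n + 1) = y (k + 1)" "x (n - 1) = y k"
        by (simp_all add: x_def n)
      have "vertex_eq B h (x n) (x (n + 1)) (x (n - 1)) = 0"
        unfolding x vertex_eq_inner using i(8)[of k] i(6)[of "k + 1"] by simp
      then show ?thesis using True i(3)[of "k + 1"] x(1) n by simp
    next
      case False
      then obtain k where n: "n = 2 * k + 1" by (metis oddE)
      have x: "x n = y k" "x (n - 1) = fst (q k)" "x (n + 1) = fst (q (k + 1))"
        by (simp_all add: x_def n add.commute)
      show ?thesis using False i(4)[of k] i(7)[of k] x by (simp add: n)
    qed
  qed
  moreover have "q = state x"
    using i(6) by (auto simp: fun_eq_iff state_def x_def prod_eq_iff)
  ultimately show ?thesis using word that by blast
qed

lemma chi_eq: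
  assumes "i < num J" "fst p \<in> cinterval J i"
  shows "chi J p = i"
  unfolding chi_def using assms disjoint by (intro the_equality) blast+

lemma chi_state:
  assumes "l \<in> words B J" "solution l x"
  shows "chi J (state x k) = l k"
proof (rule chi_eq)
  show "fst (state x k) \<in> cinterval J (l k)"
    using assms(2)[unfolded solution_def, rule_format, of "2 * k"] by (simp add: state_def)
qed (rule words_less[OF assms(1)])

lemma full_orbits_iff: "p \<in> full_orbits B J h \<longleftrightarrow> (\<exists>q. orbit q \<and> q 0 = p)"
  by (auto simp: full_orbits_def orbit_def)

lemma orbit_shift: "orbit q \<Longrightarrow> orbit (\<lambda>k. q (k + j))"
  unfolding orbit_def by (metis add.assoc add.commute)

lemma orbit_in: "orbit q \<Longrightarrow> q k \<in> full_orbits B J h"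
  unfolding full_orbits_iff using orbit_shift[of q k] by force

lemma return_map_eq: "return_rel B J h p q \<Longrightarrow> return_map B J h p = q"
  unfolding return_map_def using return_rel_unique by blast

lemma return_map_orbit: "orbit q \<Longrightarrow> return_map B J h (q k) = q (k + 1)"
  by (simp add: orbit_def return_map_eq)

lemma return_map_rel: "p \<in> full_orbits B J h \<Longrightarrow> return_rel B J h p (return_map B J h p)"
  unfolding full_orbits_iff using return_map_orbit by (metis orbit_def)

lemma return_map_in: "p \<in> full_orbits B J h \<Longrightarrow> return_map B J h p \<in> full_orbits B J h"
  unfolding full_orbits_iff using return_map_orbit orbit_in full_orbits_iff by metis

lemma return_map_inj: "inj_on (return_map B J h) (full_orbits B J h)"
  by (rule inj_onI) (metis return_map_rel return_rel_unique_start)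

definition previous :: "state \<Rightarrow> state" where
  "previous = inv_into (full_orbits B J h) (return_map B J h)"

lemma previous_orbit: "orbit q \<Longrightarrow> previous (q k) = q (k - 1)"
  using return_map_orbit[of q "k - 1"] inv_into_f_f[OF return_map_inj orbit_in[of q "k - 1"]]
  by (simp add: previous_def)

lemma previous_in: "p \<in> full_orbits B J h \<Longrightarrow> previous p \<in> full_orbits B J h"
  using previous_orbit orbit_in full_orbits_iff by metis

lemma previous_rel: "p \<in> full_orbits B J h \<Longrightarrow> return_rel B J h (previous p) p"
proof -
  assume "p \<in> full_orbits B J h"
  then obtain q where q: "orbit q" "q 0 = p" by (auto simp: full_orbits_iff)
  then show ?thesis
    using previous_orbit[OF q(1), of 0] q(1)[unfolded orbit_def, rule_format, of "- 1"] by simp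
qed

lemma return_iter_orbit:
  assumes "orbit q"
  shows "return_iter B J h k (q 0) = q k"
proof -
  have "(return_map B J h ^^ n) (q 0) = q (int n)" for n
    by (induction n) (use return_map_orbit[OF assms] in \<open>auto simp: add.commute\<close>)
  moreover have "(previous ^^ n) (q 0) = q (- int n)" for n
    by (induction n) (simp_all add: previous_orbit[OF assms] minus_diff_commute)
  ultimately show ?thesis
    by (simp add: return_iter_def previous_def[symmetric])
qed

lemma proj_state:
  assumes "l \<in> words B J" "solution l x"
  shows "proj B J h (state x 0) = l"
  unfolding proj_def
  using return_iter_orbit[OF solution_orbit[OF assms]] chi_state[OF assms] by auto

lemma full_orbitsE:
  assumes "p \<in> full_orbits B J h"
  obtains l x where "l \<in> words B J" "solution l x" "p = state x 0"
  using assms orbit_solution unfolding full_orbits_iff by metis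

lemma proj_image: "proj B J h ` full_orbits B J h = words B J"
proof (intro equalityI subsetI)
  fix l assume "l \<in> proj B J h ` full_orbits B J h"
  then show "l \<in> words B J" by (auto elim!: full_orbitsE simp: proj_state)
next
  fix l assume l: "l \<in> words B J"
  then obtain x where x: "solution l x" using solution_ex1 by blast
  then have "state x 0 \<in> full_orbits B J h" "proj B J h (state x 0) = l"
    using orbit_in[OF solution_orbit[OF l x]] proj_state[OF l x] by auto
  then show "l \<in> proj B J h ` full_orbits B J h" by blast
qed

text \<open>A word has only one solution, and the state at time 0 is a function of it: vertex 0
  gives the position, vertices 0 and 1 the velocity.\<close>

lemma proj_inj: "inj_on (proj B J h) (full_orbits B J h)"
proof (rule inj_onI)
  fix p p' assume p: "p \<in> full_orbits B J h" "p' \<in> full_orbits B J h" "proj B J h p = proj B J h p'"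
  obtain l x where 1: "l \<in> words B J" "solution l x" "p = state x 0" by (rule full_orbitsE[OF p(1)])
  obtain l' x' where 2: "l' \<in> words B J" "solution l' x'" "p' = state x' 0" by (rule full_orbitsE[OF p(2)])
  have "l = l'" using p(3) 1 2 proj_state by metis
  then have "x = x'" using 1 2 solution_ex1 by blast
  then show "p = p'" using 1 2 by simp
qed

lemma proj_shift:
  assumes "p \<in> full_orbits B J h"
  shows "proj B J h (return_map B J h p) = shift (proj B J h p)"
proof -
  obtain q where q: "orbit q" "q 0 = p" using assms by (auto simp: full_orbits_iff)
  have "return_iter B J h k (return_map B J h p) = q (k + 1)" for k
    using return_iter_orbit[OF orbit_shift[OF q(1), of 1], of k] return_map_orbit[OF q(1), of 0] q(2) by simp
  moreover have "return_iter B J h k p = q k" for k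
    using return_iter_orbit[OF q(1)] q(2) by simp
  ultimately show ?thesis by (simp add: proj_def shift_def)
qed

subsection \<open>Continuity of the coding\<close>

lemma continuous_on_vO:
  assumes "continuous_on S f" "continuous_on S g"
    "\<And>z. z \<in> S \<Longrightarrow> \<exists>i<num J. f z \<in> cinterval J i \<and> g z \<in> cinterval J i"
  shows "continuous_on S (\<lambda>z. vO (f z) (g z))"
proof -
  have cb: "continuous_on UNIV (bdry B)"
    using loclip_isCont[OF loclip_bdry[OF rb]] by (simp add: continuous_on_eq_continuous_at)
  have c: "continuous_on S (\<lambda>z. bd (f z))" "continuous_on S (\<lambda>z. bd (g z))"
    by (rule continuous_on_compose2[OF cb]; use assms in simp)+
  have "R2 B \<noteq> 0" using bdry_R2(2)[OF rb] by simp
  then have cc: "continuous_on S (\<lambda>z. cE B (bd (f z)) (bd (g z)))"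
    unfolding cE_def discE_def by (intro continuous_intros c) auto
  have "sqrt (1 - (cE B (bd (f z)) (bd (g z)))\<^sup>2) \<noteq> 0" if z: "z \<in> S" for z
  proof -
    obtain i where "i < num J" "f z \<in> cinterval J i" "g z \<in> cinterval J i"
      using assms(3)[OF z] by blast
    then have "(cE B (bd (f z)) (bd (g z)))\<^sup>2 < 1" using outer[of i "f z" "g z"] by (simp add: abs_square_less_1)
    then show ?thesis by simp
  qed
  then show ?thesis
    unfolding vE_def by (intro continuous_intros c cc) auto
qed

text \<open>Here \<open>e\<close> is a fixed positive number. From
  \<open>(D + d)^2 = d^2 + e (|p| + |q| + e)\<close> one gets
  \<open>D^2 - e^2 = e (|p| + |q|) - 2 d D\<close>, so the denominator \<open>QI\<close> is positive
  for all end points that are not antipodal.\<close>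

lemma continuous_on_wN:
  assumes "continuous_on S f" "continuous_on S g"
    "\<And>z. z \<in> S \<Longrightarrow> \<exists>i<num J. \<exists>j\<in>NA B J i. f z \<in> cinterval J i \<and> g z \<in> cinterval J j"
  shows "continuous_on S (\<lambda>z. wN (f z) (g z))"
proof -
  define e where "e = mu B / (energy B + h)"
  have e: "e > 0" using mu H by (simp add: e_def)
  have cb: "continuous_on UNIV (bdry B)"
    using loclip_isCont[OF loclip_bdry[OF rb]] by (simp add: continuous_on_eq_continuous_at)
  have c: "continuous_on S (\<lambda>z. bd (f z))" "continuous_on S (\<lambda>z. bd (g z))"
    by (rule continuous_on_compose2[OF cb]; use assms in simp)+
  have nz: "bd x \<noteq> 0" for x by (rule bdry_props[OF rb])
  have cd: "continuous_on S (\<lambda>z. dI (bd (f z)) (bd (g z)))"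
    unfolding dI_def by (intro continuous_intros c) auto
  have cD: "continuous_on S (\<lambda>z. DI e (bd (f z)) (bd (g z)))"
    unfolding DI_def by (intro continuous_intros c cd)
  have cQ: "continuous_on S (\<lambda>z. QI e (bd (f z)) (bd (g z)))"
    unfolding QI_def by (intro continuous_intros cD)
  have nzd: "dI (bd (f z)) (bd (g z)) \<noteq> 0" "QI e (bd (f z)) (bd (g z)) \<noteq> 0" if z: "z \<in> S" for z
  proof -
    define p q d D where "p = bd (f z)" and "q = bd (g z)" and "d = dI p q" and "D = DI e p q"
    obtain i j where "i < num J" "j \<in> NA B J i" "f z \<in> cinterval J i" "g z \<in> cinterval J j"
      using assms(3)[OF z] by blast
    then have "norm p * norm q + p \<bullet> q > 0"
      unfolding p_def q_def using inner not_antipodal_pos[OF rb] by blast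
    then have d: "d < 0" by (simp add: d_def dI_def)
    have s: "d\<^sup>2 + e * (norm p + norm q + e) \<ge> 0" using e by simp
    have D: "D > 0"
      using d s by (simp add: D_def DI_def d_def[symmetric]) (smt (verit) real_sqrt_ge_zero)
    have "(D + d)\<^sup>2 = d\<^sup>2 + e * (norm p + norm q + e)"
      using s by (simp add: D_def DI_def d_def[symmetric])
    then have "D\<^sup>2 - e\<^sup>2 = e * (norm p + norm q) + 2 * (- d) * D"
      by (simp add: power2_eq_square algebra_simps)
    moreover have "e * (norm p + norm q) \<ge> 0" "2 * (- d) * D > 0"
      using e d D by (auto intro: mult_pos_neg)
    ultimately have "D\<^sup>2 - e\<^sup>2 > 0" by linarith
    then show "dI (bd (f z)) (bd (g z)) \<noteq> 0" "QI e (bd (f z)) (bd (g z)) \<noteq> 0"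
      using d by (auto simp: QI_def D_def d_def p_def q_def)
  qed
  show ?thesis
    unfolding wI_def e_def[symmetric] by (intro continuous_intros c cd cD cQ) (use nzd nz in auto)
qed

lemma continuous_on_vertex_eq:
  assumes c: "continuous_on S f" "continuous_on S g" "continuous_on S k"
    and mem: "\<And>z. z \<in> S \<Longrightarrow> \<exists>i<num J. \<exists>j\<in>NA B J i. f z \<in> cinterval J i \<and> g z \<in> cinterval J i \<and> k z \<in> cinterval J j"
  shows "continuous_on S (\<lambda>z. vertex_eq B h (f z) (g z) (k z))"
proof -
  have "continuous_on UNIV (tangent B)"
    using billiardD(14)[OF rb] by (simp add: continuous_on_eq_continuous_at)
  then have ct: "continuous_on S (\<lambda>z. tangent B (f z))"
    by (rule continuous_on_compose2) (use c in auto)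
  have "continuous_on S (\<lambda>z. vO (f z) (g z))" "continuous_on S (\<lambda>z. wN (f z) (k z))"
    by (rule continuous_on_vO continuous_on_wN; use c mem in blast)+
  then show ?thesis unfolding vertex_eq_inner by (intro continuous_on_add continuous_on_inner ct)
qed

text \<open>A compact set of pairs of states which, over the invariant set, is the graph of the return
  map and of its inverse.\<close>

definition steps :: "(state \<times> state) set" where
  "steps = (\<Union>i<num J. \<Union>j\<in>NA B J i. (\<lambda>(x0, x1, x2, x3). ((x0, vO x0 x1), (x2, vO x2 x3))) `
     {(x0, x1, x2, x3). (x0, x1, x2, x3) \<in> cinterval J i \<times> cinterval J i \<times> cinterval J j \<times> cinterval J j \<and>
        vertex_eq B h x1 x0 x2 = 0 \<and> vertex_eq B h x2 x3 x1 = 0})"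

lemma compact_steps: "compact steps"
proof -
  have "compact ((\<lambda>(x0, x1, x2, x3). ((x0, vO x0 x1), (x2, vO x2 x3))) `
     {(x0, x1, x2, x3). (x0, x1, x2, x3) \<in> cinterval J i \<times> cinterval J i \<times> cinterval J j \<times> cinterval J j \<and>
        vertex_eq B h x1 x0 x2 = 0 \<and> vertex_eq B h x2 x3 x1 = 0})"
    if i: "i < num J" "j \<in> NA B J i" for i j
  proof (rule compact_continuous_image)
    define K where "K = cinterval J i \<times> cinterval J i \<times> cinterval J j \<times> cinterval J j"
    have j: "j < num J" "i \<in> NA B J j" using NA_less[OF i(2)] NA_commute[OF i] by auto
    have K: "compact K" unfolding K_def by (intro compact_Times compact_Icc)
    define f where "f = (\<lambda>(x0, x1, x2, x3::real). vertex_eq B h x1 x0 x2)"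
    define g where "g = (\<lambda>(x0::real, x1, x2, x3). vertex_eq B h x2 x3 x1)"
    have cf: "continuous_on K f" "continuous_on K g"
      unfolding f_def g_def split_beta
      by (rule continuous_on_vertex_eq; (intro continuous_intros)?; use i j in \<open>force simp: K_def\<close>)+
    have "closed {z \<in> K. f z = 0}" "closed {z \<in> K. g z = 0}"
      using cf compact_imp_closed[OF K] by (auto intro: continuous_closed_preimage_constant)
    then have "compact (K \<inter> ({z \<in> K. f z = 0} \<inter> {z \<in> K. g z = 0}))"
      using K by (intro compact_Int_closed closed_Int)
    moreover have "K \<inter> ({z \<in> K. f z = 0} \<inter> {z \<in> K. g z = 0}) = {(x0, x1, x2, x3).
        (x0, x1, x2, x3) \<in> cinterval J i \<times> cinterval J i \<times> cinterval J j \<times> cinterval J j \<and>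
        vertex_eq B h x1 x0 x2 = 0 \<and> vertex_eq B h x2 x3 x1 = 0}"
      by (auto simp: K_def f_def g_def)
    ultimately show "compact {(x0, x1, x2, x3).
        (x0, x1, x2, x3) \<in> cinterval J i \<times> cinterval J i \<times> cinterval J j \<times> cinterval J j \<and>
        vertex_eq B h x1 x0 x2 = 0 \<and> vertex_eq B h x2 x3 x1 = 0}" by simp
    show "continuous_on {(x0, x1, x2, x3).
        (x0, x1, x2, x3) \<in> cinterval J i \<times> cinterval J i \<times> cinterval J j \<times> cinterval J j \<and>
        vertex_eq B h x1 x0 x2 = 0 \<and> vertex_eq B h x2 x3 x1 = 0}
        (\<lambda>(x0, x1, x2, x3). ((x0, vO x0 x1), (x2, vO x2 x3)))"
      unfolding split_beta by (intro continuous_intros continuous_on_vO) (use i j in auto)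
  qed
  moreover have "finite (NA B J i)" for i by (simp add: NA_def)
  ultimately show ?thesis unfolding steps_def by (intro compact_UN) auto
qed

lemma steps_return_rel: "(p, q) \<in> steps \<Longrightarrow> return_rel B J h p q"
  unfolding steps_def by (auto intro!: return_rel_intro)

lemma orbit_steps:
  assumes "orbit q"
  shows "(q k, q (k + 1)) \<in> steps"
proof -
  obtain l x where l: "l \<in> words B J" "solution l x" "q = state x" by (rule orbit_solution[OF assms])
  note s = l(2)[unfolded solution_def, rule_format]
  have mem: "x (2 * k) \<in> cinterval J (l k)" "x (2 * k + 1) \<in> cinterval J (l k)"
    "x (2 * k + 2) \<in> cinterval J (l (k + 1))" "x (2 * k + 3) \<in> cinterval J (l (k + 1))"
    using s[of "2 * k"] s[of "2 * k + 1"] s[of "2 * k + 2"] s[of "2 * k + 3"] by simp_all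
  have eqs: "vertex_eq B h (x (2 * k + 1)) (x (2 * k)) (x (2 * k + 2)) = 0"
    "vertex_eq B h (x (2 * k + 2)) (x (2 * k + 3)) (x (2 * k + 1)) = 0"
    using s[of "2 * k + 1"] s[of "2 * k + 2"] by (simp_all add: add.assoc add.commute[of 1 "2 * k"])
  have "2 * (k + 1) = 2 * k + 2" "2 * k + 2 + 1 = 2 * k + 3" by simp_all
  then have "(q k, q (k + 1)) = (\<lambda>(x0, x1, x2, x3). ((x0, vO x0 x1), (x2, vO x2 x3)))
      (x (2 * k), x (2 * k + 1), x (2 * k + 2), x (2 * k + 3))"
    unfolding l(3) state_def by (simp add: add.commute[of 3 "2 * k"])
  then show ?thesis
    unfolding steps_def using words_less[OF l(1), of k] words_NA[OF l(1), of k] mem eqs by blast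
qed

lemma return_map_steps: "p \<in> full_orbits B J h \<Longrightarrow> (p, return_map B J h p) \<in> steps"
  and previous_steps: "p \<in> full_orbits B J h \<Longrightarrow> (previous p, p) \<in> steps"
proof -
  assume "p \<in> full_orbits B J h"
  then obtain q where q: "orbit q" "q 0 = p" by (auto simp: full_orbits_iff)
  show "(p, return_map B J h p) \<in> steps" "(previous p, p) \<in> steps"
    using orbit_steps[OF q(1), of 0] orbit_steps[OF q(1), of "- 1"] return_map_orbit[OF q(1), of 0]
      previous_orbit[OF q(1), of 0] q(2) by auto
qed

lemma continuous_return_map: "continuous_on (full_orbits B J h) (return_map B J h)"
proof (rule continuous_on_compact_graph[OF compact_steps])
  fix p q assume "p \<in> full_orbits B J h" "(p, q) \<in> steps"
  then show "q = return_map B J h p" using steps_return_rel return_map_eq by metis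
qed (rule return_map_steps)

text \<open>Swapping the pairs of \<open>steps\<close> gives a compact set which, over the invariant
  set, is the graph of \<open>previous\<close>, because a step determines its start.\<close>

lemma continuous_previous: "continuous_on (full_orbits B J h) previous"
proof (rule continuous_on_compact_graph)
  show "compact (prod.swap ` steps)"
    by (intro compact_continuous_image compact_steps) (auto simp: prod.swap_def intro!: continuous_intros)
  fix p q assume "p \<in> full_orbits B J h" "(p, q) \<in> prod.swap ` steps"
  then show "q = previous p"
    using steps_return_rel previous_rel return_rel_unique_start by (metis pair_in_swap_image)
qed (use previous_steps in force)

lemma continuous_return_iter:
  "continuous_on (full_orbits B J h) (return_iter B J h k) \<and>
   return_iter B J h k ` full_orbits B J h \<subseteq> full_orbits B J h"
proof -
  have "return_map B J h ` full_orbits B J h \<subseteq> full_orbits B J h"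
    "previous ` full_orbits B J h \<subseteq> full_orbits B J h"
    using return_map_in previous_in by auto
  then show ?thesis
    using continuous_funpow[OF continuous_return_map] continuous_funpow[OF continuous_previous]
    by (simp add: return_iter_def previous_def[symmetric])
qed

text \<open>The other parameter intervals are finitely many, closed and disjoint from the one
  containing \<open>fst p\<close>, so avoiding them is an open condition.\<close>

lemma chi_locally_constant:
  assumes "p \<in> full_orbits B J h"
  shows "openin (top_of_set (full_orbits B J h)) {q \<in> full_orbits B J h. chi J q = chi J p}"
proof -
  have chi: "chi J q < num J \<and> fst q \<in> cinterval J (chi J q)" if "q \<in> full_orbits B J h" for q
    using return_map_rel[OF that] by (rule return_rel_elim) (use chi_eq in metis)
  define K where "K = (\<Union>i\<in>{..<num J} - {chi J p}. cinterval J i)"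
  have "closed K" unfolding K_def by (intro closed_UN) auto
  then have "open (fst -` (- K) :: state set)"
    by (intro open_vimage_fst) auto
  moreover have "{q \<in> full_orbits B J h. chi J q = chi J p} = full_orbits B J h \<inter> fst -` (- K)"
  proof (intro equalityI subsetI)
    fix q assume q: "q \<in> {q \<in> full_orbits B J h. chi J q = chi J p}"
    then have "fst q \<notin> K"
      using chi[of q] chi_eq[of _ q] by (auto simp: K_def)
    then show "q \<in> full_orbits B J h \<inter> fst -` (- K)" using q by simp
  next
    fix q assume q: "q \<in> full_orbits B J h \<inter> fst -` (- K)"
    then show "q \<in> {q \<in> full_orbits B J h. chi J q = chi J p}"
      using chi[of q] by (auto simp: K_def)
  qed
  ultimately show ?thesis by (simp add: openin_open_Int)
qed

text \<open>A ball in the word metric contains all words agreeing with its centre on a finite set of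
  places, and each letter is locally constant along a continuous iterate.\<close>

lemma proj_continuous:
  "continuous_map (top_of_set (full_orbits B J h)) (Metric_space.mtopology (words B J) word_dist) (proj B J h)"
proof -
  interpret W: Metric_space "words B J" word_dist by (rule Metric_space_words)
  define X where "X = full_orbits B J h"
  show ?thesis
    unfolding W.continuous_map_to_metric X_def[symmetric]
  proof (intro ballI allI impI)
    fix p and \<epsilon> :: real assume "p \<in> topspace (top_of_set X)" and eps: "0 < \<epsilon>"
    then have p: "p \<in> X" by simp
    obtain N where N: "finite N" "\<And>l l'. (\<forall>k\<in>N. l k = l' k) \<Longrightarrow> word_dist l l' < \<epsilon>"
      using word_dist_small[OF eps] by blast
    define U where "U k = {q \<in> X. chi J (return_iter B J h k q) = chi J (return_iter B J h k p)}" for k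
    have "openin (top_of_set X) (U k)" for k
    proof -
      define Y where "Y = {q \<in> X. chi J q = chi J (return_iter B J h k p)}"
      have c: "continuous_on X (return_iter B J h k)" "return_iter B J h k ` X \<subseteq> X"
        using continuous_return_iter unfolding X_def by auto
      have "openin (top_of_set X) Y"
        unfolding Y_def X_def by (rule chi_locally_constant) (use c p in \<open>auto simp: X_def\<close>)
      then have "openin (top_of_set X) (X \<inter> return_iter B J h k -` Y)"
        using c by (intro continuous_openin_preimage) auto
      moreover have "X \<inter> return_iter B J h k -` Y = U k"
        using c(2) by (auto simp: U_def Y_def)
      ultimately show ?thesis by simp
    qed
    then have "openin (top_of_set X) (X \<inter> (\<Inter>k\<in>N. U k))"
      using N(1) by (cases "N = {}") (auto intro!: openin_Int openin_INT)
    moreover have "p \<in> X \<inter> (\<Inter>k\<in>N. U k)" using p by (auto simp: U_def)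
    moreover have "proj B J h q \<in> W.mball (proj B J h p) \<epsilon>" if q: "q \<in> X \<inter> (\<Inter>k\<in>N. U k)" for q
    proof -
      have "proj B J h p \<in> words B J" "proj B J h q \<in> words B J"
        using proj_image p q unfolding X_def by blast+
      moreover have "word_dist (proj B J h p) (proj B J h q) < \<epsilon>"
        by (rule N(2)) (use q in \<open>auto simp: proj_def U_def\<close>)
      ultimately show ?thesis by simp
    qed
    ultimately show "\<exists>U. openin (top_of_set X) U \<and> p \<in> U \<and> (\<forall>q\<in>U. proj B J h q \<in> W.mball (proj B J h p) \<epsilon>)"
      by blast
  qed
qed

end

subsection \<open>Large inner energy\<close>

text \<open>Refraction preserves the tangential velocity \<open>a\<close>, bounded by the outer
  energy, while the normal part becomes at least \<open>sqrt (2 * h)\<close>. The constant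
  \<open>2 * energy B / omega B\<close> bounds \<open>|a| |p|\<close>, since the boundary lies in
  the disc of radius \<open>sqrt (2 * energy B) / omega B\<close>. Half of \<open>k\<close> is spent
  on the inclination of the position vector to the normal, the other half on
  \<open>a\<close>.\<close>

lemma steep_refraction:
  assumes rb: "refraction_billiard B" and h: "h > 0" and k: "k > 0"
    and n: "norm (normal B x) = 1" "normal B x \<bullet> tangent B x = 0"
    and rad: "\<bar>bdry B x \<bullet> tangent B x\<bar> \<le> k / 2 * (bdry B x \<bullet> normal B x)" "bdry B x \<bullet> normal B x \<ge> r / 2"
    and large: "4 * (2 * energy B / omega B) * (1 + k) \<le> k * r * sqrt (2 * h)"
    and v: "(norm v)\<^sup>2 / 2 = VE B (bdry B x)" "normal B x \<bullet> v < 0"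
  shows "\<bar>Im (cnj (bdry B x) * refract B h x v)\<bar> \<le> k * (- (bdry B x \<bullet> refract B h x v))"
proof -
  define p t nn a w where "p = bdry B x" and "t = tangent B x" and "nn = normal B x"
    and "a = v \<bullet> t" and "w = refract B h x v"
  define b where "b = sqrt (2 * VI B h p - a\<^sup>2)"
  note bd = billiardD(1-3)[OF rb]
  have t1: "norm t = 1" by (simp add: t_def billiardD[OF rb])
  have "a\<^sup>2 \<le> (norm v)\<^sup>2"
    using Cauchy_Schwarz_ineq[of v t] t1 by (simp add: a_def dot_square_norm)
  also have "(norm v)\<^sup>2 = 2 * VE B p" using v by (simp add: p_def)
  finally have aVE: "a\<^sup>2 \<le> 2 * VE B p" .
  have "VE B p \<le> energy B" by (simp add: VE_def)
  then have a2: "a\<^sup>2 \<le> 2 * energy B" using aVE by linarith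
  have "mu B / norm p \<ge> 0" using bd by simp
  then have "VI B h p \<ge> energy B + h" by (simp add: VI_def)
  then have b2: "2 * h \<le> 2 * VI B h p - a\<^sup>2" using a2 by linarith
  then have b: "sqrt (2 * h) \<le> b" unfolding b_def by (rule real_sqrt_le_mono)
  have b0: "b > 0" using b h by (smt (verit) real_sqrt_gt_0_iff)
  have w: "w = a *\<^sub>R t - b *\<^sub>R nn"
    using v(2) by (simp add: w_def refract_def Let_def a_def b_def t_def nn_def p_def inner_commute)
  have im: "\<bar>Im (cnj p * nn)\<bar> = \<bar>p \<bullet> t\<bar>"
    using orthogonal_unit[of nn t] n t1 unfolding nn_def[symmetric] t_def[symmetric]
    by (auto simp: inner_complex_def)
  have "\<bar>a\<bar> \<le> sqrt (2 * energy B)" using a2 by (simp add: real_le_rsqrt)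
  moreover have np: "norm p \<le> sqrt (2 * energy B) / omega B"
    using bdry_props(4)[OF rb, of x] by (simp add: p_def)
  ultimately have "\<bar>a\<bar> * norm p \<le> sqrt (2 * energy B) * (sqrt (2 * energy B) / omega B)"
    by (intro mult_mono) (use bd in auto)
  also have "\<dots> = 2 * energy B / omega B" using bd by simp
  finally have ap: "\<bar>a\<bar> * norm p \<le> 2 * energy B / omega B" .
  have pn: "p \<bullet> nn \<ge> r / 2" and pt: "\<bar>p \<bullet> t\<bar> \<le> k / 2 * (p \<bullet> nn)"
    using rad by (auto simp: p_def t_def nn_def)
  have pn0: "p \<bullet> nn \<ge> 0" using pt k by (smt (verit) abs_ge_zero half_gt_zero mult_pos_neg)
  have main: "\<bar>a\<bar> * norm p * (1 + k) \<le> k / 2 * b * (p \<bullet> nn)"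
  proof -
    have "\<bar>a\<bar> * norm p * (1 + k) \<le> (2 * energy B / omega B) * (1 + k)"
      using ap k by (intro mult_right_mono) auto
    also have "\<dots> \<le> k / 2 * (sqrt (2 * h) * (r / 2))" using large by (simp add: mult_ac)
    also have "\<dots> \<le> k / 2 * (b * (p \<bullet> nn))"
    proof (rule mult_left_mono)
      have "sqrt (2 * h) * (r / 2) \<le> sqrt (2 * h) * (p \<bullet> nn)" using pn h by (intro mult_left_mono) auto
      also have "\<dots> \<le> b * (p \<bullet> nn)" using b pn0 by (intro mult_right_mono)
      finally show "sqrt (2 * h) * (r / 2) \<le> b * (p \<bullet> nn)" .
    qed (use k in simp)
    finally show ?thesis by (simp add: mult_ac)
  qed
  have "\<bar>Im (cnj p * w)\<bar> = \<bar>a * Im (cnj p * t) - b * Im (cnj p * nn)\<bar>"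
    unfolding w by (simp add: algebra_simps)
  also have "\<dots> \<le> \<bar>a\<bar> * \<bar>Im (cnj p * t)\<bar> + b * \<bar>Im (cnj p * nn)\<bar>"
    using abs_triangle_ineq4[of "a * Im (cnj p * t)" "b * Im (cnj p * nn)"] b0 by (simp only: abs_mult abs_of_pos)
  also have "\<dots> \<le> \<bar>a\<bar> * norm p + b * (k / 2 * (p \<bullet> nn))"
  proof (intro add_mono mult_left_mono)
    show "\<bar>Im (cnj p * t)\<bar> \<le> norm p"
      using abs_Im_le_cmod[of "cnj p * t"] t1 by (simp add: norm_mult)
    show "\<bar>Im (cnj p * nn)\<bar> \<le> k / 2 * (p \<bullet> nn)" unfolding im by (rule pt)
  qed (use b0 in auto)
  finally have 1: "\<bar>Im (cnj p * w)\<bar> \<le> \<bar>a\<bar> * norm p + b * (k / 2 * (p \<bullet> nn))" .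
  have "\<bar>a * (p \<bullet> t)\<bar> \<le> \<bar>a\<bar> * norm p"
    using Cauchy_Schwarz_ineq2[of p t] t1 by (simp add: abs_mult mult_left_mono)
  moreover have "- (p \<bullet> w) = b * (p \<bullet> nn) - a * (p \<bullet> t)"
    unfolding w by (simp add: inner_diff_right)
  ultimately have "b * (p \<bullet> nn) - \<bar>a\<bar> * norm p \<le> - (p \<bullet> w)" by linarith
  then have "k * (b * (p \<bullet> nn) - \<bar>a\<bar> * norm p) \<le> k * (- (p \<bullet> w))"
    using k by (intro mult_left_mono) auto
  moreover have "\<bar>a\<bar> * norm p + b * (k / 2 * (p \<bullet> nn)) \<le> k * (b * (p \<bullet> nn) - \<bar>a\<bar> * norm p)"
    using main by (simp add: algebra_simps)
  ultimately show ?thesis using 1 unfolding p_def w_def by linarith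
qed

text \<open>Divided by \<open>- sqrt (2 H)\<close>, a vertex equation reads
  \<open>\<rho>' = e NI + s NE\<close>; the sign \<open>sg\<close> makes its left side increasing
  with rate \<open>c\<close>. A perturbation of Lipschitz constant at most \<open>c / 8\<close>
  leaves the rate \<open>c / 2\<close> and a coupling of at most \<open>c / 4\<close>, half of that
  rate, as \<open>contracting_equations\<close> demands. The second smallness condition preserves
  the signs at the interval ends.\<close>

lemma sequences_unique:
  fixes xi sg :: "nat \<Rightarrow> real"
  assumes l: "l \<in> words B J" and H: "energy B + h > 0"
    and ivl: "\<And>i. i < num J \<Longrightarrow> cleft J i < xi i \<and> xi i < cright J i \<and> cright J i - cleft J i \<le> M"
  defines "e \<equiv> mu B / (energy B + h)" and "s \<equiv> 1 / sqrt (2 * (energy B + h))"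
  assumes e: "e \<ge> 0" and C: "C \<ge> 0" and c: "c > 0"
    and small: "e * C + s * C \<le> c / 8"
    "\<And>i. i < num J \<Longrightarrow> e * C + s * C \<le> c * (xi i - cleft J i) \<and> e * C + s * C \<le> c * (cright J i - xi i)"
    and rho: "\<And>i x y. i < num J \<Longrightarrow> x \<in> cinterval J i \<Longrightarrow> y \<in> cinterval J i \<Longrightarrow> x \<le> y \<Longrightarrow>
      c * (y - x) \<le> sg i * (rho1 B y - rho1 B x)"
    and sg: "\<And>i. i < num J \<Longrightarrow> \<bar>sg i\<bar> = 1 \<and> rho1 B (xi i) = 0"
    and contr: "\<And>x. isCont (rho1 B) x"
    and NE: "\<And>i x y. i < num J \<Longrightarrow> x \<in> cinterval J i \<Longrightarrow> y \<in> cinterval J i \<Longrightarrow> \<bar>NE B x y\<bar> \<le> C"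
    "\<And>i x y x' y'. i < num J \<Longrightarrow> x \<in> cinterval J i \<Longrightarrow> y \<in> cinterval J i \<Longrightarrow>
       x' \<in> cinterval J i \<Longrightarrow> y' \<in> cinterval J i \<Longrightarrow>
       \<bar>NE B x y - NE B x' y'\<bar> \<le> C * (\<bar>x - x'\<bar> + \<bar>y - y'\<bar>)"
    and NI: "\<And>i j x y. i < num J \<Longrightarrow> j \<in> NA B J i \<Longrightarrow> x \<in> cinterval J i \<Longrightarrow> y \<in> cinterval J j \<Longrightarrow>
       \<bar>NI B e x y\<bar> \<le> C"
    "\<And>i j x y x' y'. i < num J \<Longrightarrow> j \<in> NA B J i \<Longrightarrow> x \<in> cinterval J i \<Longrightarrow> y \<in> cinterval J j \<Longrightarrow>
       x' \<in> cinterval J i \<Longrightarrow> y' \<in> cinterval J j \<Longrightarrow>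
       \<bar>NI B e x y - NI B e x' y'\<bar> \<le> C * (\<bar>x - x'\<bar> + \<bar>y - y'\<bar>)"
    and wI: "\<And>i j x y. i < num J \<Longrightarrow> j \<in> NA B J i \<Longrightarrow> x \<in> cinterval J i \<Longrightarrow> y \<in> cinterval J j \<Longrightarrow>
       wI e (bdry B x) (bdry B y) \<bullet> tangent B x = e * NI B e x y - rho1 B x"
  shows "\<exists>!x. \<forall>n. x n \<in> cinterval J (l (n div 2)) \<and>
      vertex_eq B h (x n) (x (if even n then n + 1 else n - 1)) (x (if even n then n - 1 else n + 1)) = 0"
proof -
  define i where "i n = l (n div 2)" for n :: int
  \<comment> \<open>\<open>contracting_equations\<close> passes the previous and the next neighbour
    in this order; the parity of \<open>n\<close> decides which of them belongs to the inner and
    which to the outer arc.\<close>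
  define F where "F n x y z = sg (i n) * (rho1 B x - e * NI B e x (if even n then y else z)
      - s * NE B x (if even n then z else y))" for n :: int and x y z
  have s: "s > 0" using H by (simp add: s_def)
  have il: "i n < num J" for n using l by (simp add: words_def i_def)
  have near: "if even n then i (n + 1) = i n \<and> i (n - 1) \<in> NA B J (i n)
      else i (n - 1) = i n \<and> i (n + 1) \<in> NA B J (i n)" for n
  proof (cases "even n")
    case True
    then obtain k where n: "n = 2 * k" by (rule evenE)
    have "(2 * k - 1) div 2 = k - 1" by simp
    moreover have "l (k - 1 + 1) \<in> NA B J (l (k - 1))" "l (k - 1) < num J"
      using l unfolding words_def by blast+
    ultimately show ?thesis using True NA_commute[of "l (k - 1)" J "l k" B] by (simp add: i_def n)
  next
    case False
    then obtain k where n: "n = 2 * k + 1" by (rule oddE)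
    have "(2 * k + 2) div 2 = k + 1" by simp
    moreover have "l (k + 1) \<in> NA B J (l k)" using l unfolding words_def by blast
    ultimately show ?thesis using False by (simp add: i_def n add.assoc)
  qed
  define a b where "a n = cleft J (i n)" and "b n = cright J (i n)" for n
  have mem: "(if even n then z else y) \<in> cinterval J (i n) \<and>
      (\<exists>j\<in>NA B J (i n). \<forall>y' z'. y' \<in> {a (n-1)..b (n-1)} \<longrightarrow> z' \<in> {a (n+1)..b (n+1)} \<longrightarrow>
        (if even n then y' else z') \<in> cinterval J j)"
    if "y \<in> {a (n-1)..b (n-1)}" "z \<in> {a (n+1)..b (n+1)}" for n y z
    using near[of n] that by (cases "even n") (auto simp: a_def b_def)
  have ex: "\<exists>!x. \<forall>n. x n \<in> {a n..b n} \<and> F n (x n) (x (n - 1)) (x (n + 1)) = 0"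
  proof (rule contracting_equations[where c = "c / 2" and M = M])
    show "a n \<le> b n" "b n - a n \<le> M" for n using ivl[OF il[of n]] by (auto simp: a_def b_def)
    show "c / 2 > 0" using c by simp
    fix n y z assume yz: "y \<in> {a (n-1)..b (n-1)}" "z \<in> {a (n+1)..b (n+1)}"
    define Y Z where "Y = (if even n then y else z)" and "Z = (if even n then z else y)"
    obtain j where j: "j \<in> NA B J (i n)" "Y \<in> cinterval J j"
        "\<And>y' z'. y' \<in> {a (n-1)..b (n-1)} \<Longrightarrow> z' \<in> {a (n+1)..b (n+1)} \<Longrightarrow>
          (if even n then y' else z') \<in> cinterval J j"
      using mem[OF yz] yz unfolding Y_def by blast
    have Z: "Z \<in> cinterval J (i n)" using mem[OF yz] unfolding Z_def by blast
    have F: "F n x y z = sg (i n) * (rho1 B x - e * NI B e x Y - s * NE B x Z)" for x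
      by (simp add: F_def Y_def Z_def)
    have sgi: "\<bar>sg (i n)\<bar> = 1" "rho1 B (xi (i n)) = 0" using sg[OF il[of n]] by auto
    have sgb: "\<bar>sg (i n) * t\<bar> = \<bar>t\<bar>" for t using sgi by (simp add: abs_mult)
    have xi: "xi (i n) \<in> cinterval J (i n)" "a n \<in> cinterval J (i n)" "b n \<in> cinterval J (i n)"
      using ivl[OF il[of n]] by (auto simp: a_def b_def)
    note lipE = NE(2)[OF il[of n]] and lipI = NI(2)[OF il[of n] j(1)]
    show "continuous_on {a n..b n} (\<lambda>x. F n x y z)"
    proof -
      have "continuous_on {a n..b n} (\<lambda>x. NE B x Z)"
        by (rule lipschitz_on_continuous_on[of C], rule lipschitz_onI)
          (use lipE[OF _ Z _ Z] C in \<open>auto simp: dist_real_def a_def b_def\<close>)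
      moreover have "continuous_on {a n..b n} (\<lambda>x. NI B e x Y)"
        by (rule lipschitz_on_continuous_on[of C], rule lipschitz_onI)
          (use lipI[OF _ j(2) _ j(2)] C in \<open>auto simp: dist_real_def a_def b_def\<close>)
      moreover have "continuous_on {a n..b n} (rho1 B)"
        using contr by (simp add: continuous_at_imp_continuous_on)
      ultimately show ?thesis unfolding F by (intro continuous_intros)
    qed
    have pert: "\<bar>sg (i n) * (e * NI B e x Y + s * NE B x Z)\<bar> \<le> e * C + s * C"
      if "x \<in> cinterval J (i n)" for x
    proof -
      have "\<bar>e * NI B e x Y + s * NE B x Z\<bar> \<le> e * \<bar>NI B e x Y\<bar> + s * \<bar>NE B x Z\<bar>"
        using abs_triangle_ineq[of "e * NI B e x Y" "s * NE B x Z"] e s by (simp add: abs_mult)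
      also have "\<dots> \<le> e * C + s * C"
        using NI(1)[OF il j(1) that j(2)] NE(1)[OF il that Z] e s by (intro add_mono mult_left_mono) auto
      finally show ?thesis by (simp add: sgb)
    qed
    have F': "F n x y z = sg (i n) * rho1 B x - sg (i n) * (e * NI B e x Y + s * NE B x Z)" for x
      by (simp add: F algebra_simps)
    show "F n (a n) y z \<le> 0 \<and> F n (b n) y z \<ge> 0"
    proof
      have "sg (i n) * rho1 B (a n) \<le> - (c * (xi (i n) - a n))"
        using rho[OF il[of n] xi(2,1)] ivl[OF il[of n]] sgi by (simp add: a_def)
      then show "F n (a n) y z \<le> 0"
        using pert[OF xi(2)] small(2)[OF il[of n]] unfolding F' a_def by linarith
      have "sg (i n) * rho1 B (b n) \<ge> c * (b n - xi (i n))"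
        using rho[OF il[of n] xi(1,3)] ivl[OF il[of n]] sgi by (simp add: b_def)
      then show "F n (b n) y z \<ge> 0"
        using pert[OF xi(3)] small(2)[OF il[of n]] unfolding F' b_def by linarith
    qed
    have diff: "\<bar>sg (i n) * (e * (NI B e x Y - NI B e x' Y') + s * (NE B x Z - NE B x' Z'))\<bar>
        \<le> (e * C + s * C) * (\<bar>x - x'\<bar> + d)"
      if "x \<in> cinterval J (i n)" "x' \<in> cinterval J (i n)" "Y' \<in> cinterval J j" "Z' \<in> cinterval J (i n)"
        "\<bar>Y - Y'\<bar> \<le> d" "\<bar>Z - Z'\<bar> \<le> d" for x x' Y' Z' d
    proof -
      have "\<bar>e * (NI B e x Y - NI B e x' Y') + s * (NE B x Z - NE B x' Z')\<bar>
          \<le> e * \<bar>NI B e x Y - NI B e x' Y'\<bar> + s * \<bar>NE B x Z - NE B x' Z'\<bar>"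
        using abs_triangle_ineq[of "e * (NI B e x Y - NI B e x' Y')" "s * (NE B x Z - NE B x' Z')"] e s
        by (simp add: abs_mult)
      also have "\<dots> \<le> e * (C * (\<bar>x - x'\<bar> + \<bar>Y - Y'\<bar>)) + s * (C * (\<bar>x - x'\<bar> + \<bar>Z - Z'\<bar>))"
        using lipI[OF that(1) j(2) that(2,3)] lipE[OF that(1) Z that(2,4)] e s
        by (intro add_mono mult_left_mono) auto
      also have "\<dots> \<le> e * (C * (\<bar>x - x'\<bar> + d)) + s * (C * (\<bar>x - x'\<bar> + d))"
        using that e s C by (intro add_mono mult_left_mono) auto
      also have "\<dots> = (e * C + s * C) * (\<bar>x - x'\<bar> + d)" by (simp add: algebra_simps)
      finally show ?thesis by (simp add: sgb)
    qed
    show "c / 2 * (x' - x) \<le> F n x' y z - F n x y z" if x: "a n \<le> x" "x \<le> x'" "x' \<le> b n" for x x'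
    proof -
      have xx: "x \<in> cinterval J (i n)" "x' \<in> cinterval J (i n)" using x by (auto simp: a_def b_def)
      have "\<bar>sg (i n) * (e * (NI B e x Y - NI B e x' Y) + s * (NE B x Z - NE B x' Z))\<bar>
          \<le> (e * C + s * C) * (\<bar>x - x'\<bar> + 0)"
        by (rule diff[OF xx j(2) Z]) auto
      also have "\<dots> \<le> c / 8 * (x' - x)"
        using small(1) x c by (intro mult_mono) auto
      finally have "\<bar>sg (i n) * (e * (NI B e x Y - NI B e x' Y) + s * (NE B x Z - NE B x' Z))\<bar> \<le> c / 8 * (x' - x)" .
      moreover have "F n x' y z - F n x y z = sg (i n) * (rho1 B x' - rho1 B x)
          + sg (i n) * (e * (NI B e x Y - NI B e x' Y) + s * (NE B x Z - NE B x' Z))"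
        by (simp add: F algebra_simps)
      moreover have "c * (x' - x) \<le> sg (i n) * (rho1 B x' - rho1 B x)"
        by (rule rho[OF il xx x(2)])
      moreover have "c / 8 * (x' - x) \<le> c / 2 * (x' - x)" using c x by (intro mult_right_mono) auto
      moreover have "c * (x' - x) = c / 2 * (x' - x) + c / 2 * (x' - x)" by simp
      ultimately show ?thesis by linarith
    qed
    show "\<bar>F n x y z - F n x y' z'\<bar> \<le> c / 2 / 2 * d"
      if x: "x \<in> {a n..b n}" and yz': "y' \<in> {a (n-1)..b (n-1)}" "z' \<in> {a (n+1)..b (n+1)}"
        and d: "\<bar>y - y'\<bar> \<le> d" "\<bar>z - z'\<bar> \<le> d" for x y' z' d
    proof -
      define Y' Z' where "Y' = (if even n then y' else z')" and "Z' = (if even n then z' else y')"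
      have xx: "x \<in> cinterval J (i n)" using x by (auto simp: a_def b_def)
      have Y': "Y' \<in> cinterval J j" "Z' \<in> cinterval J (i n)"
        using j(3)[OF yz'] mem[OF yz'] by (auto simp: Y'_def Z'_def)
      have "\<bar>F n x y z - F n x y' z'\<bar>
          = \<bar>sg (i n) * (e * (NI B e x Y - NI B e x Y') + s * (NE B x Z - NE B x Z'))\<bar>"
      proof -
        have "F n x y z - F n x y' z'
            = - (sg (i n) * (e * (NI B e x Y - NI B e x Y') + s * (NE B x Z - NE B x Z')))"
        proof -
          have "F n x y' z' = sg (i n) * (rho1 B x - e * NI B e x Y' - s * NE B x Z')"
            by (simp add: F_def Y'_def Z'_def)
          then show ?thesis unfolding F by (simp add: algebra_simps)
        qed
        then show ?thesis by (simp only: abs_minus_cancel)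
      qed
      also have "\<dots> \<le> (e * C + s * C) * (\<bar>x - x\<bar> + d)"
        by (rule diff[OF xx xx Y']) (use d in \<open>auto simp: Y_def Z_def Y'_def Z'_def\<close>)
      also have "\<dots> \<le> c / 2 / 2 * d"
      proof -
        have "e * C + s * C \<le> c / 2 / 2" "d \<ge> 0" using small(1) c d by linarith+
        then have "(e * C + s * C) * d \<le> c / 2 / 2 * d" by (rule mult_right_mono)
        then show ?thesis by simp
      qed
      finally show ?thesis .
    qed
  qed
  have equiv: "(\<forall>n. x n \<in> {a n..b n} \<and> F n (x n) (x (n - 1)) (x (n + 1)) = 0) \<longleftrightarrow>
      (\<forall>n. x n \<in> cinterval J (l (n div 2)) \<and>
      vertex_eq B h (x n) (x (if even n then n + 1 else n - 1)) (x (if even n then n - 1 else n + 1)) = 0)"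
    for x :: "int \<Rightarrow> real"
  proof -
    have ab: "{a n..b n} = cinterval J (l (n div 2))" for n by (simp add: a_def b_def i_def)
    have "F n (x n) (x (n - 1)) (x (n + 1)) = 0 \<longleftrightarrow>
        vertex_eq B h (x n) (x (if even n then n + 1 else n - 1)) (x (if even n then n - 1 else n + 1)) = 0"
      if x: "\<forall>n. x n \<in> {a n..b n}" for n
    proof -
      define y z where "y = x (if even n then n - 1 else n + 1)" and "z = x (if even n then n + 1 else n - 1)"
      have xm: "x k \<in> cinterval J (i k)" for k using x[rule_format, of k] by (simp add: a_def b_def)
      obtain j where j: "j \<in> NA B J (i n)" "y \<in> cinterval J j"
        using near[of n] xm[of "n - 1"] xm[of "n + 1"] that unfolding y_def by (cases "even n") auto
      have R: "sqrt (2 * (energy B + h)) > 0" using H by simp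
      have "vertex_eq B h (x n) z y = NE B (x n) z + sqrt (2 * (energy B + h)) * (e * NI B e (x n) y - rho1 B (x n))"
        using wI[OF il j(1) xm j(2)] by (simp add: vertex_eq_def NE_def e_def)
      also have "\<dots> = - sqrt (2 * (energy B + h)) * (rho1 B (x n) - e * NI B e (x n) y - s * NE B (x n) z)"
        using R by (simp add: s_def algebra_simps)
      finally have "vertex_eq B h (x n) z y = 0 \<longleftrightarrow> rho1 B (x n) - e * NI B e (x n) y - s * NE B (x n) z = 0"
        using R by simp
      moreover have "F n (x n) (x (n - 1)) (x (n + 1)) = sg (i n) * (rho1 B (x n) - e * NI B e (x n) y - s * NE B (x n) z)"
        by (simp add: F_def y_def z_def if_distrib)
      moreover have "sg (i n) \<noteq> 0" using sg[OF il[of n]] by auto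
      ultimately show ?thesis unfolding y_def z_def by simp
    qed
    then show ?thesis unfolding ab by blast
  qed
  show ?thesis using ex unfolding equiv .
qed

lemma large_energy_limits:
  fixes E mu C :: real
  shows "((\<lambda>h. mu / (E + h)) \<longlongrightarrow> 0) at_top"
    "((\<lambda>h. mu / (E + h) * C + 1 / sqrt (2 * (E + h)) * C) \<longlongrightarrow> 0) at_top"
    "filterlim (\<lambda>h::real. sqrt (2 * h)) at_top at_top"
proof -
  have lin: "filterlim (\<lambda>h. E + h) at_top at_top"
    by (rule filterlim_tendsto_add_at_top[OF tendsto_const filterlim_ident])
  show e: "((\<lambda>h. mu / (E + h)) \<longlongrightarrow> 0) at_top"
    by (rule tendsto_divide_0[OF tendsto_const filterlim_at_top_imp_at_infinity[OF lin]])
  have dbl: "filterlim (\<lambda>h. 2 * f h) at_top at_top" if "filterlim f at_top at_top" for f :: "real \<Rightarrow> real"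
    by (rule filterlim_tendsto_pos_mult_at_top[OF tendsto_const _ that]) simp
  have "filterlim (\<lambda>h. sqrt (2 * (E + h))) at_top at_top"
    by (rule filterlim_compose[OF sqrt_at_top dbl[OF lin]])
  then have "((\<lambda>h. 1 / sqrt (2 * (E + h))) \<longlongrightarrow> 0) at_top"
    by (intro tendsto_divide_0[OF tendsto_const] filterlim_at_top_imp_at_infinity)
  then have "((\<lambda>h. mu / (E + h) * C + 1 / sqrt (2 * (E + h)) * C) \<longlongrightarrow> 0 * C + 0 * C) at_top"
    using e by (intro tendsto_add tendsto_mult tendsto_const)
  then show "((\<lambda>h. mu / (E + h) * C + 1 / sqrt (2 * (E + h)) * C) \<longlongrightarrow> 0) at_top" by simp
  show "filterlim (\<lambda>h::real. sqrt (2 * h)) at_top at_top"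
    by (rule filterlim_compose[OF sqrt_at_top dbl[OF filterlim_ident]])
qed

theorem theorem1p12:
  fixes B :: billiard and m :: nat and xi :: "nat \<Rightarrow> real"
  assumes "refraction_billiard B"
    and "m \<ge> 2"
    and "\<forall>i<m. nondegenerate_cc B (xi i)"
    and "inj_on (\<lambda>i. bdry B (xi i)) {..<m}"
    and "m = 2 \<longrightarrow> \<not> antipodal B (xi 0) (xi 1)"
  shows "\<exists>\<delta>>0. \<forall>J. num J = m \<and> intervals_around B J xi \<and> admissible B J \<and>
           strictly_curved B J \<and>
           (\<forall>i<m. xi i - \<delta> < oleft J i \<and> oright J i < xi i + \<delta>) \<longrightarrow>
         (\<exists>hs>0. \<forall>h>hs.
           continuous_map (top_of_set (full_orbits B J h))
             (Metric_space.mtopology (words B J) word_dist) (proj B J h) \<and>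
           proj B J h ` full_orbits B J h = words B J \<and>
           (\<forall>p\<in>full_orbits B J h.
              return_map B J h p \<in> full_orbits B J h \<and>
              proj B J h (return_map B J h p) = shift (proj B J h p)) \<and>
           inj_on (proj B J h) (full_orbits B J h))"
proof -
  note rb = assms(1)
  have nd: "nondegenerate_cc B (xi i)" "central_configuration B (xi i)" "C2_near (bdry B) (xi i)" if "i < m" for i
    using assms(3) that by (auto simp: nondegenerate_cc_def)
  \<comment> \<open>The radius is chosen before the intervals, so the relevant pairs are described
    by the configurations alone. Letters that may follow each other form such a pair, by
    \<open>NAp\<close> below.\<close>
  define pair where "pair i j \<longleftrightarrow> i < m \<and> j < m \<and> \<not> antipodal B (xi i) (xi j)" for i j
  have pair_refl: "pair i i" if "i < m" for i
    using that bdry_props(3)[OF rb] by (auto simp: pair_def antipodal_def)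
  have pos: "norm (bdry B (xi i)) * norm (bdry B (xi j)) + bdry B (xi i) \<bullet> bdry B (xi j) > 0" if "pair i j" for i j
    using not_antipodal_pos[OF rb] that by (simp add: pair_def)

  define rhoQ where "rhoQ i sg c d \<longleftrightarrow> (\<forall>x y. \<bar>x - xi i\<bar> < d \<longrightarrow> \<bar>y - xi i\<bar> < d \<longrightarrow> x \<le> y \<longrightarrow>
      c * (y - x) \<le> sg * (rho1 B y - rho1 B x))" for i and sg c d :: real
  define NEQ where "NEQ i C d \<longleftrightarrow> (\<forall>x y. \<bar>x - xi i\<bar> < d \<longrightarrow> \<bar>y - xi i\<bar> < d \<longrightarrow>
      \<bar>NE B x y\<bar> \<le> C \<and> (\<forall>x' y'. \<bar>x' - xi i\<bar> < d \<longrightarrow> \<bar>y' - xi i\<bar> < d \<longrightarrow>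
        \<bar>NE B x y - NE B x' y'\<bar> \<le> C * (\<bar>x - x'\<bar> + \<bar>y - y'\<bar>)))" for i and C d :: real
  define outQ where "outQ i d \<longleftrightarrow> (\<forall>x y. \<bar>x - xi i\<bar> < d \<longrightarrow> \<bar>y - xi i\<bar> < d \<longrightarrow>
      discE B (bdry B x) (bdry B y) \<ge> 0 \<and> \<bar>cE B (bdry B x) (bdry B y)\<bar> < 1 \<and>
      normal B x \<bullet> vE B (bdry B x) (bdry B y) > 0 \<and>
      (\<forall>lam et. lam > 0 \<longrightarrow> \<bar>et\<bar> \<le> 2 / (1 - cE B (bdry B x) (bdry B y)) \<longrightarrow>
         bdry B x + lam *\<^sub>R (bdry B x + et *\<^sub>R (bdry B y - bdry B x)) \<notin> closure (region B)))" for i and d :: real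
  define NIQ where "NIQ i j C d \<longleftrightarrow> (\<forall>e x y. \<bar>e - 0\<bar> < d \<longrightarrow> \<bar>x - xi i\<bar> < d \<longrightarrow> \<bar>y - xi j\<bar> < d \<longrightarrow>
      \<bar>NI B e x y\<bar> \<le> C \<and> (\<forall>x' y'. \<bar>x' - xi i\<bar> < d \<longrightarrow> \<bar>y' - xi j\<bar> < d \<longrightarrow>
        \<bar>NI B e x y - NI B e x' y'\<bar> \<le> C * (\<bar>x - x'\<bar> + \<bar>y - y'\<bar>)))" for i j and C d :: real
  define innQ where "innQ i j d \<longleftrightarrow> (\<forall>e x y. \<bar>e - 0\<bar> < d \<longrightarrow> \<bar>x - xi i\<bar> < d \<longrightarrow> \<bar>y - xi j\<bar> < d \<longrightarrow>
      wI e (bdry B x) (bdry B y) \<bullet> tangent B x = e * NI B e x y - rho1 B x \<and>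
      normal B x \<bullet> wI e (bdry B x) (bdry B y) < 0)" for i j and d :: real
  define choQ where "choQ i j k d \<longleftrightarrow> (\<forall>x y. \<bar>x - xi i\<bar> < d \<longrightarrow> \<bar>y - xi j\<bar> < d \<longrightarrow> bdry B x \<noteq> bdry B y \<longrightarrow>
      k * ((norm (bdry B x))\<^sup>2 - bdry B x \<bullet> bdry B y) < \<bar>Im (cnj (bdry B x) * bdry B y)\<bar>)" for i j and k d :: real
  define radQ where "radQ i k d \<longleftrightarrow> (\<forall>x. \<bar>x - xi i\<bar> < d \<longrightarrow>
      norm (normal B x) = 1 \<and> normal B x \<bullet> tangent B x = 0 \<and>
      \<bar>bdry B x \<bullet> tangent B x\<bar> \<le> k * (bdry B x \<bullet> normal B x) \<and>
      bdry B x \<bullet> normal B x \<ge> norm (bdry B (xi i)) / 2)" for i and k d :: real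

  have "\<exists>sg c. \<bar>sg\<bar> = 1 \<and> c > 0 \<and> (i < m \<longrightarrow> (\<forall>\<^sub>F d in at_right 0. rhoQ i sg c d))" for i
  proof (cases "i < m")
    case True
    then show ?thesis using rho1_monotone[OF rb nd(1)[OF True]] unfolding rhoQ_def by blast
  qed (auto intro: exI[of _ 1])
  then obtain sg c where sg: "\<And>i. \<bar>sg i\<bar> = 1" "\<And>i. c i > 0"
      "\<And>i. i < m \<Longrightarrow> \<forall>\<^sub>F d in at_right 0. rhoQ i (sg i) (c i) d"
    by metis
  have "\<exists>C\<ge>0. i < m \<longrightarrow> (\<forall>\<^sub>F d in at_right 0. NEQ i C d)" for i
    using NE_lipschitz[OF rb nd(3)[of i]] unfolding NEQ_def by blast
  then obtain CE where CE: "\<And>i. CE i \<ge> 0" "\<And>i. i < m \<Longrightarrow> \<forall>\<^sub>F d in at_right 0. NEQ i (CE i) d"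
    by metis
  have "\<exists>C\<ge>0. pair i j \<longrightarrow> (\<forall>\<^sub>F d in at_right 0. NIQ i j C d)" for i j
  proof (cases "pair i j")
    case True
    then have "i < m" by (simp add: pair_def)
    then show ?thesis using NI_lipschitz[OF rb nd(3) pos[OF True]] unfolding NIQ_def by blast
  qed auto
  then obtain CI where CI: "\<And>i j. CI i j \<ge> 0" "\<And>i j. pair i j \<Longrightarrow> \<forall>\<^sub>F d in at_right 0. NIQ i j (CI i j) d"
    by metis
  have "\<exists>k>0. pair i j \<longrightarrow> (\<forall>\<^sub>F d in at_right 0. choQ i j k d)" for i j
  proof (cases "pair i j")
    case True
    then have ij: "i < m" "j < m" "\<not> antipodal B (xi i) (xi j)" by (auto simp: pair_def)
    have "xi j = xi i \<or> Im (cnj (bdry B (xi i)) * bdry B (xi j)) \<noteq> 0"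
    proof (cases "i = j")
      case False
      then have "bdry B (xi i) \<noteq> bdry B (xi j)"
        using assms(4) ij by (auto dest: inj_onD)
      then show ?thesis using distinct_rays[OF rb nd(2)[OF ij(1)] ij(3)] by blast
    qed simp
    then show ?thesis using chord_near[OF rb nd(2)[OF ij(1)]] unfolding choQ_def by blast
  qed (auto intro: exI[of _ 1])
  then obtain ka where ka: "\<And>i j. ka i j > 0" "\<And>i j. pair i j \<Longrightarrow> \<forall>\<^sub>F d in at_right 0. choQ i j (ka i j) d"
    by metis

  have "\<forall>\<^sub>F d in at_right 0. \<forall>i\<in>{..<m}. rhoQ i (sg i) (c i) d \<and> NEQ i (CE i) d \<and> outQ i d"
    using sg(3) CE(2) outer_near[OF rb nd(2)] unfolding outQ_def
    by (intro eventually_ball_finite ballI eventually_conj) auto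
  moreover have "\<forall>\<^sub>F d in at_right 0. \<forall>z\<in>{z \<in> {..<m} \<times> {..<m}. pair (fst z) (snd z)}.
      NIQ (fst z) (snd z) (CI (fst z) (snd z)) d \<and> innQ (fst z) (snd z) d \<and>
      choQ (fst z) (snd z) (ka (fst z) (snd z)) d \<and> radQ (fst z) (ka (fst z) (snd z) / 2) d"
  proof (intro eventually_ball_finite ballI eventually_conj)
    fix z assume "z \<in> {z \<in> {..<m} \<times> {..<m}. pair (fst z) (snd z)}"
    then have z: "fst z < m" "pair (fst z) (snd z)" by auto
    show "\<forall>\<^sub>F d in at_right 0. innQ (fst z) (snd z) d"
      unfolding innQ_def by (rule inner_near[OF rb nd(2)[OF z(1)] pos[OF z(2)]])
    show "\<forall>\<^sub>F d in at_right 0. radQ (fst z) (ka (fst z) (snd z) / 2) d"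
      unfolding radQ_def by (rule radial_near[OF rb nd(2)[OF z(1)]]) (simp add: ka)
    show "\<forall>\<^sub>F d in at_right 0. NIQ (fst z) (snd z) (CI (fst z) (snd z)) d"
      "\<forall>\<^sub>F d in at_right 0. choQ (fst z) (snd z) (ka (fst z) (snd z)) d"
      by (rule CI(2)[OF z(2)] ka(2)[OF z(2)])+
  qed auto
  moreover have "\<forall>\<^sub>F d in at_right (0::real). 0 < d" by (simp add: eventually_at_right_less)
  ultimately have "\<forall>\<^sub>F d in at_right 0. 0 < d \<and>
      (\<forall>i\<in>{..<m}. rhoQ i (sg i) (c i) d \<and> NEQ i (CE i) d \<and> outQ i d) \<and>
      (\<forall>z\<in>{z \<in> {..<m} \<times> {..<m}. pair (fst z) (snd z)}.
      NIQ (fst z) (snd z) (CI (fst z) (snd z)) d \<and> innQ (fst z) (snd z) d \<and>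
      choQ (fst z) (snd z) (ka (fst z) (snd z)) d \<and> radQ (fst z) (ka (fst z) (snd z) / 2) d)"
    by eventually_elim blast
  \<comment> \<open>One radius for the finitely many conditions, found before any intervals are
    given.\<close>
  then obtain \<delta> where \<delta>: "\<delta> > 0" and
      \<delta>1: "\<forall>i\<in>{..<m}. rhoQ i (sg i) (c i) \<delta> \<and> NEQ i (CE i) \<delta> \<and> outQ i \<delta>" and
      \<delta>2: "\<forall>z\<in>{z \<in> {..<m} \<times> {..<m}. pair (fst z) (snd z)}.
      NIQ (fst z) (snd z) (CI (fst z) (snd z)) \<delta> \<and> innQ (fst z) (snd z) \<delta> \<and>
      choQ (fst z) (snd z) (ka (fst z) (snd z)) \<delta> \<and> radQ (fst z) (ka (fst z) (snd z) / 2) \<delta>"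
    using eventually_happens'[OF trivial_limit_at_right_real] by blast
  have single: "rhoQ i (sg i) (c i) \<delta> \<and> NEQ i (CE i) \<delta> \<and> outQ i \<delta>"
    if "i < m" for i
    using \<delta>1 that by blast
  have double: "NIQ i j (CI i j) \<delta> \<and> innQ i j \<delta> \<and> choQ i j (ka i j) \<delta> \<and> radQ i (ka i j / 2) \<delta>"
    if "pair i j" for i j
    using \<delta>2[rule_format, of "(i, j)"] that by (simp add: pair_def)

  show ?thesis
  proof (rule exI[of _ \<delta>], intro conjI allI impI, rule \<delta>)
    fix J assume "num J = m \<and> intervals_around B J xi \<and> admissible B J \<and> strictly_curved B J \<and>
      (\<forall>i<m. xi i - \<delta> < oleft J i \<and> oright J i < xi i + \<delta>)"
    then have J: "num J = m" "intervals_around B J xi" "admissible B J"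
      and close: "\<And>i. i < m \<Longrightarrow> xi i - \<delta> < oleft J i \<and> oright J i < xi i + \<delta>" by auto
    obtain h0 where h0: "outer_property B J" "inner_property B J h0"
      using J(3) unfolding admissible_def by blast
    have ivl: "oleft J i < cleft J i" "cleft J i < xi i" "xi i < cright J i" "cright J i < oright J i"
        "oright J i - oleft J i \<le> len B" if "i < m" for i
      using J(1,2) that by (auto simp: intervals_around_def)
    have sub: "cinterval J i \<subseteq> ointerval J i" "xi i \<in> ointerval J i" if "i < m" for i
      using ivl[OF that] by auto
    have near: "\<bar>x - xi i\<bar> < \<delta>" if "i < m" "x \<in> cinterval J i" for i x
      using that close[OF that(1)] ivl[OF that(1)] by auto
    have NAp: "pair i j" if "i < m" "j \<in> NA B J i" for i j
      using that sub(2)[OF that(1)] sub(2)[of j] J(1) by (auto simp: NA_def not_antipodal_def pair_def)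
    \<comment> \<open>A sum in place of a maximum: all terms are nonnegative, so it dominates each
      of them.\<close>
    define C where "C = (\<Sum>i<m. CE i) + (\<Sum>i<m. \<Sum>j<m. CI i j)"
    have CEC: "CE i \<le> C" if "i < m" for i
    proof -
      have "CE i \<le> (\<Sum>i<m. CE i)" using that CE(1) by (intro member_le_sum) auto
      moreover have "(\<Sum>i<m. \<Sum>j<m. CI i j) \<ge> 0" by (intro sum_nonneg CI)
      ultimately show ?thesis by (simp add: C_def)
    qed
    have CIC: "CI i j \<le> C" if "i < m" "j < m" for i j
    proof -
      have "CI i j \<le> (\<Sum>j<m. CI i j)" using that CI(1) by (intro member_le_sum) auto
      also have "\<dots> \<le> (\<Sum>i<m. \<Sum>j<m. CI i j)" using that by (intro member_le_sum sum_nonneg CI) auto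
      finally show ?thesis using sum_nonneg[of "{..<m}" CE] CE(1) by (simp add: C_def)
    qed
    have C0: "C \<ge> 0" unfolding C_def by (intro add_nonneg_nonneg sum_nonneg CE CI)
    \<comment> \<open>\<open>c0\<close> is a common rate for \<open>\<rho>'\<close>, and
      \<open>g\<close> below is the least distance of a configuration from the ends of its compact
      interval. So \<open>c0 * g\<close> bounds the modulus of \<open>\<rho>'\<close> at the ends
      from below, and the small terms have to stay beneath it.\<close>
    define c0 where "c0 = Min (c ` {..<m})"
    have ne: "{..<m} \<noteq> {}" using assms(2) by (auto simp: lessThan_empty_iff)
    have c0: "c0 > 0" "\<And>i. i < m \<Longrightarrow> c0 \<le> c i" using sg(2) ne by (auto simp: c0_def)
    define g where "g = Min ((\<lambda>i. min (xi i - cleft J i) (cright J i - xi i)) ` {..<m})"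
    have g: "g > 0" using ivl ne by (auto simp: g_def)
    have gi: "g \<le> xi i - cleft J i" "g \<le> cright J i - xi i" if "i < m" for i
    proof -
      have "g \<le> min (xi i - cleft J i) (cright J i - xi i)"
        unfolding g_def using that by (intro Min_le) auto
      then show "g \<le> xi i - cleft J i" "g \<le> cright J i - xi i" by auto
    qed
    have "\<forall>\<^sub>F h in at_top. mu B / (energy B + h) < \<delta>"
      by (rule order_tendstoD(2)[OF large_energy_limits(1) \<delta>])
    moreover have "\<forall>\<^sub>F h in at_top. mu B / (energy B + h) * C + 1 / sqrt (2 * (energy B + h)) * C < min (c0 / 8) (c0 * g)"
      by (rule order_tendstoD(2)[OF large_energy_limits(2)]) (use c0 g in simp)
    moreover have "\<forall>\<^sub>F h in at_top. \<forall>z\<in>{..<m} \<times> {..<m}.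
        4 * (2 * energy B / omega B) * (1 + ka (fst z) (snd z)) / (ka (fst z) (snd z) * norm (bdry B (xi (fst z))))
          \<le> sqrt (2 * h)"
      using large_energy_limits(3) unfolding filterlim_at_top
      by (intro eventually_ball_finite ballI) auto
    ultimately have "\<forall>\<^sub>F h in at_top. mu B / (energy B + h) < \<delta> \<and>
        mu B / (energy B + h) * C + 1 / sqrt (2 * (energy B + h)) * C < min (c0 / 8) (c0 * g) \<and>
        (\<forall>z\<in>{..<m} \<times> {..<m}.
        4 * (2 * energy B / omega B) * (1 + ka (fst z) (snd z)) / (ka (fst z) (snd z) * norm (bdry B (xi (fst z))))
          \<le> sqrt (2 * h)) \<and> h > h0"
      using eventually_gt_at_top[of h0] by eventually_elim blast
    then obtain h1 where h1: "\<And>h. h \<ge> h1 \<Longrightarrow> mu B / (energy B + h) < \<delta> \<and>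
        mu B / (energy B + h) * C + 1 / sqrt (2 * (energy B + h)) * C < min (c0 / 8) (c0 * g) \<and>
        (\<forall>z\<in>{..<m} \<times> {..<m}.
        4 * (2 * energy B / omega B) * (1 + ka (fst z) (snd z)) / (ka (fst z) (snd z) * norm (bdry B (xi (fst z))))
          \<le> sqrt (2 * h)) \<and> h > h0"
      unfolding eventually_at_top_linorder by blast
    \<comment> \<open>Beyond \<open>h1\<close> the smallness conditions and \<open>h > h0\<close>
      hold together; the \<open>1\<close> guarantees \<open>h > 0\<close>.\<close>
    have coded: "coded_billiard B J h" if "h > max 1 h1" for h
    proof -
      have h: "h > 0" "h \<ge> h1" using that by auto
      define e where "e = mu B / (energy B + h)"
      have H: "energy B + h > 0" using billiardD(3)[OF rb] h by simp
      have e: "e > 0" "\<bar>e - 0\<bar> < \<delta>" using h1[OF h(2)] billiardD(2)[OF rb] H by (auto simp: e_def)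
      have small: "e * C + 1 / sqrt (2 * (energy B + h)) * C < min (c0 / 8) (c0 * g)" and hh0: "h > h0"
        using h1[OF h(2)] by (auto simp: e_def)
      have steep: "4 * (2 * energy B / omega B) * (1 + ka i j) \<le> ka i j * norm (bdry B (xi i)) * sqrt (2 * h)"
        if "i < m" "j < m" for i j
      proof -
        have "4 * (2 * energy B / omega B) * (1 + ka i j) / (ka i j * norm (bdry B (xi i))) \<le> sqrt (2 * h)"
          using h1[OF h(2)] that by force
        moreover have "ka i j * norm (bdry B (xi i)) > 0" using ka(1) bdry_props(3)[OF rb] by simp
        moreover have "a \<le> k * s" if "a / k \<le> s" "k > 0" for a k s :: real
          using that by (simp add: pos_divide_le_eq mult.commute)
        ultimately show ?thesis by blast
      qed
      show ?thesis
      proof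
        show "refraction_billiard B" "h > 0" by (rule rb h)+
        show "i = j \<and> x = y" if "i < num J" "j < num J" "x \<in> cinterval J i" "y \<in> cinterval J j"
            "bdry B x = bdry B y" for i j x y
        proof -
          have ij: "i < m" "j < m" using that J by auto
          have xy: "x \<in> ointerval J i" "y \<in> ointerval J j" using that sub(1) ij by blast+
          have "i = j"
          proof (rule ccontr)
            assume "i \<noteq> j"
            then have "bdry B ` ointerval J i \<inter> bdry B ` ointerval J j = {}"
              using J(2) that(1,2) by (auto simp: intervals_around_def)
            then show False using xy that(5) by blast
          qed
          moreover have "\<bar>x - y\<bar> < len B"
            using xy ivl(5)[OF ij(1)] unfolding \<open>i = j\<close> by auto
          ultimately show ?thesis using bdry_eq_iff[OF rb] that(5) by blast
        qed
        show "norm (normal B x) = 1 \<and> normal B x \<bullet> tangent B x = 0"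
          if "i < num J" "x \<in> cinterval J i" for i x
        proof -
          have i: "i < m" using that J by simp
          show ?thesis
            using double[OF pair_refl[OF i]] near[OF i that(2)] unfolding radQ_def by blast
        qed
        show "discE B (bdry B x) (bdry B y) \<ge> 0 \<and> \<bar>cE B (bdry B x) (bdry B y)\<bar> < 1 \<and>
            normal B x \<bullet> vE B (bdry B x) (bdry B y) > 0 \<and>
            (\<forall>lam et. lam > 0 \<longrightarrow> \<bar>et\<bar> \<le> 2 / (1 - cE B (bdry B x) (bdry B y)) \<longrightarrow>
              bdry B x + lam *\<^sub>R (bdry B x + et *\<^sub>R (bdry B y - bdry B x)) \<notin> closure (region B))"
          if "i < num J" "x \<in> cinterval J i" "y \<in> cinterval J i" for i x y
        proof -
          have i: "i < m" using that J by simp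
          have "outQ i \<delta>" using single[OF i] by blast
          then show ?thesis using near[OF i that(2)] near[OF i that(3)] unfolding outQ_def by blast
        qed
        show "unique_arc (outer_arc B x y)"
          if "i < num J" "x \<in> cinterval J i" "y \<in> cinterval J i" for i x y
          using h0(1) that sub(1)[of i] J(1) unfolding outer_property_def by blast
        show "(\<exists>T z v. inner_arc B h x y T z v) \<and> \<not> antipodal B x y \<and>
            normal B x \<bullet> wI (mu B / (energy B + h)) (bdry B x) (bdry B y) < 0"
          if "i < num J" "j \<in> NA B J i" "x \<in> cinterval J i" "y \<in> cinterval J j" for i j x y
        proof -
          have ij: "i < m" "j < m" using that J by (auto simp: NA_def)
          have xy: "x \<in> ointerval J i" "y \<in> ointerval J j" using that sub(1) ij by blast+
          have "unique_arc (inner_arc B h x y)"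
            using h0(2) that(1,2) xy hh0 unfolding inner_property_def by blast
          moreover have "\<not> antipodal B x y"
            using that(2) xy unfolding NA_def not_antipodal_def by blast
          moreover have "innQ i j \<delta>" using double[OF NAp[OF ij(1) that(2)]] by blast
          ultimately show ?thesis
            using e near[OF ij(1) that(3)] near[OF ij(2) that(4)] unfolding innQ_def e_def unique_arc_def by blast
        qed
        show "\<exists>k\<ge>0. \<bar>Im (cnj (bdry B x) * refract B h x v)\<bar> \<le> k * (- (bdry B x \<bullet> refract B h x v)) \<and>
            (bdry B x \<noteq> bdry B y \<longrightarrow>
              k * ((norm (bdry B x))\<^sup>2 - bdry B x \<bullet> bdry B y) < \<bar>Im (cnj (bdry B x) * bdry B y)\<bar>)"
          if "i < num J" "j \<in> NA B J i" "x \<in> cinterval J i" "y \<in> cinterval J j"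
            "(norm v)\<^sup>2 / 2 = VE B (bdry B x)" "normal B x \<bullet> v < 0" for i j x y v
        proof -
          have ij: "i < m" "j < m" using that J by (auto simp: NA_def)
          have d: "choQ i j (ka i j) \<delta>" "radQ i (ka i j / 2) \<delta>"
            using double[OF NAp[OF ij(1) that(2)]] by blast+
          note n = near[OF ij(1) that(3)] near[OF ij(2) that(4)]
          have r: "norm (normal B x) = 1" "normal B x \<bullet> tangent B x = 0"
            "\<bar>bdry B x \<bullet> tangent B x\<bar> \<le> ka i j / 2 * (bdry B x \<bullet> normal B x)"
            "bdry B x \<bullet> normal B x \<ge> norm (bdry B (xi i)) / 2"
            using d(2) n(1) unfolding radQ_def by blast+
          show ?thesis
          proof (rule exI[of _ "ka i j"], intro conjI)
            show "\<bar>Im (cnj (bdry B x) * refract B h x v)\<bar> \<le> ka i j * (- (bdry B x \<bullet> refract B h x v))"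
              by (rule steep_refraction[OF rb h(1) ka(1) r steep[OF ij] that(5,6)])
            show "bdry B x \<noteq> bdry B y \<longrightarrow>
              ka i j * ((norm (bdry B x))\<^sup>2 - bdry B x \<bullet> bdry B y) < \<bar>Im (cnj (bdry B x) * bdry B y)\<bar>"
              using d(1) n unfolding choQ_def by blast
          qed (use ka(1)[of i j] in simp)
        qed
        fix l assume l: "l \<in> words B J"
        show "\<exists>!x. \<forall>n. x n \<in> cinterval J (l (n div 2)) \<and>
          vertex_eq B h (x n) (x (if even n then n + 1 else n - 1)) (x (if even n then n - 1 else n + 1)) = 0"
        proof (rule sequences_unique[OF l H, where xi = xi and sg = sg and C = C and c = c0 and M = "len B",
              folded e_def])
          show "cleft J i < xi i \<and> xi i < cright J i \<and> cright J i - cleft J i \<le> len B" if "i < num J" for i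
            using ivl[of i] that J(1) by auto
          show "e * C + 1 / sqrt (2 * (energy B + h)) * C \<le> c0 / 8" using small by simp
          show "e * C + 1 / sqrt (2 * (energy B + h)) * C \<le> c0 * (xi i - cleft J i) \<and>
              e * C + 1 / sqrt (2 * (energy B + h)) * C \<le> c0 * (cright J i - xi i)" if "i < num J" for i
          proof -
            have i: "i < m" using that J by simp
            have "c0 * g \<le> c0 * (xi i - cleft J i)" "c0 * g \<le> c0 * (cright J i - xi i)"
              using gi[OF i] c0(1) by (auto intro: mult_left_mono)
            then show ?thesis using small by linarith
          qed
          show "c0 * (y - x) \<le> sg i * (rho1 B y - rho1 B x)"
            if "i < num J" "x \<in> cinterval J i" "y \<in> cinterval J i" "x \<le> y" for i x y
          proof -
            have i: "i < m" using that J by simp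
            have "c0 * (y - x) \<le> c i * (y - x)" using c0(2)[OF i] that(4) by (intro mult_right_mono) auto
            also have "\<dots> \<le> sg i * (rho1 B y - rho1 B x)"
              using single[OF i] near[OF i that(2)] near[OF i that(3)] that(4) unfolding rhoQ_def by blast
            finally show ?thesis .
          qed
          show "\<bar>sg i\<bar> = 1 \<and> rho1 B (xi i) = 0" if "i < num J" for i
            using sg(1) rho1_central[OF rb nd(2)] that J(1) by simp
          show "isCont (rho1 B) x" for x
            unfolding rho1_def[abs_def]
            by (intro continuous_intros loclip_isCont[OF loclip_bdry[OF rb]] billiardD(14)[OF rb])
              (use bdry_props(3)[OF rb] in simp)
          show "\<bar>NE B x y\<bar> \<le> C" if "i < num J" "x \<in> cinterval J i" "y \<in> cinterval J i" for i x y
          proof -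
            have i: "i < m" using that J by simp
            have "NEQ i (CE i) \<delta>" using single[OF i] by blast
            then have "\<bar>NE B x y\<bar> \<le> CE i" using near[OF i that(2)] near[OF i that(3)] unfolding NEQ_def by blast
            then show ?thesis using CEC[OF i] by linarith
          qed
          show "\<bar>NE B x y - NE B x' y'\<bar> \<le> C * (\<bar>x - x'\<bar> + \<bar>y - y'\<bar>)"
            if "i < num J" "x \<in> cinterval J i" "y \<in> cinterval J i" "x' \<in> cinterval J i" "y' \<in> cinterval J i" for i x y x' y'
          proof -
            have i: "i < m" using that J by simp
            have "NEQ i (CE i) \<delta>" using single[OF i] by blast
            then have "\<bar>NE B x y - NE B x' y'\<bar> \<le> CE i * (\<bar>x - x'\<bar> + \<bar>y - y'\<bar>)"
              using that(2-5)[THEN near[OF i]] unfolding NEQ_def by blast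
            also have "\<dots> \<le> C * (\<bar>x - x'\<bar> + \<bar>y - y'\<bar>)" using CEC[OF i] by (intro mult_right_mono) auto
            finally show ?thesis .
          qed
          show "\<bar>NI B e x y\<bar> \<le> C"
            if "i < num J" "j \<in> NA B J i" "x \<in> cinterval J i" "y \<in> cinterval J j" for i j x y
          proof -
            have ij: "i < m" "j < m" using that J by (auto simp: NA_def)
            have "NIQ i j (CI i j) \<delta>" using double[OF NAp[OF ij(1) that(2)]] by blast
            then have "\<bar>NI B e x y\<bar> \<le> CI i j"
              using e(2) near[OF ij(1) that(3)] near[OF ij(2) that(4)] unfolding NIQ_def by blast
            then show ?thesis using CIC[OF ij] by linarith
          qed
          show "\<bar>NI B e x y - NI B e x' y'\<bar> \<le> C * (\<bar>x - x'\<bar> + \<bar>y - y'\<bar>)"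
            if "i < num J" "j \<in> NA B J i" "x \<in> cinterval J i" "y \<in> cinterval J j" "x' \<in> cinterval J i"
              "y' \<in> cinterval J j" for i j x y x' y'
          proof -
            have ij: "i < m" "j < m" using that J by (auto simp: NA_def)
            have "NIQ i j (CI i j) \<delta>" using double[OF NAp[OF ij(1) that(2)]] by blast
            then have "\<bar>NI B e x y - NI B e x' y'\<bar> \<le> CI i j * (\<bar>x - x'\<bar> + \<bar>y - y'\<bar>)"
              using e(2) that(3,5)[THEN near[OF ij(1)]] that(4,6)[THEN near[OF ij(2)]] unfolding NIQ_def by blast
            also have "\<dots> \<le> C * (\<bar>x - x'\<bar> + \<bar>y - y'\<bar>)" using CIC[OF ij] by (intro mult_right_mono) auto
            finally show ?thesis .
          qed
          show "wI e (bdry B x) (bdry B y) \<bullet> tangent B x = e * NI B e x y - rho1 B x"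
            if "i < num J" "j \<in> NA B J i" "x \<in> cinterval J i" "y \<in> cinterval J j" for i j x y
          proof -
            have ij: "i < m" "j < m" using that J by (auto simp: NA_def)
            have "innQ i j \<delta>" using double[OF NAp[OF ij(1) that(2)]] by blast
            then show ?thesis
              using e(2) near[OF ij(1) that(3)] near[OF ij(2) that(4)] unfolding innQ_def by blast
          qed
        qed (use e C0 c0 in auto)
      qed
    qed
    show "\<exists>hs>0. \<forall>h>hs.
           continuous_map (top_of_set (full_orbits B J h))
             (Metric_space.mtopology (words B J) word_dist) (proj B J h) \<and>
           proj B J h ` full_orbits B J h = words B J \<and>
           (\<forall>p\<in>full_orbits B J h.
              return_map B J h p \<in> full_orbits B J h \<and>
              proj B J h (return_map B J h p) = shift (proj B J h p)) \<and>
           inj_on (proj B J h) (full_orbits B J h)"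
    proof (rule exI[of _ "max 1 h1"], intro conjI allI impI ballI)
      fix h assume "h > max 1 h1"
      then interpret coded_billiard B J h by (rule coded)
      show "continuous_map (top_of_set (full_orbits B J h))
          (Metric_space.mtopology (words B J) word_dist) (proj B J h)"
        "proj B J h ` full_orbits B J h = words B J" "inj_on (proj B J h) (full_orbits B J h)"
        by (rule proj_continuous proj_image proj_inj)+
      fix p assume "p \<in> full_orbits B J h"
      then show "return_map B J h p \<in> full_orbits B J h"
        "proj B J h (return_map B J h p) = shift (proj B J h p)"
        by (rule return_map_in proj_shift)+
    qed auto
  qed
qed

end
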